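(* Over $\mathsf{RCA}_0^\omega$ there is an explicit equivalence between $\mathsf{UDNR}$ and $(\mu^2)$; that is, $\mathsf{RCA}_0^\omega$ proves $\mathsf{UDNR}\leftrightarrow(\mu^2)$, and both implications are explicit, where $$\mathsf{UDNR}:\quad (\exists \Psi^{1\to1})(\forall A^{1})(\forall e^{0})\big(\Psi(A)(e)\ne \Phi_{e}^{A}(e)\big).$$
   Context: Types: $0$ is the type of natural numbers, $1=0\to 0$, $2=1\to 0$. Sets of naturals are type-1 objects given by binary characteristic functions. $\mathsf{RCA}_0^\omega$ is Kohlenbach's base theory of higher-order Reverse Mathematics, namely $\mathsf{E}\text{-}\mathsf{PRA}^\omega+\mathsf{QF}\text{-}\mathsf{AC}^{1,0}$: here $\mathsf{E}\text{-}\mathsf{PRA}^\omega$ is classical extensional primitive recursive arithmetic in all finite types (combinators, recursor for type 0 only, quantifier-free induction, and the extensionality axiom $(\forall\varphi^{\rho\to\tau})(\forall x^\rho,y^\rho)[x=_\rho y\to\varphi(x)=_\tau\varphi(y)]$, equality at higher types being defined pointwise from $=_0$), and $\mathsf{QF}\text{-}\mathsf{AC}^{1,0}$ is $(\forall f^1)(\exists n^0)\varphi_0(f,n)\to(\exists F^2)(\forall f^1)\varphi_0(f,F(f))$ for quantifier-free $\varphi_0$. $(\mu^2)$ (Feferman's mu-operator) is $(\exists\mu^2)(\forall f^1)\big[(\exists n^0)f(n)=0\to f(\mu(f))=0\big]$. $\Phi^A_e$ is the $e$-th partial computable function with oracle $A$; $\Psi(A)(e)\neq\Phi_e^A(e)$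 means that if $\Phi_e^A(e)$ halts with output $y$ then $\Psi(A)(e)\ne y$. An implication $(\exists \Phi)A(\Phi)\to(\exists\Psi)B(\Psi)$ is explicit if there is a term $t$ of the language such that additionally $(\forall\Phi)[A(\Phi)\to B(t(\Phi))]$ is provable. By convention the implication is still called explicit if $t$ takes as an additional argument an extensionality functional for $\Phi$, i.e. a functional $\Xi$ such that $(\forall k^0,f^1,g^1)[\overline f\,\Xi(f,g,k)=\overline g\,\Xi(f,g,k)\to\overline{\Phi(f)}k=\overline{\Phi(g)}k]$, where $\overline f n$ is the initial segment of $f$ of length $n$. An explicit equivalence is one in which both implications are explicit. *)

theory Defs
  imports Main
begin

section \<open>Finite types and terms of E-PRA\<open>\<^sup>\<omega>\<close>\<close>

text \<open>\<open>N\<close> is the type \<open>0\<close> of natural numbers.\<close>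

datatype ty = N | Fn ty ty  (infixr "\<Rrightarrow>" 80)

abbreviation ty1 :: ty where "ty1 \<equiv> N \<Rrightarrow> N"
abbreviation ty2 :: ty where "ty2 \<equiv> ty1 \<Rrightarrow> N"

text \<open>A variable carries its type; variables of different types are different variables.\<close>

type_synonym var = "nat \<times> ty"

datatype trm =
    Var var
  | Zero
  | Succ
  | PiC ty ty
  | SigC ty ty ty
  | Rec
  | App trm trm  (infixl "\<cdot>" 90)

fun has_type :: "trm \<Rightarrow> ty \<Rightarrow> bool" where
  "has_type (Var x) \<tau> \<longleftrightarrow> \<tau> = snd x"
| "has_type Zero \<tau> \<longleftrightarrow> \<tau> = N"
| "has_type Succ \<tau> \<longleftrightarrow> \<tau> = N \<Rrightarrow> N"
| "has_type (PiC \<rho> \<sigma>) \<tau> \<longleftrightarrow> \<tau> = \<rho> \<Rrightarrow> \<sigma> \<Rrightarrow> \<rho>"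
| "has_type (SigC \<delta> \<rho> \<sigma>) \<tau> \<longleftrightarrow> \<tau> = (\<delta> \<Rrightarrow> \<rho> \<Rrightarrow> \<sigma>) \<Rrightarrow> (\<delta> \<Rrightarrow> \<rho>) \<Rrightarrow> \<delta> \<Rrightarrow> \<sigma>"
| "has_type Rec \<tau> \<longleftrightarrow> \<tau> = N \<Rrightarrow> N \<Rrightarrow> (N \<Rrightarrow> N \<Rrightarrow> N) \<Rrightarrow> N"
| "has_type (s \<cdot> t) \<tau> \<longleftrightarrow> (\<exists>\<sigma>. has_type s (\<sigma> \<Rrightarrow> \<tau>) \<and> has_type t \<sigma>)"

fun tvars :: "trm \<Rightarrow> var set" where
  "tvars (Var x) = {x}"
| "tvars (s \<cdot> t) = tvars s \<union> tvars t"
| "tvars _ = {}"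

abbreviation closed :: "trm \<Rightarrow> bool" where "closed t \<equiv> tvars t = {}"

fun tsubst :: "trm \<Rightarrow> var \<Rightarrow> trm \<Rightarrow> trm" where
  "tsubst (Var y) x r = (if y = x then r else Var y)"
| "tsubst (s \<cdot> t) x r = tsubst s x r \<cdot> tsubst t x r"
| "tsubst t x r = t"

definition fresh :: "trm list \<Rightarrow> nat" where
  "fresh ts = Suc (Max (insert 0 (fst ` (\<Union>t\<in>set ts. tvars t))))"


section \<open>Formulas\<close>

text \<open>Equality at type \<open>N\<close> is the only primitive predicate. The logic is classical, so the
  remaining connectives are defined from implication, falsity and the universal quantifier.\<close>

datatype fm =
    Eq trm trm  (infix "\<^bold>=" 70)
  | Bot  ("\<^bold>\<bottom>")
  | Imp fm fm  (infixr "\<^bold>\<longrightarrow>" 55)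
  | Forall var fm

abbreviation Neg :: "fm \<Rightarrow> fm"  ("\<^bold>\<not> _" [68] 68) where "\<^bold>\<not> \<phi> \<equiv> \<phi> \<^bold>\<longrightarrow> \<^bold>\<bottom>"
abbreviation And :: "fm \<Rightarrow> fm \<Rightarrow> fm"  (infixr "\<^bold>\<and>" 65) where "\<phi> \<^bold>\<and> \<psi> \<equiv> \<^bold>\<not> (\<phi> \<^bold>\<longrightarrow> \<^bold>\<not> \<psi>)"
abbreviation Iff :: "fm \<Rightarrow> fm \<Rightarrow> fm"  (infix "\<^bold>\<longleftrightarrow>" 54)
  where "\<phi> \<^bold>\<longleftrightarrow> \<psi> \<equiv> (\<phi> \<^bold>\<longrightarrow> \<psi>) \<^bold>\<and> (\<psi> \<^bold>\<longrightarrow> \<phi>)"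
abbreviation Exists :: "var \<Rightarrow> fm \<Rightarrow> fm" where "Exists x \<phi> \<equiv> \<^bold>\<not> (Forall x (\<^bold>\<not> \<phi>))"

text \<open>\<open>forall i \<sigma> (\<lambda>x. \<phi> x)\<close> binds the object variable \<open>(i, \<sigma>)\<close>; the meta-level \<open>\<lambda>\<close> only provides
  a readable name for it.\<close>

abbreviation forall :: "nat \<Rightarrow> ty \<Rightarrow> (trm \<Rightarrow> fm) \<Rightarrow> fm"
  where "forall i \<sigma> F \<equiv> Forall (i, \<sigma>) (F (Var (i, \<sigma>)))"
abbreviation exists :: "nat \<Rightarrow> ty \<Rightarrow> (trm \<Rightarrow> fm) \<Rightarrow> fm"
  where "exists i \<sigma> F \<equiv> Exists (i, \<sigma>) (F (Var (i, \<sigma>)))"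

fun wff :: "fm \<Rightarrow> bool" where
  "wff (s \<^bold>= t) \<longleftrightarrow> has_type s N \<and> has_type t N"
| "wff \<^bold>\<bottom> \<longleftrightarrow> True"
| "wff (\<phi> \<^bold>\<longrightarrow> \<psi>) \<longleftrightarrow> wff \<phi> \<and> wff \<psi>"
| "wff (Forall x \<phi>) \<longleftrightarrow> wff \<phi>"

fun qf :: "fm \<Rightarrow> bool" where
  "qf (s \<^bold>= t) \<longleftrightarrow> True"
| "qf \<^bold>\<bottom> \<longleftrightarrow> True"
| "qf (\<phi> \<^bold>\<longrightarrow> \<psi>) \<longleftrightarrow> qf \<phi> \<and> qf \<psi>"
| "qf (Forall x \<phi>) \<longleftrightarrow> False"

fun fv :: "fm \<Rightarrow> var set" where
  "fv (s \<^bold>= t) = tvars s \<union> tvars t"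
| "fv \<^bold>\<bottom> = {}"
| "fv (\<phi> \<^bold>\<longrightarrow> \<psi>) = fv \<phi> \<union> fv \<psi>"
| "fv (Forall x \<phi>) = fv \<phi> - {x}"

text \<open>Naive substitution; it is the intended one whenever \<open>free_for\<close> holds.\<close>

fun subst :: "fm \<Rightarrow> var \<Rightarrow> trm \<Rightarrow> fm" where
  "subst (s \<^bold>= t) x r = (tsubst s x r \<^bold>= tsubst t x r)"
| "subst \<^bold>\<bottom> x r = \<^bold>\<bottom>"
| "subst (\<phi> \<^bold>\<longrightarrow> \<psi>) x r = (subst \<phi> x r \<^bold>\<longrightarrow> subst \<psi> x r)"
| "subst (Forall y \<phi>) x r = (if y = x then Forall y \<phi> else Forall y (subst \<phi> x r))"

fun free_for :: "trm \<Rightarrow> var \<Rightarrow> fm \<Rightarrow> bool" where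
  "free_for r x (s \<^bold>= t) \<longleftrightarrow> True"
| "free_for r x \<^bold>\<bottom> \<longleftrightarrow> True"
| "free_for r x (\<phi> \<^bold>\<longrightarrow> \<psi>) \<longleftrightarrow> free_for r x \<phi> \<and> free_for r x \<psi>"
| "free_for r x (Forall y \<phi>) \<longleftrightarrow> x \<notin> fv (Forall y \<phi>) \<or> (y \<notin> tvars r \<and> free_for r x \<phi>)"

text \<open>Equality at higher types is an abbreviation, defined pointwise.\<close>

fun eq_at :: "ty \<Rightarrow> trm \<Rightarrow> trm \<Rightarrow> fm" where
  "eq_at N s t = (s \<^bold>= t)"
| "eq_at (\<sigma> \<Rrightarrow> \<tau>) s t = (let i = fresh [s, t] in forall i \<sigma> (\<lambda>x. eq_at \<tau> (s \<cdot> x) (t \<cdot> x)))"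


section \<open>The systems E-PRA\<open>\<^sup>\<omega>\<close> and RCA\<open>\<^sub>0\<^sup>\<omega>\<close>\<close>

text \<open>Axioms are given as schemata over arbitrary terms instead of variables.\<close>

inductive_set EPRA :: "fm set" where
  eq_refl: "has_type s N \<Longrightarrow> (s \<^bold>= s) \<in> EPRA"
| eq_sym: "has_type s N \<Longrightarrow> has_type t N \<Longrightarrow> (s \<^bold>= t \<^bold>\<longrightarrow> t \<^bold>= s) \<in> EPRA"
| eq_trans: "has_type s N \<Longrightarrow> has_type t N \<Longrightarrow> has_type u N \<Longrightarrow>
    (s \<^bold>= t \<^bold>\<longrightarrow> t \<^bold>= u \<^bold>\<longrightarrow> s \<^bold>= u) \<in> EPRA"
| ext: "has_type \<phi> (\<rho> \<Rrightarrow> \<tau>) \<Longrightarrow> has_type s \<rho> \<Longrightarrow> has_type t \<rho> \<Longrightarrow>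
    (eq_at \<rho> s t \<^bold>\<longrightarrow> eq_at \<tau> (\<phi> \<cdot> s) (\<phi> \<cdot> t)) \<in> EPRA"
| succ_nonzero: "has_type s N \<Longrightarrow> (\<^bold>\<not> (Succ \<cdot> s \<^bold>= Zero)) \<in> EPRA"
| succ_inj: "has_type s N \<Longrightarrow> has_type t N \<Longrightarrow>
    (Succ \<cdot> s \<^bold>= Succ \<cdot> t \<^bold>\<longrightarrow> s \<^bold>= t) \<in> EPRA"
| pi: "has_type s \<rho> \<Longrightarrow> has_type t \<tau> \<Longrightarrow> eq_at \<rho> (PiC \<rho> \<tau> \<cdot> s \<cdot> t) s \<in> EPRA"
| sigma: "has_type s (\<delta> \<Rrightarrow> \<rho> \<Rrightarrow> \<tau>) \<Longrightarrow> has_type t (\<delta> \<Rrightarrow> \<rho>) \<Longrightarrow> has_type u \<delta> \<Longrightarrow>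
    eq_at \<tau> (SigC \<delta> \<rho> \<tau> \<cdot> s \<cdot> t \<cdot> u) (s \<cdot> u \<cdot> (t \<cdot> u)) \<in> EPRA"
| rec_zero: "has_type s N \<Longrightarrow> has_type t (N \<Rrightarrow> N \<Rrightarrow> N) \<Longrightarrow>
    (Rec \<cdot> Zero \<cdot> s \<cdot> t \<^bold>= s) \<in> EPRA"
| rec_succ: "has_type n N \<Longrightarrow> has_type s N \<Longrightarrow> has_type t (N \<Rrightarrow> N \<Rrightarrow> N) \<Longrightarrow>
    (Rec \<cdot> (Succ \<cdot> n) \<cdot> s \<cdot> t \<^bold>= t \<cdot> (Rec \<cdot> n \<cdot> s \<cdot> t) \<cdot> n) \<in> EPRA"
| qf_induction: "qf \<phi> \<Longrightarrow> wff \<phi> \<Longrightarrow> snd x = N \<Longrightarrow>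
    (subst \<phi> x Zero \<^bold>\<longrightarrow> Forall x (\<phi> \<^bold>\<longrightarrow> subst \<phi> x (Succ \<cdot> Var x)) \<^bold>\<longrightarrow> Forall x \<phi>) \<in> EPRA"

inductive_set QF_AC10 :: "fm set" where
  "qf \<phi> \<Longrightarrow> wff \<phi> \<Longrightarrow> snd f = ty1 \<Longrightarrow> snd n = N \<Longrightarrow> snd F = ty2 \<Longrightarrow> F \<notin> fv \<phi> \<Longrightarrow>
    (Forall f (Exists n \<phi>) \<^bold>\<longrightarrow> Exists F (Forall f (subst \<phi> n (Var F \<cdot> Var f)))) \<in> QF_AC10"

text \<open>Natural deduction for classical many-sorted logic over a set of axioms.\<close>

inductive derivable :: "fm set \<Rightarrow> fm list \<Rightarrow> fm \<Rightarrow> bool" for Ax :: "fm set" where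
  axiom: "\<phi> \<in> Ax \<Longrightarrow> derivable Ax \<Gamma> \<phi>"
| assm: "\<phi> \<in> set \<Gamma> \<Longrightarrow> derivable Ax \<Gamma> \<phi>"
| impI: "wff \<phi> \<Longrightarrow> derivable Ax (\<phi> # \<Gamma>) \<psi> \<Longrightarrow> derivable Ax \<Gamma> (\<phi> \<^bold>\<longrightarrow> \<psi>)"
| impE: "derivable Ax \<Gamma> (\<phi> \<^bold>\<longrightarrow> \<psi>) \<Longrightarrow> derivable Ax \<Gamma> \<phi> \<Longrightarrow> derivable Ax \<Gamma> \<psi>"
| raa: "wff \<phi> \<Longrightarrow> derivable Ax ((\<^bold>\<not> \<phi>) # \<Gamma>) \<^bold>\<bottom> \<Longrightarrow> derivable Ax \<Gamma> \<phi>"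
| allI: "derivable Ax \<Gamma> \<phi> \<Longrightarrow> \<forall>\<psi>\<in>set \<Gamma>. x \<notin> fv \<psi> \<Longrightarrow> derivable Ax \<Gamma> (Forall x \<phi>)"
| allE: "derivable Ax \<Gamma> (Forall x \<phi>) \<Longrightarrow> has_type t (snd x) \<Longrightarrow> free_for t x \<phi> \<Longrightarrow>
    derivable Ax \<Gamma> (subst \<phi> x t)"

definition RCA0w :: "fm \<Rightarrow> bool"  ("RCA\<^sub>0\<^sup>\<omega> \<turnstile> _" [50] 50) where
  "RCA\<^sub>0\<^sup>\<omega> \<turnstile> \<phi> \<longleftrightarrow> derivable (EPRA \<union> QF_AC10) [] \<phi>"


section \<open>Closed terms for primitive recursive functions\<close>

fun ty_of :: "trm \<Rightarrow> ty" where
  "ty_of (Var x) = snd x"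
| "ty_of Zero = N"
| "ty_of Succ = N \<Rrightarrow> N"
| "ty_of (PiC \<rho> \<sigma>) = \<rho> \<Rrightarrow> \<sigma> \<Rrightarrow> \<rho>"
| "ty_of (SigC \<delta> \<rho> \<sigma>) = (\<delta> \<Rrightarrow> \<rho> \<Rrightarrow> \<sigma>) \<Rrightarrow> (\<delta> \<Rrightarrow> \<rho>) \<Rrightarrow> \<delta> \<Rrightarrow> \<sigma>"
| "ty_of Rec = N \<Rrightarrow> N \<Rrightarrow> (N \<Rrightarrow> N \<Rrightarrow> N) \<Rrightarrow> N"
| "ty_of (s \<cdot> t) = (case ty_of s of N \<Rightarrow> N | _ \<Rrightarrow> \<tau> \<Rightarrow> \<tau>)"

lemma ty_of_eq: "has_type t \<tau> \<Longrightarrow> ty_of t = \<tau>"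
  by (induction t arbitrary: \<tau>) fastforce+

text \<open>Bracket abstraction: \<open>lam x t\<close> is the combinatory rendering of \<open>\<lambda>x. t\<close>.\<close>

fun lam :: "var \<Rightarrow> trm \<Rightarrow> trm" where
  "lam x (s \<cdot> t) =
    (if x \<in> tvars (s \<cdot> t)
     then SigC (snd x) (ty_of t) (ty_of (s \<cdot> t)) \<cdot> lam x s \<cdot> lam x t
     else PiC (ty_of (s \<cdot> t)) (snd x) \<cdot> (s \<cdot> t))"
| "lam x t =
    (if t = Var x
     then SigC (snd x) (snd x \<Rrightarrow> snd x) (snd x) \<cdot> PiC (snd x) (snd x \<Rrightarrow> snd x) \<cdot> PiC (snd x) (snd x)
     else PiC (ty_of t) (snd x) \<cdot> t)"

lemma has_type_lam: "has_type t \<tau> \<Longrightarrow> has_type (lam x t) (snd x \<Rrightarrow> \<tau>)"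
proof (induction t arbitrary: \<tau>)
  case (App s t)
  then obtain \<sigma> where "has_type s (\<sigma> \<Rrightarrow> \<tau>)" "has_type t \<sigma>" by auto
  with App.IH show ?case by (auto simp: ty_of_eq)
qed auto

lemma tvars_lam: "tvars (lam x t) = tvars t - {x}"
  by (induction t) auto

text \<open>As for quantifiers, \<open>fn i \<sigma> (\<lambda>x. t x)\<close> abstracts the object variable \<open>(i, \<sigma>)\<close>.
  Forall terms below named \<open>t_\<dots>\<close> are closed.\<close>

abbreviation fn :: "nat \<Rightarrow> ty \<Rightarrow> (trm \<Rightarrow> trm) \<Rightarrow> trm"
  where "fn i \<sigma> F \<equiv> lam (i, \<sigma>) (F (Var (i, \<sigma>)))"

definition t_pred :: trm where
  "t_pred = fn 0 N (\<lambda>n. Rec \<cdot> n \<cdot> Zero \<cdot> fn 1 N (\<lambda>r. fn 2 N (\<lambda>i. i)))"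

definition t_add :: trm where
  "t_add = fn 0 N (\<lambda>m. fn 1 N (\<lambda>n. Rec \<cdot> n \<cdot> m \<cdot> fn 2 N (\<lambda>r. fn 3 N (\<lambda>i. Succ \<cdot> r))))"

definition t_monus :: trm where
  "t_monus = fn 0 N (\<lambda>m. fn 1 N (\<lambda>n. Rec \<cdot> n \<cdot> m \<cdot> fn 2 N (\<lambda>r. fn 3 N (\<lambda>i. t_pred \<cdot> r))))"

definition t_dist :: trm where
  "t_dist = fn 0 N (\<lambda>m. fn 1 N (\<lambda>n. t_add \<cdot> (t_monus \<cdot> m \<cdot> n) \<cdot> (t_monus \<cdot> n \<cdot> m)))"

text \<open>\<open>t_ifz \<cdot> c \<cdot> a \<cdot> b\<close> is \<open>a\<close> if \<open>c = 0\<close>, and \<open>b\<close> otherwise.\<close>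

definition t_ifz :: trm where
  "t_ifz = fn 0 N (\<lambda>c. fn 1 N (\<lambda>a. fn 2 N (\<lambda>b. Rec \<cdot> c \<cdot> a \<cdot> fn 3 N (\<lambda>r. fn 4 N (\<lambda>i. b)))))"

text \<open>Cantor pairing \<open>(m, n) \<mapsto> (\<Sum>i\<le>m + n. i) + m\<close>, as in \<open>prod_encode\<close> of \<open>Nat_Bijection\<close>.
  \<open>t_diag \<cdot> z\<close> is the largest \<open>w\<close> whose triangular number is at most \<open>z\<close>.\<close>

definition t_tri :: trm where
  "t_tri = fn 0 N (\<lambda>n. Rec \<cdot> n \<cdot> Zero \<cdot> fn 1 N (\<lambda>r. fn 2 N (\<lambda>i. t_add \<cdot> r \<cdot> (Succ \<cdot> i))))"

definition t_pair :: trm where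
  "t_pair = fn 0 N (\<lambda>m. fn 1 N (\<lambda>n. t_add \<cdot> (t_tri \<cdot> (t_add \<cdot> m \<cdot> n)) \<cdot> m))"

definition t_diag :: trm where
  "t_diag = fn 0 N (\<lambda>z. Rec \<cdot> z \<cdot> Zero \<cdot> fn 1 N (\<lambda>r. fn 2 N (\<lambda>i.
     t_ifz \<cdot> (t_monus \<cdot> (t_tri \<cdot> (Succ \<cdot> r)) \<cdot> (Succ \<cdot> i)) \<cdot> (Succ \<cdot> r) \<cdot> r)))"

definition t_fst :: trm where
  "t_fst = fn 0 N (\<lambda>z. t_monus \<cdot> z \<cdot> (t_tri \<cdot> (t_diag \<cdot> z)))"

definition t_snd :: trm where
  "t_snd = fn 0 N (\<lambda>z. t_monus \<cdot> (t_diag \<cdot> z) \<cdot> (t_fst \<cdot> z))"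

text \<open>Finite sequences: the empty one is coded by \<open>0\<close> and \<open>x # xs\<close> by \<open>Suc \<langle>x, code of xs\<rangle>\<close>, as in
  \<open>list_encode\<close> of \<open>Nat_Bijection\<close>; every number codes exactly one sequence. Reading beyond the
  end of a sequence yields \<open>0\<close>.\<close>

definition t_cons :: trm where
  "t_cons = fn 0 N (\<lambda>x. fn 1 N (\<lambda>c. Succ \<cdot> (t_pair \<cdot> x \<cdot> c)))"

definition t_hd :: trm where
  "t_hd = fn 0 N (\<lambda>c. t_fst \<cdot> (t_pred \<cdot> c))"

definition t_tl :: trm where
  "t_tl = fn 0 N (\<lambda>c. t_snd \<cdot> (t_pred \<cdot> c))"

definition t_drop :: trm where
  "t_drop = fn 0 N (\<lambda>n. fn 1 N (\<lambda>c. Rec \<cdot> n \<cdot> c \<cdot> fn 2 N (\<lambda>r. fn 3 N (\<lambda>i. t_tl \<cdot> r))))"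

definition t_nth :: trm where
  "t_nth = fn 0 N (\<lambda>n. fn 1 N (\<lambda>c. t_hd \<cdot> (t_drop \<cdot> n \<cdot> c)))"

text \<open>\<open>t_prepend \<cdot> g \<cdot> n \<cdot> c\<close> is \<open>g 0, \<dots>, g (n - 1)\<close> followed by the sequence \<open>c\<close>.\<close>

definition t_prepend :: trm where
  "t_prepend = fn 0 ty1 (\<lambda>g. fn 1 N (\<lambda>n. fn 2 N (\<lambda>c. Rec \<cdot> n \<cdot> c \<cdot> fn 3 N (\<lambda>r. fn 4 N (\<lambda>i.
     t_cons \<cdot> (g \<cdot> (t_monus \<cdot> n \<cdot> (Succ \<cdot> i))) \<cdot> r)))))"

text \<open>\<open>t_upd \<cdot> n \<cdot> v \<cdot> c\<close> sets entry \<open>n\<close> of \<open>c\<close> to \<open>v\<close>, padding with zeros if necessary.\<close>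

definition t_upd :: trm where
  "t_upd = fn 0 N (\<lambda>n. fn 1 N (\<lambda>v. fn 2 N (\<lambda>c.
     t_prepend \<cdot> fn 3 N (\<lambda>j. t_nth \<cdot> j \<cdot> c) \<cdot> n \<cdot> (t_cons \<cdot> v \<cdot> (t_drop \<cdot> (Succ \<cdot> n) \<cdot> c)))))"

text \<open>The code of the initial segment \<open>f 0, \<dots>, f (n - 1)\<close>.\<close>

definition t_bar :: trm where
  "t_bar = fn 0 ty1 (\<lambda>f. fn 1 N (\<lambda>n. t_prepend \<cdot> f \<cdot> n \<cdot> Zero))"


section \<open>Partial computable functions with an oracle\<close>

text \<open>
  The numbering \<open>\<Phi>\<^sub>e\<^sup>A\<close> is given by Cutland's unlimited register machines with oracle (URMO), with
  registers and program lines counted from \<open>0\<close>. The index \<open>e\<close> codes the sequence of instructions;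
  an instruction is coded as \<open>\<langle>op, m, n, q\<rangle>\<close> (pairing associated to the right), where

    \<open>op = 0\<close>: \<open>R\<^sub>m := 0\<close>
    \<open>op = 1\<close>: \<open>R\<^sub>m := R\<^sub>m + 1\<close>
    \<open>op = 2\<close>: \<open>R\<^sub>n := R\<^sub>m\<close>
    \<open>op = 3\<close>: if \<open>R\<^sub>m = R\<^sub>n\<close> go to line \<open>q\<close>
    \<open>op \<ge> 4\<close>: \<open>R\<^sub>m := A(R\<^sub>m)\<close>

  Otherwise control passes to the next line. A configuration is a pair of the line number and the
  sequence of register contents. Initially the input is in \<open>R\<^sub>0\<close> and all other registers are \<open>0\<close>;
  the machine halts when there is no line with the current number, with the output in \<open>R\<^sub>0\<close>.
\<close>

definition t_exec :: trm where
  "t_exec = fn 0 ty1 (\<lambda>A. fn 1 N (\<lambda>ins. fn 2 N (\<lambda>pc. fn 3 N (\<lambda>c.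
     let op = t_fst \<cdot> ins;
         m = t_fst \<cdot> (t_snd \<cdot> ins);
         n = t_fst \<cdot> (t_snd \<cdot> (t_snd \<cdot> ins));
         q = t_snd \<cdot> (t_snd \<cdot> (t_snd \<cdot> ins));
         next_line = (\<lambda>c'. t_pair \<cdot> (Succ \<cdot> pc) \<cdot> c')
     in t_ifz \<cdot> op
          \<cdot> next_line (t_upd \<cdot> m \<cdot> Zero \<cdot> c)
       \<cdot> (t_ifz \<cdot> (t_pred \<cdot> op)
          \<cdot> next_line (t_upd \<cdot> m \<cdot> (Succ \<cdot> (t_nth \<cdot> m \<cdot> c)) \<cdot> c)
       \<cdot> (t_ifz \<cdot> (t_pred \<cdot> (t_pred \<cdot> op))
          \<cdot> next_line (t_upd \<cdot> n \<cdot> (t_nth \<cdot> m \<cdot> c) \<cdot> c)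
       \<cdot> (t_ifz \<cdot> (t_pred \<cdot> (t_pred \<cdot> (t_pred \<cdot> op)))
          \<cdot> (t_ifz \<cdot> (t_dist \<cdot> (t_nth \<cdot> m \<cdot> c) \<cdot> (t_nth \<cdot> n \<cdot> c)) \<cdot> (t_pair \<cdot> q \<cdot> c) \<cdot> next_line c)
          \<cdot> next_line (t_upd \<cdot> m \<cdot> (A \<cdot> (t_nth \<cdot> m \<cdot> c)) \<cdot> c))))))))"

text \<open>\<open>t_rest \<cdot> e \<cdot> st\<close> is the part of the program \<open>e\<close> from the current line on, so it is \<open>0\<close> iff the
  configuration \<open>st\<close> is halted. Halted configurations are left unchanged by \<open>t_step\<close>.\<close>

definition t_rest :: trm where
  "t_rest = fn 0 N (\<lambda>e. fn 1 N (\<lambda>st. t_drop \<cdot> (t_fst \<cdot> st) \<cdot> e))"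

definition t_step :: trm where
  "t_step = fn 0 ty1 (\<lambda>A. fn 1 N (\<lambda>e. fn 2 N (\<lambda>st.
     t_ifz \<cdot> (t_rest \<cdot> e \<cdot> st) \<cdot> st
       \<cdot> (t_exec \<cdot> A \<cdot> (t_hd \<cdot> (t_rest \<cdot> e \<cdot> st)) \<cdot> (t_fst \<cdot> st) \<cdot> (t_snd \<cdot> st)))))"

text \<open>The configuration after \<open>s\<close> steps of machine \<open>e\<close> with oracle \<open>A\<close> on input \<open>n\<close>.\<close>

definition t_config :: trm where
  "t_config = fn 0 ty1 (\<lambda>A. fn 1 N (\<lambda>e. fn 2 N (\<lambda>n. fn 3 N (\<lambda>s.
     Rec \<cdot> s \<cdot> (t_pair \<cdot> Zero \<cdot> (t_cons \<cdot> n \<cdot> Zero)) \<cdot> fn 4 N (\<lambda>st. fn 5 N (\<lambda>i. t_step \<cdot> A \<cdot> e \<cdot> st))))))"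

text \<open>\<open>\<Phi>\<^sub>e\<^sup>A(n)\<close> halts with output \<open>y\<close>.\<close>

definition Phi_halts :: "trm \<Rightarrow> trm \<Rightarrow> trm \<Rightarrow> trm \<Rightarrow> fm" where
  "Phi_halts A e n y = exists (fresh [A, e, n, y]) N (\<lambda>s.
     t_rest \<cdot> e \<cdot> (t_config \<cdot> A \<cdot> e \<cdot> n \<cdot> s) \<^bold>= Zero \<^bold>\<and>
     t_nth \<cdot> Zero \<cdot> (t_snd \<cdot> (t_config \<cdot> A \<cdot> e \<cdot> n \<cdot> s)) \<^bold>= y)"


section \<open>The principles\<close>

abbreviation Psi_var :: var where "Psi_var \<equiv> (0, ty1 \<Rrightarrow> ty1)"
abbreviation mu_var :: var where "mu_var \<equiv> (0, ty2)"

definition is_UDNR :: fm where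
  "is_UDNR = forall 0 ty1 (\<lambda>A. forall 0 N (\<lambda>e. forall 1 N (\<lambda>y.
     Phi_halts A e e y \<^bold>\<longrightarrow> \<^bold>\<not> (Var Psi_var \<cdot> A \<cdot> e \<^bold>= y))))"

definition UDNR :: fm where
  "UDNR = Exists Psi_var is_UDNR"

definition is_mu :: fm where
  "is_mu = forall 0 ty1 (\<lambda>f.
     exists 0 N (\<lambda>n. f \<cdot> n \<^bold>= Zero) \<^bold>\<longrightarrow> f \<cdot> (Var mu_var \<cdot> f) \<^bold>= Zero)"

definition mu2 :: fm where
  "mu2 = Exists mu_var is_mu"


section \<open>Explicit implications\<close>

text \<open>\<open>ext_functional \<Xi> \<Phi>\<close>: the functional \<open>\<Xi>\<close> is an extensionality functional for \<open>\<Phi>\<close> of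
  type \<open>1 \<rightarrow> 1\<close>.\<close>

abbreviation Xi_ty :: ty where "Xi_ty \<equiv> ty1 \<Rrightarrow> ty1 \<Rrightarrow> N \<Rrightarrow> N"

definition ext_functional :: "var \<Rightarrow> var \<Rightarrow> fm" where
  "ext_functional \<Xi> \<Phi> = forall 0 N (\<lambda>k. forall 0 ty1 (\<lambda>f. forall 1 ty1 (\<lambda>g.
     t_bar \<cdot> f \<cdot> (Var \<Xi> \<cdot> f \<cdot> g \<cdot> k) \<^bold>= t_bar \<cdot> g \<cdot> (Var \<Xi> \<cdot> f \<cdot> g \<cdot> k) \<^bold>\<longrightarrow>
     t_bar \<cdot> (Var \<Phi> \<cdot> f) \<cdot> k \<^bold>= t_bar \<cdot> (Var \<Phi> \<cdot> g) \<cdot> k)))"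

text \<open>\<open>explicit_imp \<Phi> A \<Psi> B\<close>: the implication from \<open>\<exists>\<Phi>. A(\<Phi>)\<close> to \<open>\<exists>\<Psi>. B(\<Psi>)\<close> is provable and explicit.
  Here \<open>A\<close> has no free variables except \<open>\<Phi>\<close>, and \<open>B\<close> none except \<open>\<Psi>\<close>. The last disjunct is the
  convention that the witnessing term may also use an extensionality functional for \<open>\<Phi>\<close>.\<close>

definition explicit_imp :: "var \<Rightarrow> fm \<Rightarrow> var \<Rightarrow> fm \<Rightarrow> bool" where
  "explicit_imp \<Phi> A \<Psi> B \<longleftrightarrow>
     RCA\<^sub>0\<^sup>\<omega> \<turnstile> (Exists \<Phi> A \<^bold>\<longrightarrow> Exists \<Psi> B) \<and>
     ((\<exists>t. closed t \<and> has_type t (snd \<Phi> \<Rrightarrow> snd \<Psi>) \<and> free_for (t \<cdot> Var \<Phi>) \<Psi> B \<and>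
         RCA\<^sub>0\<^sup>\<omega> \<turnstile> Forall \<Phi> (A \<^bold>\<longrightarrow> subst B \<Psi> (t \<cdot> Var \<Phi>))) \<or>
      snd \<Phi> = ty1 \<Rrightarrow> ty1 \<and>
      (\<exists>t \<Xi>. snd \<Xi> = Xi_ty \<and> \<Xi> \<notin> fv A \<union> fv B \<and>
         closed t \<and> has_type t (snd \<Phi> \<Rrightarrow> Xi_ty \<Rrightarrow> snd \<Psi>) \<and> free_for (t \<cdot> Var \<Phi> \<cdot> Var \<Xi>) \<Psi> B \<and>
         RCA\<^sub>0\<^sup>\<omega> \<turnstile> Forall \<Phi> (Forall \<Xi> (A \<^bold>\<and> ext_functional \<Xi> \<Phi> \<^bold>\<longrightarrow> subst B \<Psi> (t \<cdot> Var \<Phi> \<cdot> Var \<Xi>)))))"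

end

theory Submission
  imports Defs "HOL-Library.Countable_Set"
begin

text \<open>
  From \<open>\<Psi>\<close> to \<open>\<mu>\<close>: let \<open>e\<close> be a program that looks for an \<open>i\<close> with \<open>A(2i + 1) \<noteq> 0\<close> and then outputs
  \<open>A(2i)\<close>, and let \<open>v = \<Psi>(0)(e)\<close> for the zero oracle. Given \<open>f\<close>, put \<open>v, 1\<close> at the places \<open>2i, 2i + 1\<close> of
  \<open>A\<^sub>f\<close> if \<open>f(i) = 0\<close>, and \<open>0, 0\<close> otherwise. If \<open>f\<close> has a zero, then the program outputs \<open>v\<close> with oracle
  \<open>A\<^sub>f\<close>, so \<open>\<Psi>(A\<^sub>f)(e) \<noteq> v\<close>; if not, then \<open>A\<^sub>f = 0\<close> and \<open>\<Psi>(A\<^sub>f)(e) = v\<close> by extensionality. An extensionality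
  functional therefore bounds the least zero of \<open>f\<close>, and without it \<open>QF-AC\<close> applied to
  \<open>\<Psi>(A\<^sub>f)(e) \<noteq> v \<longrightarrow> f(n) = 0\<close> yields \<open>\<mu>\<close>. Conversely, \<open>\<mu>\<close> finds a halting stage of
  \<open>\<Phi>\<^sub>e\<^sup>A(e)\<close>, and \<open>\<Psi>(A)(e)\<close> is the output there plus one.

  Derivability in \<open>RCA\<^sub>0\<^sup>\<omega>\<close> is reduced to truth in Henkin models, where quantifier-free induction holds
  for all predicates built from term-definable functions.
\<close>

text \<open>Full witnessing is more than the detour through models requires. The premises of
  induction, and of extensionality at type 1, are universal closures of quantifier-free formulas. It
  suffices that, whenever all instances of such a formula hold, finitely many true formulas entail
  all of them. The quantifiers in the principles themselves are handled in the calculus, and models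
  only settle quantifier-free goals. Since a model may be non-standard and induction covers only
  quantifier-free predicates, existential quantifiers and order are replaced by terms such as
  predecessor and cut-off subtraction. The value \<open>v\<close> turns \<Psi> against itself: its
  own answer for the zero oracle is planted as the output of the program, so a change of answer
  betrays a zero of \<open>f\<close>. The markers 1 at odd places are separate from \<open>v\<close>
  because \<open>v\<close> may be 0. Extensionality as an axiom only tells that the two oracles are
  not equal everywhere; a term that finds the place needs a bound on the search, and this is what an
  extensionality functional supplies.\<close>

declare split_paired_All [simp del] split_paired_Ex [simp del]

section \<open>Syntax\<close>

lemma has_type_unique: "has_type t \<sigma> \<Longrightarrow> has_type t \<tau> \<Longrightarrow> \<sigma> = \<tau>"
  using ty_of_eq by blast

lemma finite_tvars [simp]: "finite (tvars t)"
  by (induction t) auto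

lemma tsubst_notin [simp]: "x \<notin> tvars s \<Longrightarrow> tsubst s x t = s"
  by (induction s) auto

lemma tsubst_self [simp]: "tsubst s x (Var x) = s"
  by (induction s) auto

lemma tsubst_tsubst: "z \<notin> tvars s \<Longrightarrow> tsubst (tsubst s x (Var z)) z t = tsubst s x t"
  by (induction s) auto

lemma has_type_tsubst: "has_type s \<tau> \<Longrightarrow> has_type t (snd x) \<Longrightarrow> has_type (tsubst s x t) \<tau>"
  by (induction s arbitrary: \<tau>) auto

fun bv :: "fm \<Rightarrow> var set" where
  "bv (s \<^bold>= t) = {}"
| "bv \<^bold>\<bottom> = {}"
| "bv (\<phi> \<^bold>\<longrightarrow> \<psi>) = bv \<phi> \<union> bv \<psi>"
| "bv (Forall x \<phi>) = insert x (bv \<phi>)"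

lemma finite_fv [simp]: "finite (fv \<phi>)"
  by (induction \<phi>) auto

lemma finite_bv [simp]: "finite (bv \<phi>)"
  by (induction \<phi>) auto

lemma bv_qf: "qf \<phi> \<Longrightarrow> bv \<phi> = {}"
  by (induction \<phi>) auto

lemma free_for_bv: "tvars t \<inter> bv \<phi> = {} \<Longrightarrow> free_for t x \<phi>"
  by (induction \<phi>) auto

lemma free_for_qf: "qf \<phi> \<Longrightarrow> free_for t x \<phi>"
  by (simp add: free_for_bv bv_qf)

lemma qf_subst [simp]: "qf (subst \<phi> x t) \<longleftrightarrow> qf \<phi>"
  by (induction \<phi>) auto

lemma wff_subst: "wff \<phi> \<Longrightarrow> has_type t (snd x) \<Longrightarrow> wff (subst \<phi> x t)"
  by (induction \<phi>) (auto simp: has_type_tsubst)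

lemma subst_self [simp]: "subst \<phi> x (Var x) = \<phi>"
  by (induction \<phi>) auto

text \<open>Going through an eigenvariable \<open>z\<close> amounts to direct instantiation. With
  quantifiers present, an inner binder of \<open>z\<close> could get in the way.\<close>

lemma subst_subst: "qf \<phi> \<Longrightarrow> z \<notin> fv \<phi> \<Longrightarrow> subst (subst \<phi> x (Var z)) z t = subst \<phi> x t"
  by (induction \<phi>) (auto simp: tsubst_tsubst)

lemma fresh_var:
  assumes "finite (V :: var set)"
  obtains i where "\<And>x. x \<in> V \<Longrightarrow> fst x < i"
proof
  fix x assume "x \<in> V"
  then show "fst x < Suc (Max (fst ` V))"
    using assms by (simp add: le_imp_less_Suc)
qed

lemma fresh_gt: "t \<in> set ts \<Longrightarrow> x \<in> tvars t \<Longrightarrow> fst x < fresh ts"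
  unfolding fresh_def by (rule le_imp_less_Suc, rule Max_ge) auto

lemma fresh_mono:
  assumes "(\<Union>t\<in>set ts. tvars t) \<subseteq> (\<Union>t\<in>set us. tvars t)"
  shows "fresh ts \<le> fresh us"
  unfolding fresh_def using assms by (intro Suc_le_mono[THEN iffD2] Max_mono) auto

abbreviation apps :: "trm \<Rightarrow> trm list \<Rightarrow> trm" where "apps \<equiv> foldl (\<cdot>)"

text \<open>Every finite type ends in \<open>N\<close>, so equality at a higher type can be read as
  equality at \<open>N\<close> of the applications to all full argument lists. This removes
  quantifiers from most reasoning about equality.\<close>

fun targs :: "ty \<Rightarrow> ty list" where
  "targs N = []"
| "targs (\<sigma> \<Rrightarrow> \<tau>) = \<sigma> # targs \<tau>"

abbreviation args_for :: "trm list \<Rightarrow> ty \<Rightarrow> bool" where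
  "args_for us \<tau> \<equiv> list_all2 has_type us (targs \<tau>)"

lemma has_type_apps: "has_type s \<tau> \<Longrightarrow> args_for us \<tau> \<Longrightarrow> has_type (apps s us) N"
proof (induction \<tau> arbitrary: s us)
  case (Fn \<sigma> \<tau>)
  then obtain u vs where "us = u # vs" "has_type u \<sigma>" "args_for vs \<tau>"
    by (auto simp: list_all2_Cons2)
  with Fn.IH(2)[of "s \<cdot> u" vs] Fn.prems(1) show ?case by auto
qed auto

lemma tsubst_apps: "tsubst (apps s us) x t = apps (tsubst s x t) (map (\<lambda>u. tsubst u x t) us)"
  by (induction us arbitrary: s) auto

section \<open>Derivations and extensional equality\<close>

abbreviation der :: "fm list \<Rightarrow> fm \<Rightarrow> bool"  (infix "\<turnstile>" 50) where
  "\<Gamma> \<turnstile> \<phi> \<equiv> derivable (EPRA \<union> QF_AC10) \<Gamma> \<phi>"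

lemma EPRA_der: "\<phi> \<in> EPRA \<Longrightarrow> \<Gamma> \<turnstile> \<phi>"
  by (simp add: derivable.axiom)

lemma der_refl: "has_type s N \<Longrightarrow> \<Gamma> \<turnstile> s \<^bold>= s"
  by (intro EPRA_der EPRA.eq_refl)

lemma der_sym: "\<Gamma> \<turnstile> s \<^bold>= t \<Longrightarrow> has_type s N \<Longrightarrow> has_type t N \<Longrightarrow> \<Gamma> \<turnstile> t \<^bold>= s"
  by (meson EPRA_der EPRA.eq_sym derivable.impE)

lemma der_trans: "\<Gamma> \<turnstile> s \<^bold>= t \<Longrightarrow> \<Gamma> \<turnstile> t \<^bold>= u \<Longrightarrow> has_type s N \<Longrightarrow> has_type t N \<Longrightarrow> has_type u N \<Longrightarrow>
  \<Gamma> \<turnstile> s \<^bold>= u"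
  by (meson EPRA_der EPRA.eq_trans derivable.impE)

lemma der_conj: "\<Gamma> \<turnstile> s \<^bold>= t \<Longrightarrow> \<Gamma> \<turnstile> s' \<^bold>= s \<Longrightarrow> \<Gamma> \<turnstile> t' \<^bold>= t \<Longrightarrow>
    has_type s N \<Longrightarrow> has_type t N \<Longrightarrow> has_type s' N \<Longrightarrow> has_type t' N \<Longrightarrow> \<Gamma> \<turnstile> s' \<^bold>= t'"
  using der_trans der_sym by blast

lemma der_gen:
  assumes "\<Gamma> \<turnstile> \<phi>" "qf \<phi>" "\<forall>\<psi>\<in>set \<Gamma>. z \<notin> fv \<psi>" "has_type t (snd z)"
  shows "\<Gamma> \<turnstile> subst \<phi> z t"
  using assms by (intro derivable.allE derivable.allI) (auto simp: free_for_qf)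

text \<open>\<open>eq_at\<close> computes its bound variables from the two terms, so an instance of
  \<open>eq_at\<close> is in general not the \<open>eq_at\<close> of the instantiated terms. This
  relation leaves the bound variables open and is therefore stable under renaming.\<close>

inductive aeq :: "ty \<Rightarrow> trm \<Rightarrow> trm \<Rightarrow> fm \<Rightarrow> bool" where
  "aeq N s t (s \<^bold>= t)"
| "b \<notin> tvars s \<union> tvars t \<Longrightarrow> snd b = \<sigma> \<Longrightarrow> aeq \<tau> (s \<cdot> Var b) (t \<cdot> Var b) \<phi> \<Longrightarrow>
    aeq (\<sigma> \<Rrightarrow> \<tau>) s t (Forall b \<phi>)"

inductive_cases aeq_NE: "aeq N s t \<phi>"
inductive_cases aeq_FnE: "aeq (\<sigma> \<Rrightarrow> \<tau>) s t \<phi>"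

lemma aeq_eq_at: "aeq \<tau> s t (eq_at \<tau> s t)"
proof (induction \<tau> arbitrary: s t)
  case (Fn \<sigma> \<tau>)
  have "(fresh [s, t], \<sigma>) \<notin> tvars s \<union> tvars t"
    using fresh_gt[of s "[s, t]"] fresh_gt[of t "[s, t]"] by fastforce
  then show ?case by (auto simp: Let_def intro!: aeq.intros Fn)
qed (auto intro: aeq.intros)

lemma aeq_subst:
  "aeq \<tau> s t \<phi> \<Longrightarrow> z \<notin> bv \<phi> \<Longrightarrow>
    aeq \<tau> (tsubst s b (Var z)) (tsubst t b (Var z)) (subst \<phi> b (Var z))"
proof (induction rule: aeq.induct)
  case (2 c s t \<sigma> \<tau> \<phi>)
  show ?case
  proof (cases "c = b")
    case True
    with 2 show ?thesis by (auto intro: aeq.intros)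
  next
    case False
    have *: "c \<notin> tvars (tsubst s b (Var z))" if "c \<notin> tvars s" for s
      using that 2(5) by (induction s) auto
    from False 2 * show ?thesis by (auto intro!: aeq.intros)
  qed
qed (auto intro: aeq.intros)

text \<open>The arguments may contain bound variables of \<open>\<phi>\<close>, so direct
  instantiation risks capture. Each quantifier is opened with a fresh variable \<open>z\<close>
  instead; at type \<open>N\<close> the formula is quantifier-free, and there \<open>z\<close> can
  be generalised and replaced by the argument.\<close>

lemma aeq_elim:
  "aeq \<tau> s t \<phi> \<Longrightarrow> \<Gamma> \<turnstile> \<phi> \<Longrightarrow> args_for us \<tau> \<Longrightarrow> \<Gamma> \<turnstile> apps s us \<^bold>= apps t us"
proof (induction \<tau> arbitrary: s t \<phi> us)
  case N
  then show ?case by (auto elim: aeq_NE)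
next
  case (Fn \<sigma> \<tau>)
  obtain b \<psi> where b: "\<phi> = Forall b \<psi>" "b \<notin> tvars s \<union> tvars t" "snd b = \<sigma>"
      "aeq \<tau> (s \<cdot> Var b) (t \<cdot> Var b) \<psi>"
    using Fn.prems(1) by (auto elim: aeq_FnE)
  obtain u vs where u: "us = u # vs" "has_type u \<sigma>" "args_for vs \<tau>"
    using Fn.prems(3) by (auto simp: list_all2_Cons2)
  define V where "V = (\<Union>\<psi>\<in>set \<Gamma>. fv \<psi>) \<union> bv \<psi> \<union> tvars s \<union> tvars t \<union> (\<Union>u\<in>set us. tvars u)"
  have "finite V" unfolding V_def by auto
  then obtain i where i: "\<And>x. x \<in> V \<Longrightarrow> fst x < i" by (rule fresh_var) auto
  define z where "z = (i, \<sigma>)"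
  have z: "z \<notin> V" "snd z = \<sigma>" using i[of z] by (auto simp: z_def)
  have "\<Gamma> \<turnstile> subst \<psi> b (Var z)"
    using Fn.prems(2) b z by (auto simp: V_def intro!: derivable.allE free_for_bv)
  moreover have "aeq \<tau> (s \<cdot> Var z) (t \<cdot> Var z) (subst \<psi> b (Var z))"
    using aeq_subst[OF b(4), of z b] b z by (auto simp: V_def)
  ultimately have "\<Gamma> \<turnstile> apps (s \<cdot> Var z) vs \<^bold>= apps (t \<cdot> Var z) vs"
    using Fn.IH(2) u by blast
  from der_gen[OF this, of z u] have
    "\<Gamma> \<turnstile> subst (apps (s \<cdot> Var z) vs \<^bold>= apps (t \<cdot> Var z) vs) z u"
    using z u by (auto simp: V_def)
  moreover have "map (\<lambda>v. tsubst v z u) vs = vs"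
    using z u by (auto simp: V_def intro!: map_idI)
  moreover have "z \<notin> tvars s" "z \<notin> tvars t" using z by (auto simp: V_def)
  ultimately show ?case by (simp add: tsubst_apps u)
qed

text \<open>The variable to be generalised has index \<open>fresh [s, t]\<close>. The first
  assumption keeps it out of the context, and it survives the passage to a further argument because
  \<open>fresh\<close> can only grow.\<close>

lemma eq_at_intro:
  assumes "\<And>\<psi> x. \<psi> \<in> set \<Gamma> \<Longrightarrow> x \<in> fv \<psi> \<Longrightarrow> fst x < fresh [s, t]"
    and "\<And>us. args_for us \<tau> \<Longrightarrow> \<Gamma> \<turnstile> apps s us \<^bold>= apps t us"
  shows "\<Gamma> \<turnstile> eq_at \<tau> s t"
  using assms
proof (induction \<tau> arbitrary: s t)
  case N
  from N(2)[of "[]"] show ?case by simp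
next
  case (Fn \<sigma> \<tau>)
  let ?b = "(fresh [s, t], \<sigma>)"
  have "\<Gamma> \<turnstile> eq_at \<tau> (s \<cdot> Var ?b) (t \<cdot> Var ?b)"
  proof (rule Fn.IH(2))
    fix \<psi> x assume "\<psi> \<in> set \<Gamma>" "x \<in> fv \<psi>"
    then have "fst x < fresh [s, t]" by (rule Fn.prems(1))
    also have "\<dots> \<le> fresh [s \<cdot> Var ?b, t \<cdot> Var ?b]" by (rule fresh_mono) auto
    finally show "fst x < fresh [s \<cdot> Var ?b, t \<cdot> Var ?b]" .
  next
    fix us assume "args_for us \<tau>"
    then show "\<Gamma> \<turnstile> apps (s \<cdot> Var ?b) us \<^bold>= apps (t \<cdot> Var ?b) us"
      using Fn.prems(2)[of "Var ?b # us"] by simp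
  qed
  moreover have "\<forall>\<psi>\<in>set \<Gamma>. ?b \<notin> fv \<psi>" using Fn.prems(1) by fastforce
  ultimately show ?case by (auto simp: Let_def intro!: derivable.allI)
qed

text \<open>Provable equality in every context. Quantifying over contexts makes these equations
  usable under any assumptions although the calculus has no weakening.\<close>

definition ueq :: "ty \<Rightarrow> trm \<Rightarrow> trm \<Rightarrow> bool" where
  "ueq \<tau> s t \<longleftrightarrow> has_type s \<tau> \<and> has_type t \<tau> \<and>
     (\<forall>\<Gamma> us. args_for us \<tau> \<longrightarrow> \<Gamma> \<turnstile> apps s us \<^bold>= apps t us)"

lemma ueq_types: "ueq \<tau> s t \<Longrightarrow> has_type s \<tau>" "ueq \<tau> s t \<Longrightarrow> has_type t \<tau>"
  by (auto simp: ueq_def)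

lemma ueq_trans [trans]: "ueq \<tau> s t \<Longrightarrow> ueq \<tau> t u \<Longrightarrow> ueq \<tau> s u"
  unfolding ueq_def by (blast intro: der_trans has_type_apps)

lemma ueq_eq_at:
  assumes "\<And>\<Gamma>. \<Gamma> \<turnstile> eq_at \<tau> s t" "has_type s \<tau>" "has_type t \<tau>"
  shows "ueq \<tau> s t"
  using assms aeq_elim[OF aeq_eq_at assms(1)] by (auto simp: ueq_def)

lemma ueq_pi: "has_type s \<rho> \<Longrightarrow> has_type t \<tau> \<Longrightarrow> ueq \<rho> (PiC \<rho> \<tau> \<cdot> s \<cdot> t) s"
  by (rule ueq_eq_at) (auto intro: EPRA_der EPRA.pi)

lemma ueq_sigma: "has_type s (\<delta> \<Rrightarrow> \<rho> \<Rrightarrow> \<tau>) \<Longrightarrow> has_type t (\<delta> \<Rrightarrow> \<rho>) \<Longrightarrow> has_type u \<delta> \<Longrightarrow>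
    ueq \<tau> (SigC \<delta> \<rho> \<tau> \<cdot> s \<cdot> t \<cdot> u) (s \<cdot> u \<cdot> (t \<cdot> u))"
  by (rule ueq_eq_at) (auto intro: EPRA_der EPRA.sigma)

lemma ueq_fun: "ueq (\<sigma> \<Rrightarrow> \<tau>) s t \<Longrightarrow> has_type u \<sigma> \<Longrightarrow> ueq \<tau> (s \<cdot> u) (t \<cdot> u)"
  unfolding ueq_def by (auto dest!: spec[where x = "u # us" for us])

text \<open>A variable that is free in \<open>\<Gamma>\<close> cannot be generalised, so the premise of the extensionality
  axiom, whose bound variables are prescribed by \<open>eq_at\<close>, may be out of reach. Padding both sides
  with a variable of large index moves the bound variables away from \<open>\<Gamma>\<close>.\<close>

lemma der_ext:
  assumes "has_type \<phi> (\<sigma> \<Rrightarrow> \<tau>)" "has_type s \<sigma>" "has_type t \<sigma>" "args_for vs \<tau>"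
    and eq: "\<And>us. args_for us \<sigma> \<Longrightarrow> \<Gamma> \<turnstile> apps s us \<^bold>= apps t us"
  shows "\<Gamma> \<turnstile> apps (\<phi> \<cdot> s) vs \<^bold>= apps (\<phi> \<cdot> t) vs"
proof -
  have "finite (\<Union>\<psi>\<in>set \<Gamma>. fv \<psi>)" by auto
  then obtain i where i: "\<And>x. x \<in> (\<Union>\<psi>\<in>set \<Gamma>. fv \<psi>) \<Longrightarrow> fst x < i" by (rule fresh_var) auto
  define pad where "pad s = PiC \<sigma> N \<cdot> s \<cdot> Var (i, N)" for s
  have pad: "has_type (pad s) \<sigma>" "ueq \<sigma> (pad s) s" if "has_type s \<sigma>" for s
    using that by (auto simp: pad_def intro: ueq_pi)
  have ext: "\<Gamma> \<turnstile> apps (\<phi> \<cdot> s) vs \<^bold>= apps (\<phi> \<cdot> t) vs"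
    if "has_type s \<sigma>" "has_type t \<sigma>" "\<Gamma> \<turnstile> eq_at \<sigma> s t" for s t
    using derivable.impE[OF EPRA_der[OF EPRA.ext[OF assms(1) that(1,2)]] that(3)]
      aeq_elim[OF aeq_eq_at] assms(4) by blast
  have pad_ext: "\<Gamma> \<turnstile> apps (\<phi> \<cdot> pad s) vs \<^bold>= apps (\<phi> \<cdot> s) vs" if "has_type s \<sigma>" for s
    using that pad by (intro ext) (auto simp: pad_def intro!: EPRA_der EPRA.pi)
  have "\<Gamma> \<turnstile> eq_at \<sigma> (pad s) (pad t)"
  proof (rule eq_at_intro)
    fix \<psi> x assume "\<psi> \<in> set \<Gamma>" "x \<in> fv \<psi>"
    then have "fst x < i" by (intro i) auto
    also have "i < fresh [pad s, pad t]"
      using fresh_gt[of "pad s" "[pad s, pad t]" "(i, N)"] by (auto simp: pad_def)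
    finally show "fst x < fresh [pad s, pad t]" .
  next
    fix us assume us: "args_for us \<sigma>"
    have "\<Gamma> \<turnstile> apps (pad r) us \<^bold>= apps r us" if "has_type r \<sigma>" for r
      using pad(2)[OF that] us by (auto simp: ueq_def)
    then show "\<Gamma> \<turnstile> apps (pad s) us \<^bold>= apps (pad t) us"
      using eq[OF us] assms(2,3) pad(1) us by (blast intro: der_conj has_type_apps)
  qed
  then have "\<Gamma> \<turnstile> apps (\<phi> \<cdot> pad s) vs \<^bold>= apps (\<phi> \<cdot> pad t) vs"
    using pad assms by (intro ext) auto
  moreover have "has_type (apps (\<phi> \<cdot> s) vs) N" if "has_type s \<sigma>" for s
    using assms that by (intro has_type_apps) auto
  ultimately show ?thesis
    using pad_ext pad(1) assms(2,3) by (blast intro: der_conj der_sym)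
qed

lemma ueq_arg:
  assumes "has_type \<phi> (\<sigma> \<Rrightarrow> \<tau>)" "ueq \<sigma> s t"
  shows "ueq \<tau> (\<phi> \<cdot> s) (\<phi> \<cdot> t)"
proof -
  have "\<Gamma> \<turnstile> apps (\<phi> \<cdot> s) us \<^bold>= apps (\<phi> \<cdot> t) us" if "args_for us \<tau>" for \<Gamma> us
    using assms that by (intro der_ext) (auto simp: ueq_def)
  then show ?thesis using assms by (auto simp: ueq_def)
qed

lemma ueq_app: "ueq (\<sigma> \<Rrightarrow> \<tau>) s s' \<Longrightarrow> ueq \<sigma> t t' \<Longrightarrow> ueq \<tau> (s \<cdot> t) (s' \<cdot> t')"
  by (rule ueq_trans[OF ueq_fun ueq_arg]) (auto dest: ueq_types)

section \<open>Simultaneous substitution and evaluation of abstractions\<close>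

fun sub :: "(var \<Rightarrow> trm) \<Rightarrow> trm \<Rightarrow> trm" where
  "sub \<theta> (Var x) = \<theta> x"
| "sub \<theta> (s \<cdot> t) = sub \<theta> s \<cdot> sub \<theta> t"
| "sub \<theta> t = t"

lemma sub_cong: "(\<And>x. x \<in> tvars t \<Longrightarrow> \<theta> x = \<theta>' x) \<Longrightarrow> sub \<theta> t = sub \<theta>' t"
  by (induction t) auto

lemma sub_Var [simp]: "sub Var t = t"
  by (induction t) auto

lemma sub_closed: "closed t \<Longrightarrow> sub \<theta> t = t"
  using sub_cong[of t \<theta> Var] by simp

definition typed_env :: "(var \<Rightarrow> trm) \<Rightarrow> bool" where
  "typed_env \<theta> \<longleftrightarrow> (\<forall>x. has_type (\<theta> x) (snd x))"

lemma typed_envD: "typed_env \<theta> \<Longrightarrow> has_type (\<theta> x) (snd x)"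
  unfolding typed_env_def by blast

lemma typed_env_Var [simp]: "typed_env Var"
  by (simp add: typed_env_def)

lemma typed_env_upd [simp]: "typed_env \<theta> \<Longrightarrow> has_type u (snd x) \<Longrightarrow> typed_env (\<theta>(x := u))"
  by (simp add: typed_env_def del: split_paired_All)

lemma has_type_sub [simp]: "typed_env \<theta> \<Longrightarrow> has_type t \<tau> \<Longrightarrow> has_type (sub \<theta> t) \<tau>"
  by (induction t arbitrary: \<tau>) (auto simp: typed_envD)

text \<open>The environment makes the equation iterate: the right-hand side is again an instance of
  a term under an environment, so a nested abstraction can consume its next argument. Combinators
  bind nothing, hence no capture can occur.\<close>

lemma beta:
  assumes "has_type t \<tau>" "has_type u (snd x)" "typed_env \<theta>"
  shows "ueq \<tau> (sub \<theta> (lam x t) \<cdot> u) (sub (\<theta>(x := u)) t)"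
  using assms
proof (induction t arbitrary: \<tau>)
  case (Var y)
  show ?case
  proof (cases "y = x")
    case True
    let ?a = "snd x"
    have "ueq ?a (SigC ?a (?a \<Rrightarrow> ?a) ?a \<cdot> PiC ?a (?a \<Rrightarrow> ?a) \<cdot> PiC ?a ?a \<cdot> u)
      (PiC ?a (?a \<Rrightarrow> ?a) \<cdot> u \<cdot> (PiC ?a ?a \<cdot> u))"
      using Var by (intro ueq_sigma) auto
    also have "ueq ?a \<dots> u" using Var by (intro ueq_pi) auto
    finally show ?thesis using True Var by simp
  next
    case False
    then show ?thesis using Var by (auto intro!: ueq_pi simp: typed_envD)
  qed
next
  case (App s t)
  then obtain \<sigma> where s: "has_type s (\<sigma> \<Rrightarrow> \<tau>)" "has_type t \<sigma>" by auto
  have lam: "has_type (sub \<theta> (lam x s)) (snd x \<Rrightarrow> \<sigma> \<Rrightarrow> \<tau>)" "has_type (sub \<theta> (lam x t)) (snd x \<Rrightarrow> \<sigma>)"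
    using s App.prems by (auto intro!: has_type_sub has_type_lam)
  show ?case
  proof (cases "x \<in> tvars (s \<cdot> t)")
    case True
    have "ueq \<tau> (SigC (snd x) \<sigma> \<tau> \<cdot> sub \<theta> (lam x s) \<cdot> sub \<theta> (lam x t) \<cdot> u)
        (sub \<theta> (lam x s) \<cdot> u \<cdot> (sub \<theta> (lam x t) \<cdot> u))"
      using lam App.prems by (intro ueq_sigma) auto
    also have "ueq \<tau> \<dots> (sub (\<theta>(x := u)) (s \<cdot> t))"
      unfolding sub.simps using App s by (intro ueq_app[where \<sigma> = \<sigma>]) blast+
    finally show ?thesis using True ty_of_eq[OF s(2)] ty_of_eq[OF App.prems(1)]
      by (simp del: ty_of.simps tvars.simps fun_upd_apply)
  next
    case False
    have "sub (\<theta>(x := u)) (s \<cdot> t) = sub \<theta> (s \<cdot> t)"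
      using False by (intro sub_cong) auto
    moreover have "ueq \<tau> (PiC \<tau> (snd x) \<cdot> sub \<theta> (s \<cdot> t) \<cdot> u) (sub \<theta> (s \<cdot> t))"
      using App.prems by (intro ueq_pi has_type_sub) auto
    ultimately show ?thesis using False ty_of_eq[OF App.prems(1)]
      by (simp del: ty_of.simps tvars.simps fun_upd_apply)
  qed
qed (auto intro!: ueq_pi)

section \<open>Henkin models\<close>

text \<open>Weakening is not admissible for \<open>derivable\<close>: from a context in which \<open>(0, ty1)\<close> is free,
  nothing can be generalised over that variable. So monotonicity is built into the definition.\<close>

definition entails :: "fm set \<Rightarrow> fm \<Rightarrow> bool"  (infix "\<tturnstile>" 50) where
  "T \<tturnstile> \<phi> \<longleftrightarrow> (\<forall>\<Gamma>. T \<subseteq> set \<Gamma> \<longrightarrow> \<Gamma> \<turnstile> \<phi>)"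

lemma entailsI: "(\<And>\<Gamma>. T \<subseteq> set \<Gamma> \<Longrightarrow> \<Gamma> \<turnstile> \<phi>) \<Longrightarrow> T \<tturnstile> \<phi>"
  by (simp add: entails_def)

lemma entailsD: "T \<tturnstile> \<phi> \<Longrightarrow> T \<subseteq> set \<Gamma> \<Longrightarrow> \<Gamma> \<turnstile> \<phi>"
  by (simp add: entails_def)

lemma entails_mono: "T \<tturnstile> \<phi> \<Longrightarrow> T \<subseteq> T' \<Longrightarrow> T' \<tturnstile> \<phi>"
  unfolding entails_def by blast

lemma entails_assm: "\<phi> \<in> T \<Longrightarrow> T \<tturnstile> \<phi>"
  by (auto intro: entailsI derivable.assm)

lemma entails_impI: "wff \<phi> \<Longrightarrow> insert \<phi> T \<tturnstile> \<psi> \<Longrightarrow> T \<tturnstile> \<phi> \<^bold>\<longrightarrow> \<psi>"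
  by (rule entailsI, rule derivable.impI, assumption, erule entailsD) auto

lemma entails_impE: "T \<tturnstile> \<phi> \<^bold>\<longrightarrow> \<psi> \<Longrightarrow> T \<tturnstile> \<phi> \<Longrightarrow> T \<tturnstile> \<psi>"
  unfolding entails_def by (blast intro: derivable.impE)

lemma entails_raa: "wff \<phi> \<Longrightarrow> insert (\<^bold>\<not> \<phi>) T \<tturnstile> \<^bold>\<bottom> \<Longrightarrow> T \<tturnstile> \<phi>"
  by (rule entailsI, rule derivable.raa, assumption, erule entailsD) auto

lemma entails_efq: "T \<tturnstile> \<^bold>\<bottom> \<Longrightarrow> wff \<phi> \<Longrightarrow> T \<tturnstile> \<phi>"
  by (blast intro: entails_raa entails_mono)

lemma entails_allE: "T \<tturnstile> Forall x \<phi> \<Longrightarrow> has_type t (snd x) \<Longrightarrow> free_for t x \<phi> \<Longrightarrow> T \<tturnstile> subst \<phi> x t"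
  unfolding entails_def by (blast intro: derivable.allE)

text \<open>Which variable is an admissible eigenvariable depends on the context, known only after
  \<open>T\<close> has been fixed. The premise therefore speaks of all variables outside a finite
  set, and \<open>z\<close> is chosen afterwards.\<close>

lemma entails_gen:
  assumes "finite V" "qf \<phi>" "\<And>z. z \<notin> V \<Longrightarrow> snd z = snd x \<Longrightarrow> T \<tturnstile> subst \<phi> x (Var z)"
    and "T \<subseteq> set \<Gamma>"
  obtains z where "z \<notin> V" "snd z = snd x" "\<forall>\<psi>\<in>set \<Gamma>. z \<notin> fv \<psi>" "z \<notin> fv \<phi>"
    "\<Gamma> \<turnstile> Forall z (subst \<phi> x (Var z))"
proof -
  have "finite (V \<union> fv \<phi> \<union> (\<Union>\<psi>\<in>set \<Gamma>. fv \<psi>))" using assms by auto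
  then obtain i where i: "\<And>y. y \<in> V \<union> fv \<phi> \<union> (\<Union>\<psi>\<in>set \<Gamma>. fv \<psi>) \<Longrightarrow> fst y < i"
    by (rule fresh_var) blast
  define z where "z = (i, snd x)"
  have z: "z \<notin> V \<union> fv \<phi> \<union> (\<Union>\<psi>\<in>set \<Gamma>. fv \<psi>)" "snd z = snd x" using i[of z] by (auto simp: z_def)
  have "\<Gamma> \<turnstile> subst \<phi> x (Var z)" using assms z by (blast intro: entailsD)
  with z show ?thesis by (intro that[of z] derivable.allI) auto
qed

lemma entails_inst:
  assumes "finite V" "qf \<phi>" "\<And>z. z \<notin> V \<Longrightarrow> snd z = snd x \<Longrightarrow> T \<tturnstile> subst \<phi> x (Var z)"
    and "has_type t (snd x)"
  shows "T \<tturnstile> subst \<phi> x t"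
proof (rule entailsI)
  fix \<Gamma> assume "T \<subseteq> set \<Gamma>"
  from entails_gen[OF assms(1-3) this]
  obtain z where z: "snd z = snd x" "z \<notin> fv \<phi>" "\<Gamma> \<turnstile> Forall z (subst \<phi> x (Var z))"
    by metis
  then have "\<Gamma> \<turnstile> subst (subst \<phi> x (Var z)) z t"
    using assms by (intro derivable.allE) (auto intro: free_for_qf)
  then show "\<Gamma> \<turnstile> subst \<phi> x t" using assms z by (simp add: subst_subst)
qed

section \<open>Construction of Henkin sets\<close>

instance ty :: countable by countable_datatype
instance trm :: countable by countable_datatype
instance fm :: countable by countable_datatype

text \<open>\<open>generic\<close> is the replacement for witnesses: if no instance of a
  quantifier-free formula fails in \<open>X\<close>, a finite part of \<open>X\<close> proves all
  instances at once. From such a part the universal closure is derivable by generalising over a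
  fresh variable, so it can serve as premise of an axiom.\<close>

locale henkin =
  fixes X :: "fm set"
  assumes closure: "finite T \<Longrightarrow> T \<subseteq> X \<Longrightarrow> T \<tturnstile> \<phi> \<Longrightarrow> wff \<phi> \<Longrightarrow> \<phi> \<in> X"
    and Bot_notin: "\<^bold>\<bottom> \<notin> X"
    and complete: "wff \<phi> \<Longrightarrow> \<phi> \<in> X \<or> (\<^bold>\<not> \<phi>) \<in> X"
    and generic: "qf \<phi> \<Longrightarrow> wff \<phi> \<Longrightarrow> (\<And>t. has_type t (snd x) \<Longrightarrow> subst \<phi> x t \<in> X) \<Longrightarrow>
      \<exists>T. finite T \<and> T \<subseteq> X \<and> (\<forall>t. has_type t (snd x) \<longrightarrow> T \<tturnstile> subst \<phi> x t)"

definition fin_consistent :: "fm set \<Rightarrow> bool" where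
  "fin_consistent T \<longleftrightarrow> finite T \<and> (\<forall>\<phi>\<in>T. wff \<phi>) \<and> \<not> T \<tturnstile> \<^bold>\<bottom>"

lemma fin_consistent_decide:
  assumes "fin_consistent T" "wff \<phi>"
  shows "fin_consistent (insert \<phi> T) \<or> fin_consistent (insert (\<^bold>\<not> \<phi>) T)"
proof -
  have "T \<tturnstile> \<^bold>\<bottom>" if "insert \<phi> T \<tturnstile> \<^bold>\<bottom>" "insert (\<^bold>\<not> \<phi>) T \<tturnstile> \<^bold>\<bottom>"
    using entails_impE[OF entails_impI[OF assms(2) that(1)] entails_raa[OF assms(2) that(2)]] .
  then show ?thesis using assms by (auto simp: fin_consistent_def)
qed

text \<open>Variables play the role of Henkin constants. Either the negation of some variable
  instance can be added consistently and becomes a counterexample, or all variable instances are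
  entailed, and then all instances are by \<open>entails_inst\<close>.\<close>

lemma fin_consistent_extend:
  assumes "fin_consistent T"
  obtains T' where "fin_consistent T'" "T \<subseteq> T'" "wff \<phi> \<Longrightarrow> \<phi> \<in> T' \<or> (\<^bold>\<not> \<phi>) \<in> T'"
    "wff \<phi> \<Longrightarrow> qf \<phi> \<Longrightarrow> (\<exists>t. has_type t (snd x) \<and> (\<^bold>\<not> subst \<phi> x t) \<in> T') \<or>
      (\<forall>t. has_type t (snd x) \<longrightarrow> T' \<tturnstile> subst \<phi> x t)"
proof (cases "wff \<phi>")
  case True
  with fin_consistent_decide[OF assms] obtain T1 where T1: "fin_consistent T1" "T \<subseteq> T1" "\<phi> \<in> T1 \<or> (\<^bold>\<not> \<phi>) \<in> T1"
    by blast
  show ?thesis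
  proof (cases "\<exists>z. snd z = snd x \<and> fin_consistent (insert (\<^bold>\<not> subst \<phi> x (Var z)) T1)")
    case True
    then obtain z where z: "has_type (Var z) (snd x)" "fin_consistent (insert (\<^bold>\<not> subst \<phi> x (Var z)) T1)"
      by auto
    let ?T = "insert (\<^bold>\<not> subst \<phi> x (Var z)) T1"
    have a: "\<exists>t. has_type t (snd x) \<and> (\<^bold>\<not> subst \<phi> x t) \<in> ?T"
      using z(1) by (intro exI[of _ "Var z"]) simp
    have b: "T \<subseteq> ?T" and c: "\<phi> \<in> ?T \<or> (\<^bold>\<not> \<phi>) \<in> ?T" using T1 by auto
    show ?thesis by (rule that[OF z(2) b], rule c, rule disjI1, rule a)
  next
    case False
    have "T1 \<tturnstile> subst \<phi> x t" if "qf \<phi>" "has_type t (snd x)" for t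
    proof (rule entails_inst[of "{}"])
      fix z :: var assume "snd z = snd x"
      with False \<open>wff \<phi>\<close> T1(1) show "T1 \<tturnstile> subst \<phi> x (Var z)"
        by (rule_tac entails_raa) (auto simp: fin_consistent_def wff_subst)
    qed (use that in auto)
    with T1 show ?thesis by (intro that[of T1]) auto
  qed
next
  case False
  show ?thesis by (rule that[of T]) (use assms False in auto)
qed

lemma henkin_exists:
  assumes "fin_consistent T"
  obtains X where "henkin X" "T \<subseteq> X"
proof -
  define P where "P \<phi> x S S' \<longleftrightarrow> (fin_consistent S \<longrightarrow> fin_consistent S' \<and> S \<subseteq> S' \<and> (wff \<phi> \<longrightarrow> \<phi> \<in> S' \<or> (\<^bold>\<not> \<phi>) \<in> S') \<and>
      (wff \<phi> \<longrightarrow> qf \<phi> \<longrightarrow> (\<exists>t. has_type t (snd x) \<and> (\<^bold>\<not> subst \<phi> x t) \<in> S') \<or>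
        (\<forall>t. has_type t (snd x) \<longrightarrow> S' \<tturnstile> subst \<phi> x t)))" for \<phi> x S S'
  have "\<exists>S'. P \<phi> x S S'" for \<phi> x S
  proof (cases "fin_consistent S")
    case True
    from fin_consistent_extend[OF this, of \<phi> x] show ?thesis unfolding P_def by metis
  qed (auto simp: P_def)
  then obtain ex where ex: "\<And>\<phi> x S. P \<phi> x S (ex \<phi> x S)" by metis
  \<comment> \<open>Each pair of a formula and a variable is treated at the stage that codes it. All
    stages are finite, so a finite subset of the union lies in one of them.\<close>
  define code where "code = (from_nat :: nat \<Rightarrow> fm \<times> var)"
  define Ts where "Ts = rec_nat T (\<lambda>n S. ex (fst (code n)) (snd (code n)) S)"
  have Ts: "Ts 0 = T" "\<And>n. Ts (Suc n) = ex (fst (code n)) (snd (code n)) (Ts n)"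
    by (auto simp: Ts_def)
  have fin_consistent: "fin_consistent (Ts n)" for n
    by (induction n) (use assms Ts ex in \<open>auto simp: P_def\<close>)
  have "Ts n \<subseteq> Ts (Suc n)" for n
    using ex[of "fst (code n)" "snd (code n)" "Ts n"] fin_consistent[of n] unfolding P_def Ts by blast
  then have mono: "Ts m \<subseteq> Ts n" if "m \<le> n" for m n
    using that by (rule lift_Suc_mono_le)
  define X where "X = (\<Union>n. Ts n)"
  have fin: "\<exists>n. S \<subseteq> Ts n" if "finite S" "S \<subseteq> X" for S
    using that
  proof (induction rule: finite_induct)
    case (insert \<phi> S)
    then obtain m n where "S \<subseteq> Ts m" "\<phi> \<in> Ts n" by (auto simp: X_def)
    then have "insert \<phi> S \<subseteq> Ts (max m n)" using mono[of m "max m n"] mono[of n "max m n"] by auto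
    then show ?case by blast
  qed auto
  have cons: "\<not> S \<tturnstile> \<^bold>\<bottom>" if "finite S" "S \<subseteq> X" for S
    using fin[OF that] fin_consistent entails_mono unfolding fin_consistent_def by blast
  have step: "\<exists>n. P \<phi> x (Ts n) (Ts (Suc n))" for \<phi> x
    using ex[of \<phi> x "Ts (to_nat (\<phi>, x))"] Ts(2)[of "to_nat (\<phi>, x)"]
    by (intro exI[of _ "to_nat (\<phi>, x)"]) (simp add: code_def)
  have complete: "\<phi> \<in> X \<or> (\<^bold>\<not> \<phi>) \<in> X" if "wff \<phi>" for \<phi>
    using step[of \<phi> undefined] fin_consistent that unfolding P_def X_def by blast
  have sub: "Ts n \<subseteq> X" for n by (auto simp: X_def)
  have clash: False if "\<phi> \<in> X" "(\<^bold>\<not> \<phi>) \<in> X" for \<phi>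
    using cons[of "{\<phi>, \<^bold>\<not> \<phi>}"] entails_impE[of "{\<phi>, \<^bold>\<not> \<phi>}" \<phi> "\<^bold>\<bottom>"] that by (auto intro: entails_assm)
  have "henkin X"
  proof
    fix S \<phi> assume S: "finite S" "S \<subseteq> X" "S \<tturnstile> \<phi>" "wff \<phi>"
    have "insert (\<^bold>\<not> \<phi>) S \<tturnstile> \<^bold>\<bottom>"
      using S(3) by (intro entails_impE[of _ \<phi> "\<^bold>\<bottom>"]) (auto intro: entails_assm entails_mono)
    then have "(\<^bold>\<not> \<phi>) \<notin> X" using cons[of "insert (\<^bold>\<not> \<phi>) S"] S by auto
    then show "\<phi> \<in> X" using complete S by blast
  next
    show "\<^bold>\<bottom> \<notin> X" using cons[of "{\<^bold>\<bottom>}"] by (auto intro: entails_assm)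
  next
    fix \<phi> x assume a: "qf \<phi>" "wff \<phi>" "\<And>t. has_type t (snd x) \<Longrightarrow> subst \<phi> x t \<in> X"
    obtain n where n: "P \<phi> x (Ts n) (Ts (Suc n))" using step by blast
    \<comment> \<open>A counterexample recorded at this stage would contradict the instance assumed
      to be in \<open>X\<close>; so the uniform alternative was realised.\<close>
    have "\<not> (has_type t (snd x) \<and> (\<^bold>\<not> subst \<phi> x t) \<in> Ts (Suc n))" for t
      using clash a(3) sub by blast
    then have "\<forall>t. has_type t (snd x) \<longrightarrow> Ts (Suc n) \<tturnstile> subst \<phi> x t"
      using n fin_consistent a(1,2) unfolding P_def by blast
    then show "\<exists>S. finite S \<and> S \<subseteq> X \<and> (\<forall>t. has_type t (snd x) \<longrightarrow> S \<tturnstile> subst \<phi> x t)"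
      using fin_consistent[of "Suc n"] sub[of "Suc n"] by (auto simp: fin_consistent_def)
  qed (fact complete)
  moreover have "T \<subseteq> X" using sub[of 0] Ts by simp
  ultimately show ?thesis using that by blast
qed

theorem completeness:
  assumes "finite T" "\<And>\<psi>. \<psi> \<in> T \<Longrightarrow> wff \<psi>" "wff \<phi>"
    and "\<And>X. henkin X \<Longrightarrow> T \<subseteq> X \<Longrightarrow> \<phi> \<in> X"
  shows "T \<tturnstile> \<phi>"
proof (rule ccontr)
  assume "\<not> T \<tturnstile> \<phi>"
  then have "fin_consistent (insert (\<^bold>\<not> \<phi>) T)" using assms entails_raa by (auto simp: fin_consistent_def)
  then obtain X where X: "henkin X" "insert (\<^bold>\<not> \<phi>) T \<subseteq> X" by (rule henkin_exists)
  then have "{\<phi>, \<^bold>\<not> \<phi>} \<subseteq> X" using assms by auto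
  moreover have "{\<phi>, \<^bold>\<not> \<phi>} \<tturnstile> \<^bold>\<bottom>" by (rule entails_impE[of _ \<phi>]) (auto intro: entails_assm)
  ultimately show False using henkin.closure[OF X(1), of "{\<phi>, \<^bold>\<not> \<phi>}" "\<^bold>\<bottom>"] henkin.Bot_notin[OF X(1)]
    by simp
qed

section \<open>Connectives and instantiation in a Henkin set\<close>

context henkin
begin

lemma entailed: "T \<subseteq> X \<Longrightarrow> finite T \<Longrightarrow> (\<And>\<Gamma>. T \<subseteq> set \<Gamma> \<Longrightarrow> \<Gamma> \<turnstile> \<phi>) \<Longrightarrow> wff \<phi> \<Longrightarrow> \<phi> \<in> X"
  by (rule closure) (auto intro: entailsI)

lemma imp_iff [simp]:
  assumes "wff \<phi>" "wff \<psi>"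
  shows "(\<phi> \<^bold>\<longrightarrow> \<psi>) \<in> X \<longleftrightarrow> (\<phi> \<in> X \<longrightarrow> \<psi> \<in> X)"
proof
  assume "(\<phi> \<^bold>\<longrightarrow> \<psi>) \<in> X"
  then show "\<phi> \<in> X \<longrightarrow> \<psi> \<in> X"
    using closure[of "{\<phi> \<^bold>\<longrightarrow> \<psi>, \<phi>}" \<psi>] assms
      entails_impE[OF entails_assm entails_assm, of \<phi> \<psi> "{\<phi> \<^bold>\<longrightarrow> \<psi>, \<phi>}"] by auto
next
  assume *: "\<phi> \<in> X \<longrightarrow> \<psi> \<in> X"
  show "(\<phi> \<^bold>\<longrightarrow> \<psi>) \<in> X"
  proof (cases "\<psi> \<in> X")
    case True
    then show ?thesis using closure[of "{\<psi>}" "\<phi> \<^bold>\<longrightarrow> \<psi>"] assms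
      by (auto intro: entails_impI entails_assm)
  next
    case False
    with * complete[OF assms(1)] have "(\<^bold>\<not> \<phi>) \<in> X" by blast
    moreover have "{\<phi>, \<^bold>\<not> \<phi>} \<tturnstile> \<psi>"
      using assms by (intro entails_efq[OF entails_impE[where \<phi> = \<phi>, OF entails_assm entails_assm]]) auto
    then have "{\<^bold>\<not> \<phi>} \<tturnstile> \<phi> \<^bold>\<longrightarrow> \<psi>" using assms by (intro entails_impI)
    ultimately show ?thesis using closure[of "{\<^bold>\<not> \<phi>}" "\<phi> \<^bold>\<longrightarrow> \<psi>"] assms by auto
  qed
qed

lemma Bot_iff [simp]: "\<^bold>\<bottom> \<in> X \<longleftrightarrow> False"
  using Bot_notin by simp

lemma all_inst: "Forall x \<phi> \<in> X \<Longrightarrow> has_type t (snd x) \<Longrightarrow> free_for t x \<phi> \<Longrightarrow> wff \<phi> \<Longrightarrow> subst \<phi> x t \<in> X"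
  using closure[of "{Forall x \<phi>}" "subst \<phi> x t"]
  by (auto intro: entails_allE entails_assm simp: wff_subst)

end

lemma has_type_lam' [simp]: "snd x = \<sigma> \<Longrightarrow> has_type t \<tau> \<Longrightarrow> has_type (lam x t) (\<sigma> \<Rrightarrow> \<tau>)"
  using has_type_lam by blast

declare lam.simps [simp del] tvars_lam [simp]

lemma has_type_iff: "has_type t \<sigma> \<Longrightarrow> has_type t \<tau> \<longleftrightarrow> \<tau> = \<sigma>"
  using has_type_unique by blast

lemma ueq_rec_zero: "has_type s N \<Longrightarrow> has_type t (N \<Rrightarrow> N \<Rrightarrow> N) \<Longrightarrow> ueq N (Rec \<cdot> Zero \<cdot> s \<cdot> t) s"
  by (auto simp: ueq_def intro!: EPRA_der EPRA.rec_zero)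

lemma ueq_rec_succ: "has_type n N \<Longrightarrow> has_type s N \<Longrightarrow> has_type t (N \<Rrightarrow> N \<Rrightarrow> N) \<Longrightarrow>
    ueq N (Rec \<cdot> (Succ \<cdot> n) \<cdot> s \<cdot> t) (t \<cdot> (Rec \<cdot> n \<cdot> s \<cdot> t) \<cdot> n)"
  by (auto simp: ueq_def intro!: EPRA_der EPRA.rec_succ)

primrec numeral_term :: "nat \<Rightarrow> trm" where
  "numeral_term 0 = Zero"
| "numeral_term (Suc k) = Succ \<cdot> numeral_term k"

lemma has_type_numeral_term [simp]: "has_type (numeral_term k) N"
  by (induction k) auto

section \<open>The elements of sort \<open>N\<close> and the action of terms on them\<close>

context henkin
begin

text \<open>The elements of sort \<open>N\<close> are the classes of terms that are equal in \<open>X\<close>. They are enumerated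
  without repetition by the natural numbers, so that equations between them need no carrier
  conditions; the number that names an element has no meaning.\<close>

definition cls :: "trm \<Rightarrow> trm set" where
  "cls s = {t. has_type t N \<and> (s \<^bold>= t) \<in> X}"

definition val :: "trm \<Rightarrow> nat" where
  "val s = to_nat_on (cls ` {t. has_type t N}) (cls s)"

lemma EPRA_X: "\<phi> \<in> EPRA \<Longrightarrow> wff \<phi> \<Longrightarrow> \<phi> \<in> X"
  by (rule entailed[of "{}"]) (auto intro: EPRA_der)

lemma eq_refl_X: "has_type s N \<Longrightarrow> (s \<^bold>= s) \<in> X"
  by (auto intro!: EPRA_X EPRA.eq_refl)

lemma eq_sym_X: "(s \<^bold>= t) \<in> X \<Longrightarrow> has_type s N \<Longrightarrow> has_type t N \<Longrightarrow> (t \<^bold>= s) \<in> X"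
  using EPRA_X[OF EPRA.eq_sym[of s t]] by simp

lemma eq_trans_X: "(s \<^bold>= t) \<in> X \<Longrightarrow> (t \<^bold>= u) \<in> X \<Longrightarrow> has_type s N \<Longrightarrow> has_type t N \<Longrightarrow> has_type u N \<Longrightarrow>
    (s \<^bold>= u) \<in> X"
  using EPRA_X[OF EPRA.eq_trans[of s t u]] by simp

lemma cls_eq_iff: "has_type s N \<Longrightarrow> has_type t N \<Longrightarrow> cls s = cls t \<longleftrightarrow> (s \<^bold>= t) \<in> X"
  unfolding cls_def by (blast intro: eq_refl_X eq_sym_X eq_trans_X)

lemma Succ_nonzero_X: "has_type s N \<Longrightarrow> (Succ \<cdot> s \<^bold>= Zero) \<notin> X"
  using EPRA_X[OF EPRA.succ_nonzero[of s]] by simp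

lemma Succ_nonzero_X': "has_type s N \<Longrightarrow> (Zero \<^bold>= Succ \<cdot> s) \<notin> X"
  using Succ_nonzero_X eq_sym_X[of Zero "Succ \<cdot> s"] by auto

lemma Succ_inj_X: "(Succ \<cdot> s \<^bold>= Succ \<cdot> t) \<in> X \<Longrightarrow> has_type s N \<Longrightarrow> has_type t N \<Longrightarrow> (s \<^bold>= t) \<in> X"
  using EPRA_X[OF EPRA.succ_inj[of s t]] by simp

text \<open>Distinct numerals lie in distinct classes by the successor axioms. Infinitude makes
  \<open>to_nat_on\<close> a bijection onto all of \<open>nat\<close>, so every natural number names
  an element.\<close>

lemma infinite_classes: "infinite (cls ` {t. has_type t N})"
proof -
  have "k = l" if "(numeral_term k \<^bold>= numeral_term l) \<in> X" for k l
    using that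
  proof (induction k arbitrary: l)
    case 0
    then show ?case using Succ_nonzero_X' by (cases l) auto
  next
    case (Suc k)
    then show ?case using Succ_nonzero_X Succ_inj_X by (cases l) auto
  qed
  then have "inj (\<lambda>k. cls (numeral_term k))" by (auto simp: inj_def cls_eq_iff)
  then have "infinite (range (\<lambda>k. cls (numeral_term k)))" by (simp add: finite_image_iff)
  then show ?thesis by (rule infinite_super[rotated]) auto
qed

lemma val_bij: "bij_betw (to_nat_on (cls ` {t. has_type t N})) (cls ` {t. has_type t N}) UNIV"
  using infinite_classes by (intro to_nat_on_infinite) auto

lemma val_eq_iff: "has_type s N \<Longrightarrow> has_type t N \<Longrightarrow> (s \<^bold>= t) \<in> X \<longleftrightarrow> val s = val t"
  using val_bij by (simp add: bij_betw_def inj_on_eq_iff[of _ "cls ` {t. has_type t N}"] val_def cls_eq_iff)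

lemma val_surj: obtains t where "has_type t N" "val t = a"
proof -
  have "a \<in> to_nat_on (cls ` {t. has_type t N}) ` (cls ` {t. has_type t N})"
    using val_bij by (auto simp: bij_betw_def)
  then show ?thesis using that by (auto simp: val_def)
qed

definition nm :: "nat \<Rightarrow> trm" where
  "nm a = (SOME t. has_type t N \<and> val t = a)"

lemma nm [simp]: "has_type (nm a) N" "val (nm a) = a"
proof -
  have "\<exists>t. has_type t N \<and> val t = a" by (metis val_surj)
  from someI_ex[OF this] show "has_type (nm a) N" "val (nm a) = a" by (auto simp: nm_def)
qed

lemma ueq_val: "ueq N s t \<Longrightarrow> val s = val t"
proof -
  assume a: "ueq N s t"
  then have "(s \<^bold>= t) \<in> X" by (intro entailed[of "{}"]) (auto simp: ueq_def)
  then show ?thesis using a by (simp add: val_eq_iff ueq_def)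
qed

lemma val_cong:
  assumes "has_type \<phi> (N \<Rrightarrow> \<tau>)" "val s = val t" "has_type s N" "has_type t N" "args_for us \<tau>"
  shows "val (apps (\<phi> \<cdot> s) us) = val (apps (\<phi> \<cdot> t) us)"
proof -
  have types: "has_type (apps (\<phi> \<cdot> s) us) N" "has_type (apps (\<phi> \<cdot> t) us) N"
    using assms by (auto intro!: has_type_apps)
  have "(apps (\<phi> \<cdot> s) us \<^bold>= apps (\<phi> \<cdot> t) us) \<in> X"
  proof (rule entailed[of "{s \<^bold>= t}"])
    fix \<Gamma> assume "{s \<^bold>= t} \<subseteq> set \<Gamma>"
    then show "\<Gamma> \<turnstile> apps (\<phi> \<cdot> s) us \<^bold>= apps (\<phi> \<cdot> t) us"
      using assms by (intro der_ext) (auto intro: derivable.assm)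
  qed (use assms types in \<open>auto simp: val_eq_iff\<close>)
  then show ?thesis using types by (simp add: val_eq_iff)
qed

text \<open>Arguments enter through the representatives \<open>nm\<close>; by
  \<open>val_cong\<close> their choice is irrelevant, and \<open>val_op1\<close>,
  \<open>val_op2\<close>, \<open>val_op3\<close> then compute the values of applications from the
  values of the arguments.\<close>

definition op1 :: "trm \<Rightarrow> nat \<Rightarrow> nat" where "op1 f a = val (f \<cdot> nm a)"
definition op2 :: "trm \<Rightarrow> nat \<Rightarrow> nat \<Rightarrow> nat" where "op2 f a b = val (f \<cdot> nm a \<cdot> nm b)"
definition op3 :: "trm \<Rightarrow> nat \<Rightarrow> nat \<Rightarrow> nat \<Rightarrow> nat" where
  "op3 f a b c = val (f \<cdot> nm a \<cdot> nm b \<cdot> nm c)"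

lemma val_op1: "has_type f (N \<Rrightarrow> N) \<Longrightarrow> has_type s N \<Longrightarrow> val (f \<cdot> s) = op1 f (val s)"
  unfolding op1_def using val_cong[of f N s "nm (val s)" "[]"] by simp

lemma val_op2:
  assumes "has_type f (N \<Rrightarrow> N \<Rrightarrow> N)" "has_type s N" "has_type t N"
  shows "val (f \<cdot> s \<cdot> t) = op2 f (val s) (val t)"
proof -
  have "val (f \<cdot> s \<cdot> t) = val (f \<cdot> nm (val s) \<cdot> t)"
    using assms val_cong[of f "N \<Rrightarrow> N" s "nm (val s)" "[t]"] by simp
  also have "\<dots> = op2 f (val s) (val t)"
    using assms by (subst val_op1) (auto simp: op1_def op2_def)
  finally show ?thesis .
qed

lemma val_op3:
  assumes "has_type f (N \<Rrightarrow> N \<Rrightarrow> N \<Rrightarrow> N)" "has_type s N" "has_type t N" "has_type u N"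
  shows "val (f \<cdot> s \<cdot> t \<cdot> u) = op3 f (val s) (val t) (val u)"
proof -
  have "val (f \<cdot> s \<cdot> t \<cdot> u) = val (f \<cdot> nm (val s) \<cdot> t \<cdot> u)"
    using assms val_cong[of f "N \<Rrightarrow> N \<Rrightarrow> N" s "nm (val s)" "[t, u]"] by simp
  also have "\<dots> = op3 f (val s) (val t) (val u)"
    using assms by (subst val_op2) (auto simp: op2_def op3_def)
  finally show ?thesis .
qed

lemma val_beta1: "has_type t N \<Longrightarrow> has_type u (snd x) \<Longrightarrow> typed_env \<theta> \<Longrightarrow>
    val (sub \<theta> (lam x t) \<cdot> u) = val (sub (\<theta>(x := u)) t)"
  by (intro ueq_val beta)

lemma val_beta2: "has_type t N \<Longrightarrow> has_type u (snd x) \<Longrightarrow> has_type v (snd y) \<Longrightarrow> typed_env \<theta> \<Longrightarrow>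
    val (sub \<theta> (lam x (lam y t)) \<cdot> u \<cdot> v) = val (sub (\<theta>(x := u, y := v)) t)"
  using ueq_val[OF ueq_fun[OF beta[of "lam y t" "snd y \<Rrightarrow> N"]]] by (simp add: val_beta1)

lemma val_beta3: "has_type t N \<Longrightarrow> has_type u (snd x) \<Longrightarrow> has_type v (snd y) \<Longrightarrow> has_type w (snd z) \<Longrightarrow>
    typed_env \<theta> \<Longrightarrow>
    val (sub \<theta> (lam x (lam y (lam z t))) \<cdot> u \<cdot> v \<cdot> w) = val (sub (\<theta>(x := u, y := v, z := w)) t)"
  using ueq_val[OF ueq_fun[OF ueq_fun[OF beta[of "lam y (lam z t)" "snd y \<Rrightarrow> snd z \<Rrightarrow> N"]]]]
  by (simp add: val_beta2)

lemma val_beta4: "has_type t N \<Longrightarrow> has_type u (snd x) \<Longrightarrow> has_type v (snd y) \<Longrightarrow> has_type w (snd z) \<Longrightarrow>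
    has_type w' (snd z') \<Longrightarrow> typed_env \<theta> \<Longrightarrow>
    val (sub \<theta> (lam x (lam y (lam z (lam z' t)))) \<cdot> u \<cdot> v \<cdot> w \<cdot> w') =
    val (sub (\<theta>(x := u, y := v, z := w, z' := w')) t)"
  using ueq_val[OF ueq_fun[OF ueq_fun[OF ueq_fun[OF beta[of "lam y (lam z (lam z' t))"
    "snd y \<Rrightarrow> snd z \<Rrightarrow> snd z' \<Rrightarrow> N"]]]]]
  by (simp add: val_beta3)

abbreviation ze :: nat where "ze \<equiv> val Zero"
abbreviation su :: "nat \<Rightarrow> nat" where "su \<equiv> op1 Succ"

lemma val_Succ: "has_type s N \<Longrightarrow> val (Succ \<cdot> s) = su (val s)"
  by (simp add: val_op1)

lemma su_ze [simp]: "su a \<noteq> ze" "ze \<noteq> su a"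
  using Succ_nonzero_X[of "nm a"] by (auto simp: val_eq_iff val_Succ)

lemma su_inj [simp]: "su a = su b \<longleftrightarrow> a = b"
  using Succ_inj_X[of "nm a" "nm b"] by (auto simp: val_eq_iff val_Succ)

section \<open>Definability and induction\<close>

definition dfun :: "(nat \<Rightarrow> nat) \<Rightarrow> bool" where
  "dfun F \<longleftrightarrow> (\<exists>f. has_type f (N \<Rrightarrow> N) \<and> (\<forall>a. F a = op1 f a))"

text \<open>The defining formula is demanded for every large index \<open>i\<close>: the variable
  \<open>(i, N)\<close> must avoid the parameters inside the terms, and two formulas can be joined
  only over a common variable.\<close>

definition dpred :: "(nat \<Rightarrow> bool) \<Rightarrow> bool" where
  "dpred P \<longleftrightarrow> (\<exists>i0. \<forall>i\<ge>i0. \<exists>\<phi>. qf \<phi> \<and> wff \<phi> \<and>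
     (\<forall>t. has_type t N \<longrightarrow> (subst \<phi> (i, N) t \<in> X \<longleftrightarrow> P (val t))))"

lemma dfun_const: "dfun (\<lambda>_. c)"
  unfolding dfun_def using ueq_val[OF ueq_pi[of "nm c" N _ N]]
  by (intro exI[of _ "PiC N N \<cdot> nm c"]) (simp add: op1_def)

lemma dfun_id: "dfun (\<lambda>a. a)"
  unfolding dfun_def using val_beta1[of "Var (0, N)" _ "(0, N)" Var]
  by (intro exI[of _ "lam (0, N) (Var (0, N))"]) (simp add: op1_def)

text \<open>Composition is written as \<open>S (K h) f\<close>, which needs no fresh variable
  although \<open>h\<close> and \<open>f\<close> may contain parameters. The two- and three-place
  versions continue the same pattern.\<close>

lemma dfun_op1:
  assumes "has_type h (N \<Rrightarrow> N)" "dfun F"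
  shows "dfun (\<lambda>a. op1 h (F a))"
proof -
  obtain f where f: "has_type f (N \<Rrightarrow> N)" "\<And>a. F a = op1 f a"
    using assms by (auto simp: dfun_def)
  have "ueq N (SigC N N N \<cdot> (PiC (N \<Rrightarrow> N) N \<cdot> h) \<cdot> f \<cdot> nm a) (h \<cdot> (f \<cdot> nm a))" for a
  proof -
    have "ueq N (SigC N N N \<cdot> (PiC (N \<Rrightarrow> N) N \<cdot> h) \<cdot> f \<cdot> nm a) (PiC (N \<Rrightarrow> N) N \<cdot> h \<cdot> nm a \<cdot> (f \<cdot> nm a))"
      using f assms by (intro ueq_sigma) auto
    also have "ueq N \<dots> (h \<cdot> (f \<cdot> nm a))"
      using f assms by (intro ueq_arg ueq_fun[OF ueq_pi]) auto
    finally show ?thesis .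
  qed
  then have "op1 (SigC N N N \<cdot> (PiC (N \<Rrightarrow> N) N \<cdot> h) \<cdot> f) a = op1 h (F a)" for a
    using f assms by (subst op1_def, subst ueq_val) (auto simp: val_op1 has_type_iff[OF f(1)])
  then show ?thesis
    unfolding dfun_def using f assms by (intro exI[of _ "SigC N N N \<cdot> (PiC (N \<Rrightarrow> N) N \<cdot> h) \<cdot> f"]) auto
qed

lemma ueq_S:
  assumes "has_type h (N \<Rrightarrow> \<sigma> \<Rrightarrow> \<tau>)" "has_type f (N \<Rrightarrow> \<sigma>)" "has_type s N"
  shows "ueq \<tau> (SigC N \<sigma> \<tau> \<cdot> h \<cdot> f \<cdot> s) (h \<cdot> s \<cdot> (f \<cdot> s))"
  using assms by (intro ueq_sigma) auto

lemma dfun_op2: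
  assumes "has_type h (N \<Rrightarrow> N \<Rrightarrow> N)" "dfun F" "dfun G"
  shows "dfun (\<lambda>a. op2 h (F a) (G a))"
proof -
  obtain f g where f: "has_type f (N \<Rrightarrow> N)" "\<And>a. F a = op1 f a"
    and g: "has_type g (N \<Rrightarrow> N)" "\<And>a. G a = op1 g a"
    using assms by (auto simp: dfun_def)
  let ?k = "SigC N N (N \<Rrightarrow> N) \<cdot> (PiC (N \<Rrightarrow> N \<Rrightarrow> N) N \<cdot> h) \<cdot> f"
  have "ueq N (SigC N N N \<cdot> ?k \<cdot> g \<cdot> nm a) (h \<cdot> (f \<cdot> nm a) \<cdot> (g \<cdot> nm a))" for a
  proof -
    have "ueq N (SigC N N N \<cdot> ?k \<cdot> g \<cdot> nm a) (?k \<cdot> nm a \<cdot> (g \<cdot> nm a))"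
      using f g assms by (intro ueq_S) auto
    also have "ueq N \<dots> (PiC (N \<Rrightarrow> N \<Rrightarrow> N) N \<cdot> h \<cdot> nm a \<cdot> (f \<cdot> nm a) \<cdot> (g \<cdot> nm a))"
      using f g assms by (intro ueq_fun[OF ueq_S]) auto
    also have "ueq N \<dots> (h \<cdot> (f \<cdot> nm a) \<cdot> (g \<cdot> nm a))"
      using f g assms by (intro ueq_fun[OF ueq_fun[OF ueq_pi]]) auto
    finally show ?thesis .
  qed
  then have "op1 (SigC N N N \<cdot> ?k \<cdot> g) a = op2 h (F a) (G a)" for a
    using f g assms by (subst op1_def, subst ueq_val) (auto simp: val_op1[OF f(1)] val_op1[OF g(1)] val_op2 has_type_iff[OF f(1)] has_type_iff[OF g(1)])
  then show ?thesis
    unfolding dfun_def using f g assms by (intro exI[of _ "SigC N N N \<cdot> ?k \<cdot> g"]) auto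
qed

lemma dfun_op3:
  assumes "has_type h (N \<Rrightarrow> N \<Rrightarrow> N \<Rrightarrow> N)" "dfun F" "dfun G" "dfun H"
  shows "dfun (\<lambda>a. op3 h (F a) (G a) (H a))"
proof -
  obtain f g k where f: "has_type f (N \<Rrightarrow> N)" "\<And>a. F a = op1 f a"
    and g: "has_type g (N \<Rrightarrow> N)" "\<And>a. G a = op1 g a"
    and k: "has_type k (N \<Rrightarrow> N)" "\<And>a. H a = op1 k a"
    using assms by (auto simp: dfun_def)
  let ?p = "SigC N N (N \<Rrightarrow> N \<Rrightarrow> N) \<cdot> (PiC (N \<Rrightarrow> N \<Rrightarrow> N \<Rrightarrow> N) N \<cdot> h) \<cdot> f"
  let ?q = "SigC N N (N \<Rrightarrow> N) \<cdot> ?p \<cdot> g"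
  have "ueq N (SigC N N N \<cdot> ?q \<cdot> k \<cdot> nm a) (h \<cdot> (f \<cdot> nm a) \<cdot> (g \<cdot> nm a) \<cdot> (k \<cdot> nm a))" for a
  proof -
    have "ueq N (SigC N N N \<cdot> ?q \<cdot> k \<cdot> nm a) (?q \<cdot> nm a \<cdot> (k \<cdot> nm a))"
      using f g k assms by (intro ueq_S) auto
    also have "ueq N \<dots> (?p \<cdot> nm a \<cdot> (g \<cdot> nm a) \<cdot> (k \<cdot> nm a))"
      using f g k assms by (intro ueq_fun[OF ueq_S]) auto
    also have "ueq N \<dots> (PiC (N \<Rrightarrow> N \<Rrightarrow> N \<Rrightarrow> N) N \<cdot> h \<cdot> nm a \<cdot> (f \<cdot> nm a) \<cdot> (g \<cdot> nm a) \<cdot> (k \<cdot> nm a))"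
      using f g k assms by (intro ueq_fun[OF ueq_fun[OF ueq_S]]) auto
    also have "ueq N \<dots> (h \<cdot> (f \<cdot> nm a) \<cdot> (g \<cdot> nm a) \<cdot> (k \<cdot> nm a))"
      using f g k assms by (intro ueq_fun[OF ueq_fun[OF ueq_fun[OF ueq_pi]]]) auto
    finally show ?thesis .
  qed
  then have "op1 (SigC N N N \<cdot> ?q \<cdot> k) a = op3 h (F a) (G a) (H a)" for a
    using f g k assms by (subst op1_def, subst ueq_val) (auto simp: val_op1[OF f(1)] val_op1[OF g(1)] val_op1[OF k(1)] val_op3 has_type_iff[OF f(1)] has_type_iff[OF g(1)] has_type_iff[OF k(1)])
  then show ?thesis
    unfolding dfun_def using f g k assms by (intro exI[of _ "SigC N N N \<cdot> ?q \<cdot> k"]) auto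
qed

lemma dpred_eq:
  assumes "dfun F" "dfun G"
  shows "dpred (\<lambda>a. F a = G a)"
proof -
  obtain f g where f: "has_type f (N \<Rrightarrow> N)" "\<And>a. F a = op1 f a"
    and g: "has_type g (N \<Rrightarrow> N)" "\<And>a. G a = op1 g a"
    using assms by (auto simp: dfun_def)
  have "finite (tvars f \<union> tvars g)" by auto
  then obtain i0 where i0: "\<And>x. x \<in> tvars f \<union> tvars g \<Longrightarrow> fst x < i0" by (rule fresh_var) auto
  show ?thesis unfolding dpred_def
  proof (intro exI[of _ i0] HOL.allI HOL.impI)
    fix i assume "i0 \<le> i"
    with i0[of "(i, N)"] have "(i, N) \<notin> tvars f" "(i, N) \<notin> tvars g" by auto
    then show "\<exists>\<phi>. qf \<phi> \<and> wff \<phi> \<and>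
        (\<forall>t. has_type t N \<longrightarrow> (subst \<phi> (i, N) t \<in> X \<longleftrightarrow> F (val t) = G (val t)))"
      using f g by (intro exI[of _ "f \<cdot> Var (i, N) \<^bold>= g \<cdot> Var (i, N)"])
        (auto simp: val_eq_iff val_op1 has_type_iff[of f] has_type_iff[of g])
  qed
qed

lemma dpred_imp:
  assumes "dpred P" "dpred Q"
  shows "dpred (\<lambda>a. P a \<longrightarrow> Q a)"
proof -
  obtain i0 j0 where
    P: "\<And>i. i \<ge> i0 \<Longrightarrow> \<exists>\<phi>. qf \<phi> \<and> wff \<phi> \<and> (\<forall>t. has_type t N \<longrightarrow> (subst \<phi> (i, N) t \<in> X \<longleftrightarrow> P (val t)))" and
    Q: "\<And>i. i \<ge> j0 \<Longrightarrow> \<exists>\<phi>. qf \<phi> \<and> wff \<phi> \<and> (\<forall>t. has_type t N \<longrightarrow> (subst \<phi> (i, N) t \<in> X \<longleftrightarrow> Q (val t)))"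
    using assms by (auto simp: dpred_def)
  show ?thesis unfolding dpred_def
  proof (intro exI[of _ "max i0 j0"] HOL.allI HOL.impI)
    fix i assume "max i0 j0 \<le> i"
    with P[of i] Q[of i] obtain \<phi> \<psi> where
      "qf \<phi>" "wff \<phi>" "\<And>t. has_type t N \<Longrightarrow> (subst \<phi> (i, N) t \<in> X \<longleftrightarrow> P (val t))"
      "qf \<psi>" "wff \<psi>" "\<And>t. has_type t N \<Longrightarrow> (subst \<psi> (i, N) t \<in> X \<longleftrightarrow> Q (val t))"
      by auto
    then show "\<exists>\<phi>. qf \<phi> \<and> wff \<phi> \<and>
        (\<forall>t. has_type t N \<longrightarrow> (subst \<phi> (i, N) t \<in> X \<longleftrightarrow> (P (val t) \<longrightarrow> Q (val t))))"
      by (intro exI[of _ "\<phi> \<^bold>\<longrightarrow> \<psi>"]) (simp add: wff_subst)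
  qed
qed

lemma dpred_False: "dpred (\<lambda>a. False)"
  unfolding dpred_def by (rule exI[of _ 0], intro HOL.allI HOL.impI, rule exI[of _ "\<^bold>\<bottom>"]) simp

lemma dpred_not: "dpred P \<Longrightarrow> dpred (\<lambda>a. \<not> P a)"
  using dpred_imp[OF _ dpred_False] by simp

lemma dpred_disj: "dpred P \<Longrightarrow> dpred Q \<Longrightarrow> dpred (\<lambda>a. P a \<or> Q a)"
  using dpred_imp[OF dpred_not, of P Q] by (simp add: disj_imp)

lemma dpred_conj: "dpred P \<Longrightarrow> dpred Q \<Longrightarrow> dpred (\<lambda>a. P a \<and> Q a)"
  using dpred_not[OF dpred_disj[OF dpred_not dpred_not], of P Q] by simp

text \<open>These rules follow the syntax of a predicate, so definability of an induction hypothesis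
  reduces to typing conditions for the terms in it. Constants count as definable, which admits
  arbitrary parameters.\<close>

lemmas definable_intros = dpred_conj dpred_disj dpred_not dpred_imp dpred_eq dfun_const dfun_id dfun_op1 dfun_op2 dfun_op3

text \<open>Names of elements carry no meaning, so induction on \<open>nat\<close> says nothing
  here. What is used is the quantifier-free induction axiom inside the calculus, whose universally
  quantified step premise is obtained from truth of all its instances through
  \<open>generic\<close>.\<close>

theorem induct [case_names dpred ze su]:
  assumes "dpred P" "P ze" "\<And>a. P a \<Longrightarrow> P (su a)"
  shows "P a"
proof -
  obtain i \<phi> where \<phi>: "qf \<phi>" "wff \<phi>" "\<And>t. has_type t N \<Longrightarrow> subst \<phi> (i, N) t \<in> X \<longleftrightarrow> P (val t)"
    using assms(1) unfolding dpred_def by blast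
  define x where "x = (i, N)"
  have x: "snd x = N" by (simp add: x_def)
  define step where "step = (\<phi> \<^bold>\<longrightarrow> subst \<phi> x (Succ \<cdot> Var x))"
  have step: "qf step" "wff step" using \<phi> x by (auto simp: step_def wff_subst)
  have subst_S: "subst (subst \<phi> x (Succ \<cdot> Var x)) x t = subst \<phi> x (Succ \<cdot> t)" for t
  proof -
    have "tsubst (tsubst s x (Succ \<cdot> Var x)) x t = tsubst s x (Succ \<cdot> t)" for s
      by (induction s) auto
    then show ?thesis using \<phi>(1) by (induction \<phi>) auto
  qed
  have "subst step x t \<in> X" if "has_type t N" for t
    using that \<phi> assms(3) by (simp add: step_def subst_S wff_subst x_def[symmetric] val_Succ x)
  from generic[OF step, of x] this x obtain T where
    T: "finite T" "T \<subseteq> X" "\<And>t. has_type t N \<Longrightarrow> T \<tturnstile> subst step x t" by auto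
  have "subst \<phi> x (nm a) \<in> X"
  proof (rule entailed[of "insert (subst \<phi> x Zero) T"])
    fix \<Gamma> assume \<Gamma>: "insert (subst \<phi> x Zero) T \<subseteq> set \<Gamma>"
    \<comment> \<open>The induction axiom is applied at the eigenvariable \<open>z\<close>, since
      \<open>x\<close> itself may be free in the context and then could not be generalised.\<close>
    from entails_gen[OF _ step(1), of "{}" x T \<Gamma>] obtain z where
      z: "snd z = N" "\<forall>\<psi>\<in>set \<Gamma>. z \<notin> fv \<psi>" "z \<notin> fv step" "\<Gamma> \<turnstile> Forall z (subst step x (Var z))"
      using T(3) \<Gamma> x by (metis finite.emptyI has_type.simps(1) insert_subset)
    have z\<phi>: "z \<notin> fv \<phi>" using z by (auto simp: step_def)
    let ?\<phi> = "subst \<phi> x (Var z)"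
    have "subst ?\<phi> z Zero = subst \<phi> x Zero" "subst ?\<phi> z (Succ \<cdot> Var z) = subst \<phi> x (Succ \<cdot> Var z)"
      using \<phi> z\<phi> by (auto simp: subst_subst)
    moreover have "subst step x (Var z) = (?\<phi> \<^bold>\<longrightarrow> subst \<phi> x (Succ \<cdot> Var z))"
      by (simp add: step_def subst_S)
    moreover have "\<Gamma> \<turnstile> (subst ?\<phi> z Zero \<^bold>\<longrightarrow> Forall z (?\<phi> \<^bold>\<longrightarrow> subst ?\<phi> z (Succ \<cdot> Var z)) \<^bold>\<longrightarrow> Forall z ?\<phi>)"
      using \<phi> z x by (intro EPRA_der EPRA.qf_induction) (auto simp: wff_subst)
    ultimately have "\<Gamma> \<turnstile> Forall z ?\<phi>"
      using z(4) \<Gamma> derivable.impE[OF derivable.impE[OF _ derivable.assm]] by auto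
    then have "\<Gamma> \<turnstile> subst ?\<phi> z (nm a)"
      using z \<phi> by (intro derivable.allE) (auto intro: free_for_qf)
    then show "\<Gamma> \<turnstile> subst \<phi> x (nm a)" using \<phi> z\<phi> by (simp add: subst_subst)
  qed (use T \<phi> x assms(2) in \<open>auto simp: wff_subst x_def[symmetric]\<close>)
  then show ?thesis using \<phi>(3)[of "nm a"] by (simp add: x_def)
qed

text \<open>Pointwise agreement is a family of true quantifier-free instances;
  \<open>generic\<close> condenses it to finitely many assumptions, from which
  \<open>der_ext\<close> derives the equation of the values.\<close>

lemma val_ext1:
  assumes "has_type f ty1" "has_type g ty1" "\<And>a. op1 f a = op1 g a"
    and "has_type \<phi> (ty1 \<Rrightarrow> \<tau>)" "args_for us \<tau>"
  shows "val (apps (\<phi> \<cdot> f) us) = val (apps (\<phi> \<cdot> g) us)"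
proof -
  have types: "has_type (apps (\<phi> \<cdot> f) us) N" "has_type (apps (\<phi> \<cdot> g) us) N"
    using assms by (auto intro!: has_type_apps)
  have "finite (tvars f \<union> tvars g)" by auto
  then obtain i where i: "\<And>y. y \<in> tvars f \<union> tvars g \<Longrightarrow> fst y < i" by (rule fresh_var) auto
  define x where "x = (i, N)"
  have x: "x \<notin> tvars f" "x \<notin> tvars g" "snd x = N" using i[of x] by (auto simp: x_def)
  have "subst (f \<cdot> Var x \<^bold>= g \<cdot> Var x) x t \<in> X" if "has_type t N" for t
    using assms x that by (auto simp: val_eq_iff val_op1 has_type_iff[of f] has_type_iff[of g])
  from generic[of "f \<cdot> Var x \<^bold>= g \<cdot> Var x" x] this x assms(1,2) obtain T where
    T: "finite T" "T \<subseteq> X" "\<And>t. has_type t N \<Longrightarrow> T \<tturnstile> f \<cdot> t \<^bold>= g \<cdot> t" by auto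
  have "(apps (\<phi> \<cdot> f) us \<^bold>= apps (\<phi> \<cdot> g) us) \<in> X"
  proof (rule entailed[OF T(2,1)])
    fix \<Gamma> assume "T \<subseteq> set \<Gamma>"
    then show "\<Gamma> \<turnstile> apps (\<phi> \<cdot> f) us \<^bold>= apps (\<phi> \<cdot> g) us"
      using assms entailsD[OF T(3)] by (intro der_ext) (auto simp: list_all2_Cons2)
  qed (use types in simp)
  then show ?thesis using types by (simp add: val_eq_iff)
qed

end

section \<open>Arithmetic in a Henkin model\<close>

text \<open>Updates that do not matter are removed, so that equal instances of a step function become
  syntactically equal.\<close>

lemma sub_drop [simp]:
  "x \<notin> tvars t \<Longrightarrow> sub (\<theta>(x := u)) t = sub \<theta> t"
  "x \<notin> tvars t \<Longrightarrow> sub (\<theta>(x := u, x1 := u1)) t = sub (\<theta>(x1 := u1)) t"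
  "x \<notin> tvars t \<Longrightarrow> sub (\<theta>(x := u, x1 := u1, x2 := u2)) t = sub (\<theta>(x1 := u1, x2 := u2)) t"
  "x \<notin> tvars t \<Longrightarrow> sub (\<theta>(x := u, x1 := u1, x2 := u2, x3 := u3)) t = sub (\<theta>(x1 := u1, x2 := u2, x3 := u3)) t"
  by (rule sub_cong; auto)+

section \<open>Types and closedness of the coded functions\<close>

lemma t_pred_type: "has_type t_pred (N \<Rrightarrow> N)" and t_pred_closed: "closed t_pred"
  by (auto simp: t_pred_def)
lemmas t_pred_simps [simp] = has_type_iff[OF t_pred_type] t_pred_closed sub_closed[OF t_pred_closed]

lemma t_add_type: "has_type t_add (N \<Rrightarrow> N \<Rrightarrow> N)" and t_add_closed: "closed t_add"
  by (auto simp: t_add_def)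
lemmas t_add_simps [simp] = has_type_iff[OF t_add_type] t_add_closed sub_closed[OF t_add_closed]

lemma t_monus_type: "has_type t_monus (N \<Rrightarrow> N \<Rrightarrow> N)" and t_monus_closed: "closed t_monus"
  by (auto simp: t_monus_def)
lemmas t_monus_simps [simp] = has_type_iff[OF t_monus_type] t_monus_closed sub_closed[OF t_monus_closed]

lemma t_dist_type: "has_type t_dist (N \<Rrightarrow> N \<Rrightarrow> N)" and t_dist_closed: "closed t_dist"
  by (auto simp: t_dist_def)
lemmas t_dist_simps [simp] = has_type_iff[OF t_dist_type] t_dist_closed sub_closed[OF t_dist_closed]

lemma t_ifz_type: "has_type t_ifz (N \<Rrightarrow> N \<Rrightarrow> N \<Rrightarrow> N)" and t_ifz_closed: "closed t_ifz"
  by (auto simp: t_ifz_def)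
lemmas t_ifz_simps [simp] = has_type_iff[OF t_ifz_type] t_ifz_closed sub_closed[OF t_ifz_closed]

lemma t_tri_type: "has_type t_tri (N \<Rrightarrow> N)" and t_tri_closed: "closed t_tri"
  by (auto simp: t_tri_def)
lemmas t_tri_simps [simp] = has_type_iff[OF t_tri_type] t_tri_closed sub_closed[OF t_tri_closed]

lemma t_pair_type: "has_type t_pair (N \<Rrightarrow> N \<Rrightarrow> N)" and t_pair_closed: "closed t_pair"
  by (auto simp: t_pair_def)
lemmas t_pair_simps [simp] = has_type_iff[OF t_pair_type] t_pair_closed sub_closed[OF t_pair_closed]

lemma t_diag_type: "has_type t_diag (N \<Rrightarrow> N)" and t_diag_closed: "closed t_diag"
  by (auto simp: t_diag_def)
lemmas t_diag_simps [simp] = has_type_iff[OF t_diag_type] t_diag_closed sub_closed[OF t_diag_closed]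

lemma t_fst_type: "has_type t_fst (N \<Rrightarrow> N)" and t_fst_closed: "closed t_fst"
  by (auto simp: t_fst_def)
lemmas t_fst_simps [simp] = has_type_iff[OF t_fst_type] t_fst_closed sub_closed[OF t_fst_closed]

lemma t_snd_type: "has_type t_snd (N \<Rrightarrow> N)" and t_snd_closed: "closed t_snd"
  by (auto simp: t_snd_def)
lemmas t_snd_simps [simp] = has_type_iff[OF t_snd_type] t_snd_closed sub_closed[OF t_snd_closed]

lemma t_cons_type: "has_type t_cons (N \<Rrightarrow> N \<Rrightarrow> N)" and t_cons_closed: "closed t_cons"
  by (auto simp: t_cons_def)
lemmas t_cons_simps [simp] = has_type_iff[OF t_cons_type] t_cons_closed sub_closed[OF t_cons_closed]

lemma t_hd_type: "has_type t_hd (N \<Rrightarrow> N)" and t_hd_closed: "closed t_hd"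
  by (auto simp: t_hd_def)
lemmas t_hd_simps [simp] = has_type_iff[OF t_hd_type] t_hd_closed sub_closed[OF t_hd_closed]

lemma t_tl_type: "has_type t_tl (N \<Rrightarrow> N)" and t_tl_closed: "closed t_tl"
  by (auto simp: t_tl_def)
lemmas t_tl_simps [simp] = has_type_iff[OF t_tl_type] t_tl_closed sub_closed[OF t_tl_closed]

lemma t_drop_type: "has_type t_drop (N \<Rrightarrow> N \<Rrightarrow> N)" and t_drop_closed: "closed t_drop"
  by (auto simp: t_drop_def)
lemmas t_drop_simps [simp] = has_type_iff[OF t_drop_type] t_drop_closed sub_closed[OF t_drop_closed]

lemma t_nth_type: "has_type t_nth (N \<Rrightarrow> N \<Rrightarrow> N)" and t_nth_closed: "closed t_nth"
  by (auto simp: t_nth_def)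
lemmas t_nth_simps [simp] = has_type_iff[OF t_nth_type] t_nth_closed sub_closed[OF t_nth_closed]

lemma t_prepend_type: "has_type t_prepend (ty1 \<Rrightarrow> N \<Rrightarrow> N \<Rrightarrow> N)" and t_prepend_closed: "closed t_prepend"
  by (auto simp: t_prepend_def)
lemmas t_prepend_simps [simp] = has_type_iff[OF t_prepend_type] t_prepend_closed sub_closed[OF t_prepend_closed]

lemma t_upd_type: "has_type t_upd (N \<Rrightarrow> N \<Rrightarrow> N \<Rrightarrow> N)" and t_upd_closed: "closed t_upd"
  by (auto simp: t_upd_def)
lemmas t_upd_simps [simp] = has_type_iff[OF t_upd_type] t_upd_closed sub_closed[OF t_upd_closed]

lemma t_bar_type: "has_type t_bar (ty1 \<Rrightarrow> N \<Rrightarrow> N)" and t_bar_closed: "closed t_bar"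
  by (auto simp: t_bar_def)
lemmas t_bar_simps [simp] = has_type_iff[OF t_bar_type] t_bar_closed sub_closed[OF t_bar_closed]

lemma t_exec_type: "has_type t_exec (ty1 \<Rrightarrow> N \<Rrightarrow> N \<Rrightarrow> N \<Rrightarrow> N)" and t_exec_closed: "closed t_exec"
  by (auto simp: t_exec_def Let_def)
lemmas t_exec_simps [simp] = has_type_iff[OF t_exec_type] t_exec_closed sub_closed[OF t_exec_closed]

lemma t_rest_type: "has_type t_rest (N \<Rrightarrow> N \<Rrightarrow> N)" and t_rest_closed: "closed t_rest"
  by (auto simp: t_rest_def)
lemmas t_rest_simps [simp] = has_type_iff[OF t_rest_type] t_rest_closed sub_closed[OF t_rest_closed]

lemma t_step_type: "has_type t_step (ty1 \<Rrightarrow> N \<Rrightarrow> N \<Rrightarrow> N)" and t_step_closed: "closed t_step"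
  by (auto simp: t_step_def)
lemmas t_step_simps [simp] = has_type_iff[OF t_step_type] t_step_closed sub_closed[OF t_step_closed]

lemma t_config_type: "has_type t_config (ty1 \<Rrightarrow> N \<Rrightarrow> N \<Rrightarrow> N \<Rrightarrow> N)" and t_config_closed: "closed t_config"
  by (auto simp: t_config_def)
lemmas t_config_simps [simp] = has_type_iff[OF t_config_type] t_config_closed sub_closed[OF t_config_closed]

section \<open>Evaluation of terms and elementary arithmetic\<close>

context henkin
begin

lemma val_fn [simp]:
  "has_type t N \<Longrightarrow> has_type u (snd x) \<Longrightarrow> val (lam x t \<cdot> u) = val (sub (Var(x := u)) t)"
  "has_type t N \<Longrightarrow> has_type u (snd x) \<Longrightarrow> has_type v (snd y) \<Longrightarrow>
    val (lam x (lam y t) \<cdot> u \<cdot> v) = val (sub (Var(x := u, y := v)) t)"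
  "has_type t N \<Longrightarrow> has_type u (snd x) \<Longrightarrow> has_type v (snd y) \<Longrightarrow> has_type w (snd z) \<Longrightarrow>
    val (lam x (lam y (lam z t)) \<cdot> u \<cdot> v \<cdot> w) = val (sub (Var(x := u, y := v, z := w)) t)"
  "has_type t N \<Longrightarrow> has_type u (snd x) \<Longrightarrow> has_type v (snd y) \<Longrightarrow> has_type w (snd z) \<Longrightarrow> has_type w' (snd z') \<Longrightarrow>
    val (lam x (lam y (lam z (lam z' t))) \<cdot> u \<cdot> v \<cdot> w \<cdot> w') =
    val (sub (Var(x := u, y := v, z := w, z' := w')) t)"
  using val_beta1[of t u x Var] val_beta2[of t u x v y Var] val_beta3[of t u x v y w z Var]
    val_beta4[of t u x v y w z w' z' Var] by auto

declare val_beta1 [simp] val_beta2 [simp] val_beta3 [simp] val_beta4 [simp]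

lemma op1_beta [simp]:
  "has_type t N \<Longrightarrow> snd x = N \<Longrightarrow> typed_env \<theta> \<Longrightarrow> op1 (sub \<theta> (lam x t)) a = val (sub (\<theta>(x := nm a)) t)"
  by (simp add: op1_def)

lemma val_Rec [simp]:
  "has_type s N \<Longrightarrow> has_type t (N \<Rrightarrow> N \<Rrightarrow> N) \<Longrightarrow> val (Rec \<cdot> Zero \<cdot> s \<cdot> t) = val s"
  "has_type n N \<Longrightarrow> has_type s N \<Longrightarrow> has_type t (N \<Rrightarrow> N \<Rrightarrow> N) \<Longrightarrow>
    val (Rec \<cdot> (Succ \<cdot> n) \<cdot> s \<cdot> t) = val (t \<cdot> (Rec \<cdot> n \<cdot> s \<cdot> t) \<cdot> n)"
  by (intro ueq_val ueq_rec_zero ueq_rec_succ; simp)+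

lemma nm_type_iff [simp]: "has_type (nm a) \<tau> \<longleftrightarrow> \<tau> = N"
  by (simp add: has_type_iff[of _ N])

declare val_Succ [simp]

lemma val_unary [simp]:
  "has_type s N \<Longrightarrow> val (t_pred \<cdot> s) = op1 t_pred (val s)"
  "has_type s N \<Longrightarrow> val (t_tri \<cdot> s) = op1 t_tri (val s)"
  "has_type s N \<Longrightarrow> val (t_diag \<cdot> s) = op1 t_diag (val s)"
  "has_type s N \<Longrightarrow> val (t_fst \<cdot> s) = op1 t_fst (val s)"
  "has_type s N \<Longrightarrow> val (t_snd \<cdot> s) = op1 t_snd (val s)"
  "has_type s N \<Longrightarrow> val (t_hd \<cdot> s) = op1 t_hd (val s)"
  "has_type s N \<Longrightarrow> val (t_tl \<cdot> s) = op1 t_tl (val s)"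
  by (rule val_op1; simp)+

lemma val_binary [simp]:
  "has_type s N \<Longrightarrow> has_type t N \<Longrightarrow> val (t_add \<cdot> s \<cdot> t) = op2 t_add (val s) (val t)"
  "has_type s N \<Longrightarrow> has_type t N \<Longrightarrow> val (t_monus \<cdot> s \<cdot> t) = op2 t_monus (val s) (val t)"
  "has_type s N \<Longrightarrow> has_type t N \<Longrightarrow> val (t_dist \<cdot> s \<cdot> t) = op2 t_dist (val s) (val t)"
  "has_type s N \<Longrightarrow> has_type t N \<Longrightarrow> val (t_pair \<cdot> s \<cdot> t) = op2 t_pair (val s) (val t)"
  "has_type s N \<Longrightarrow> has_type t N \<Longrightarrow> val (t_cons \<cdot> s \<cdot> t) = op2 t_cons (val s) (val t)"
  "has_type s N \<Longrightarrow> has_type t N \<Longrightarrow> val (t_drop \<cdot> s \<cdot> t) = op2 t_drop (val s) (val t)"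
  "has_type s N \<Longrightarrow> has_type t N \<Longrightarrow> val (t_nth \<cdot> s \<cdot> t) = op2 t_nth (val s) (val t)"
  "has_type s N \<Longrightarrow> has_type t N \<Longrightarrow> val (t_rest \<cdot> s \<cdot> t) = op2 t_rest (val s) (val t)"
  by (rule val_op2; simp)+

lemma val_ternary [simp]:
  "has_type s N \<Longrightarrow> has_type t N \<Longrightarrow> has_type u N \<Longrightarrow>
    val (t_ifz \<cdot> s \<cdot> t \<cdot> u) = op3 t_ifz (val s) (val t) (val u)"
  "has_type s N \<Longrightarrow> has_type t N \<Longrightarrow> has_type u N \<Longrightarrow>
    val (t_upd \<cdot> s \<cdot> t \<cdot> u) = op3 t_upd (val s) (val t) (val u)"
  by (rule val_op3; simp)+

lemma pred_eqs [simp]: "op1 t_pred ze = ze" "op1 t_pred (su a) = a"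
proof -
  have "val (t_pred \<cdot> Zero) = ze" by (simp add: t_pred_def)
  then show "op1 t_pred ze = ze" by simp
  have "val (t_pred \<cdot> (Succ \<cdot> nm a)) = a" by (simp add: t_pred_def)
  then show "op1 t_pred (su a) = a" by simp
qed

text \<open>Being a successor is existential; the predecessor as explicit witness makes it
  quantifier-free and thus accessible to induction.\<close>

lemma nat_cases: obtains "a = ze" | b where "a = su b"
proof -
  have "a = ze \<or> a = su (op1 t_pred a)"
    by (rule induct[where P = "\<lambda>a. a = ze \<or> a = su (op1 t_pred a)"]) (intro definable_intros, simp_all)
  then show ?thesis using that by blast
qed

lemma add_eqs [simp]: "op2 t_add a ze = a" "op2 t_add a (su b) = su (op2 t_add a b)"
proof -
  have "val (t_add \<cdot> nm a \<cdot> Zero) = a" by (simp add: t_add_def)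
  then show "op2 t_add a ze = a" by simp
  have "val (t_add \<cdot> nm a \<cdot> (Succ \<cdot> nm b)) = val (Succ \<cdot> (t_add \<cdot> nm a \<cdot> nm b))"
    by (simp add: t_add_def)
  then show "op2 t_add a (su b) = su (op2 t_add a b)" by simp
qed

abbreviation ad (infixl "\<oplus>" 65) where "a \<oplus> b \<equiv> op2 t_add a b"
abbreviation mo (infixl "\<ominus>" 65) where "a \<ominus> b \<equiv> op2 t_monus a b"
abbreviation "tri \<equiv> op1 t_tri"
abbreviation "pr \<equiv> op2 t_pair"
abbreviation "dg \<equiv> op1 t_diag"
abbreviation "cn \<equiv> op2 t_cons"

lemma ifz_eq [simp]: "op3 t_ifz c a b = (if c = ze then a else b)"
proof (cases c rule: nat_cases)
  case 1
  have "val (t_ifz \<cdot> Zero \<cdot> nm a \<cdot> nm b) = a" by (simp add: t_ifz_def)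
  then show ?thesis using 1 by simp
next
  case (2 d)
  have "val (t_ifz \<cdot> (Succ \<cdot> nm d) \<cdot> nm a \<cdot> nm b) = b" by (simp add: t_ifz_def)
  then show ?thesis using 2 by simp
qed

lemma add_ze_left [simp]: "ze \<oplus> a = a"
  by (induction a rule: induct) (intro definable_intros, simp_all)

lemma add_su_left [simp]: "su a \<oplus> b = su (a \<oplus> b)"
  by (induction b rule: induct) (intro definable_intros, simp_all)

lemma add_commute: "a \<oplus> b = b \<oplus> a"
  by (induction b rule: induct) (intro definable_intros, simp_all)

lemma monus_ze [simp]: "a \<ominus> ze = a"
  and monus_su: "a \<ominus> su b = op1 t_pred (a \<ominus> b)"
proof -
  have "val (t_monus \<cdot> nm a \<cdot> Zero) = a" by (simp add: t_monus_def)
  then show "a \<ominus> ze = a" by simp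
  have "val (t_monus \<cdot> nm a \<cdot> (Succ \<cdot> nm b)) = val (t_pred \<cdot> (t_monus \<cdot> nm a \<cdot> nm b))"
    by (simp add: t_monus_def)
  then show "a \<ominus> su b = op1 t_pred (a \<ominus> b)" by simp
qed

lemma monus_su_su [simp]: "su a \<ominus> su b = a \<ominus> b"
  by (induction b rule: induct) (intro definable_intros, simp_all add: monus_su)

lemma monus_self [simp]: "a \<ominus> a = ze"
  by (induction a rule: induct) (intro definable_intros, simp_all)

lemma su_monus_self [simp]: "su a \<ominus> a = su ze"
  by (induction a rule: induct) (intro definable_intros, simp_all)

lemma monus_add_cancel [simp]: "(a \<oplus> b) \<ominus> (a \<oplus> c) = b \<ominus> c"
  by (induction a rule: induct) (intro definable_intros, simp_all)

lemma monus_add_cancel' [simp]: "(a \<oplus> b) \<ominus> a = b"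
  using monus_add_cancel[of a b ze] by (simp del: monus_add_cancel)

section \<open>Cantor pairing and coded sequences\<close>

lemma tri_eqs [simp]: "tri ze = ze" "tri (su a) = tri a \<oplus> su a"
proof -
  have "val (t_tri \<cdot> Zero) = ze" by (simp add: t_tri_def)
  then show "tri ze = ze" by simp
  have "val (t_tri \<cdot> (Succ \<cdot> nm a)) = val (t_add \<cdot> (t_tri \<cdot> nm a) \<cdot> (Succ \<cdot> nm a))"
    by (simp add: t_tri_def del: add_eqs)
  then show "tri (su a) = tri a \<oplus> su a" by simp
qed

lemma pair_eq: "pr a b = tri (a \<oplus> b) \<oplus> a"
proof -
  have "val (t_pair \<cdot> nm a \<cdot> nm b) = tri (a \<oplus> b) \<oplus> a" by (simp add: t_pair_def)
  then show ?thesis by simp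
qed

lemma diag_eqs [simp]: "dg ze = ze"
  "dg (su a) = (if tri (su (dg a)) \<ominus> su a = ze then su (dg a) else dg a)"
proof -
  have "val (t_diag \<cdot> Zero) = ze" by (simp add: t_diag_def)
  then show "dg ze = ze" by simp
  have "val (t_diag \<cdot> (Succ \<cdot> nm a)) =
      val (t_ifz \<cdot> (t_monus \<cdot> (t_tri \<cdot> (Succ \<cdot> (t_diag \<cdot> nm a))) \<cdot> (Succ \<cdot> nm a)) \<cdot>
        (Succ \<cdot> (t_diag \<cdot> nm a)) \<cdot> (t_diag \<cdot> nm a))"
    by (simp add: t_diag_def del: add_eqs)
  then show "dg (su a) = (if tri (su (dg a)) \<ominus> su a = ze then su (dg a) else dg a)"
    by simp
qed

text \<open>\<open>su w \<ominus> m \<noteq> ze\<close> stands for \<open>m \<le> w\<close>. Along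
  the diagonal the test in the recursion of \<open>dg\<close> compares \<open>tri (su w)\<close>
  with \<open>tri w \<oplus> su m\<close>; after cancellation this is
  \<open>su w \<ominus> su m\<close>, so the value stays at \<open>w\<close>.\<close>

lemma diag_tri_add:
  assumes "dg (tri w) = w"
  shows "su w \<ominus> m \<noteq> ze \<longrightarrow> dg (tri w \<oplus> m) = w"
proof (induction m rule: induct)
  case dpred
  show ?case by (intro definable_intros) simp_all
next
  case (su m)
  show ?case
  proof
    assume m: "su w \<ominus> su m \<noteq> ze"
    then have "su w \<ominus> m \<noteq> ze" by (auto simp: monus_su simp del: monus_su_su)
    with su m show "dg (tri w \<oplus> su m) = w" by simp
  qed
qed (simp add: assms)

text \<open>The last position on diagonal \<open>w\<close> is \<open>tri w \<oplus> w\<close>; its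
  successor is \<open>tri (su w)\<close>, where the test in \<open>dg\<close> succeeds exactly and
  the value moves on.\<close>

lemma diag_tri [simp]: "dg (tri w) = w"
proof (induction w rule: induct)
  case dpred
  show ?case by (intro definable_intros) simp_all
next
  case (su w)
  from diag_tri_add[OF su, of w] have "dg (tri w \<oplus> w) = w" by simp
  then show ?case by simp
qed simp

lemma diag_pair [simp]: "dg (pr a b) = a \<oplus> b"
proof -
  have "su (a \<oplus> b) \<ominus> a = su b" using monus_add_cancel'[of a "su b"] by simp
  then show ?thesis using diag_tri_add[OF diag_tri, of "a \<oplus> b" a] by (simp add: pair_eq)
qed

lemma fst_pair [simp]: "op1 t_fst (pr a b) = a"
proof -
  have "val (t_fst \<cdot> nm (pr a b)) = a" by (simp add: t_fst_def) (simp add: pair_eq)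
  then show ?thesis by simp
qed

lemma snd_pair [simp]: "op1 t_snd (pr a b) = b"
proof -
  have "val (t_snd \<cdot> nm (pr a b)) = b" by (simp add: t_snd_def)
  then show ?thesis by simp
qed

lemma cons_eq: "cn a c = su (pr a c)"
proof -
  have "val (t_cons \<cdot> nm a \<cdot> nm c) = su (pr a c)" by (simp add: t_cons_def)
  then show ?thesis by simp
qed

lemma cons_nonzero [simp]: "cn a c \<noteq> ze"
  by (simp add: cons_eq)

lemma hd_eq: "op1 t_hd c = op1 t_fst (op1 t_pred c)"
proof -
  have "val (t_hd \<cdot> nm c) = op1 t_fst (op1 t_pred c)" by (simp add: t_hd_def)
  then show ?thesis by simp
qed

lemma tl_eq: "op1 t_tl c = op1 t_snd (op1 t_pred c)"
proof -
  have "val (t_tl \<cdot> nm c) = op1 t_snd (op1 t_pred c)" by (simp add: t_tl_def)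
  then show ?thesis by simp
qed

lemma hd_tl_cons [simp]: "op1 t_hd (cn a c) = a" "op1 t_tl (cn a c) = c"
  by (simp_all add: cons_eq hd_eq tl_eq)

lemma hd_tl_ze [simp]: "op1 t_hd ze = ze" "op1 t_tl ze = ze"
proof -
  have "pr ze ze = ze" by (simp add: pair_eq)
  then show "op1 t_hd ze = ze" "op1 t_tl ze = ze"
    using fst_pair[of ze ze] snd_pair[of ze ze] by (simp_all add: hd_eq tl_eq)
qed

lemma drop_eqs [simp]: "op2 t_drop ze c = c" "op2 t_drop (su n) c = op1 t_tl (op2 t_drop n c)"
proof -
  have "val (t_drop \<cdot> Zero \<cdot> nm c) = c" by (simp add: t_drop_def)
  then show "op2 t_drop ze c = c" by simp
  have "val (t_drop \<cdot> (Succ \<cdot> nm n) \<cdot> nm c) = val (t_tl \<cdot> (t_drop \<cdot> nm n \<cdot> nm c))"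
    by (simp add: t_drop_def)
  then show "op2 t_drop (su n) c = op1 t_tl (op2 t_drop n c)" by simp
qed

lemma nth_eq [simp]: "op2 t_nth n c = op1 t_hd (op2 t_drop n c)"
proof -
  have "val (t_nth \<cdot> nm n \<cdot> nm c) = op1 t_hd (op2 t_drop n c)" by (simp add: t_nth_def)
  then show ?thesis by simp
qed

lemma dist_eq [simp]: "op2 t_dist a b = (a \<ominus> b) \<oplus> (b \<ominus> a)"
proof -
  have "val (t_dist \<cdot> nm a \<cdot> nm b) = (a \<ominus> b) \<oplus> (b \<ominus> a)" by (simp add: t_dist_def)
  then show ?thesis by simp
qed

text \<open>The search program writes only to the registers 0, 1 and 2, so prefixes of length at
  most two are all that its updates require.\<close>

lemma val_prepend [simp]:
  assumes g: "has_type g ty1" and c: "has_type c N"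
  shows "val (t_prepend \<cdot> g \<cdot> Zero \<cdot> c) = val c"
    "val (t_prepend \<cdot> g \<cdot> (Succ \<cdot> Zero) \<cdot> c) = cn (op1 g ze) (val c)"
    "val (t_prepend \<cdot> g \<cdot> (Succ \<cdot> (Succ \<cdot> Zero)) \<cdot> c) = cn (op1 g ze) (cn (op1 g (su ze)) (val c))"
  by (simp_all add: t_prepend_def has_type_iff[OF g] has_type_iff[OF c] val_op1[OF g])

lemma upd_0 [simp]: "op3 t_upd ze v c = cn v (op1 t_tl c)"
proof -
  have "val (t_upd \<cdot> Zero \<cdot> nm v \<cdot> nm c) = cn v (op1 t_tl c)" by (simp add: t_upd_def)
  then show ?thesis by simp
qed

lemma upd_1 [simp]: "op3 t_upd (su ze) v c = cn (op1 t_hd c) (cn v (op1 t_tl (op1 t_tl c)))"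
proof -
  have "val (t_upd \<cdot> (Succ \<cdot> Zero) \<cdot> nm v \<cdot> nm c) = cn (op1 t_hd c) (cn v (op1 t_tl (op1 t_tl c)))"
    by (simp add: t_upd_def)
  then show ?thesis by simp
qed

lemma upd_2 [simp]: "op3 t_upd (su (su ze)) v c =
    cn (op1 t_hd c) (cn (op1 t_hd (op1 t_tl c)) (cn v (op1 t_tl (op1 t_tl (op1 t_tl c)))))"
proof -
  have "val (t_upd \<cdot> (Succ \<cdot> (Succ \<cdot> Zero)) \<cdot> nm v \<cdot> nm c) =
      cn (op1 t_hd c) (cn (op1 t_hd (op1 t_tl c)) (cn v (op1 t_tl (op1 t_tl (op1 t_tl c)))))"
    by (simp add: t_upd_def)
  then show ?thesis by simp
qed

section \<open>Steps of the register machine\<close>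

lemma rest_eq [simp]: "op2 t_rest e (pr pc c) = op2 t_drop pc e"
proof -
  have "val (t_rest \<cdot> nm e \<cdot> nm (pr pc c)) = op2 t_drop pc e" by (simp add: t_rest_def)
  then show ?thesis by simp
qed

lemma exec_eq:
  assumes A: "has_type A ty1"
  shows "op3 (t_exec \<cdot> A) (pr k (pr m (pr n q))) pc c =
   (if k = ze then pr (su pc) (op3 t_upd m ze c)
    else if op1 t_pred k = ze then pr (su pc) (op3 t_upd m (su (op2 t_nth m c)) c)
    else if op1 t_pred (op1 t_pred k) = ze then pr (su pc) (op3 t_upd n (op2 t_nth m c) c)
    else if op1 t_pred (op1 t_pred (op1 t_pred k)) = ze
      then if op2 t_dist (op2 t_nth m c) (op2 t_nth n c) = ze then pr q c else pr (su pc) c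
    else pr (su pc) (op3 t_upd m (op1 A (op2 t_nth m c)) c))"
proof -
  note [simp] = has_type_iff[OF A] val_op1[OF A]
  have "val (t_exec \<cdot> A \<cdot> nm (pr k (pr m (pr n q))) \<cdot> nm pc \<cdot> nm c) =
   (if k = ze then pr (su pc) (op3 t_upd m ze c)
    else if op1 t_pred k = ze then pr (su pc) (op3 t_upd m (su (op2 t_nth m c)) c)
    else if op1 t_pred (op1 t_pred k) = ze then pr (su pc) (op3 t_upd n (op2 t_nth m c) c)
    else if op1 t_pred (op1 t_pred (op1 t_pred k)) = ze
      then if op2 t_dist (op2 t_nth m c) (op2 t_nth n c) = ze then pr q c else pr (su pc) c
    else pr (su pc) (op3 t_upd m (op1 A (op2 t_nth m c)) c))"
    by (simp add: t_exec_def Let_def del: dist_eq nth_eq)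
  then show ?thesis unfolding op3_def[of "t_exec \<cdot> A"] .
qed

lemma step_eq:
  assumes A: "has_type A ty1"
  shows "op2 (t_step \<cdot> A) e st = (if op2 t_rest e st = ze then st else
    op3 (t_exec \<cdot> A) (op1 t_hd (op2 t_rest e st)) (op1 t_fst st) (op1 t_snd st))"
proof -
  note [simp] = has_type_iff[OF A] val_op3[of "t_exec \<cdot> A"]
  have "val (t_step \<cdot> A \<cdot> nm e \<cdot> nm st) = (if op2 t_rest e st = ze then st else
    op3 (t_exec \<cdot> A) (op1 t_hd (op2 t_rest e st)) (op1 t_fst st) (op1 t_snd st))"
    by (simp add: t_step_def)
  then show ?thesis unfolding op2_def[of "t_step \<cdot> A"] .
qed

lemma config_eqs:
  assumes A: "has_type A ty1"
  shows "op3 (t_config \<cdot> A) e n ze = pr ze (cn n ze)"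
    and "op3 (t_config \<cdot> A) e n (su s) = op2 (t_step \<cdot> A) e (op3 (t_config \<cdot> A) e n s)"
proof -
  note [simp] = has_type_iff[OF A] val_op2[of "t_step \<cdot> A"] val_op3[of "t_config \<cdot> A"]
  have "val (t_config \<cdot> A \<cdot> nm e \<cdot> nm n \<cdot> Zero) = pr ze (cn n ze)" by (simp add: t_config_def)
  then show "op3 (t_config \<cdot> A) e n ze = pr ze (cn n ze)" by simp
  have "val (t_config \<cdot> A \<cdot> nm e \<cdot> nm n \<cdot> (Succ \<cdot> nm s)) =
      val (t_step \<cdot> A \<cdot> nm e \<cdot> (t_config \<cdot> A \<cdot> nm e \<cdot> nm n \<cdot> nm s))"
    by (simp add: t_config_def)
  then show "op3 (t_config \<cdot> A) e n (su s) = op2 (t_step \<cdot> A) e (op3 (t_config \<cdot> A) e n s)" by simp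
qed

end

section \<open>The search program\<close>

definition t_instr :: "nat \<Rightarrow> nat \<Rightarrow> nat \<Rightarrow> nat \<Rightarrow> trm" where
  "t_instr k m n q = t_pair \<cdot> numeral_term k \<cdot> (t_pair \<cdot> numeral_term m \<cdot> (t_pair \<cdot> numeral_term n \<cdot> numeral_term q))"

text \<open>With \<open>x\<close> running through the even numbers in \<open>R\<^sub>1\<close>, put \<open>A x\<close> into \<open>R\<^sub>0\<close>, and halt as soon as
  \<open>A (x + 1)\<close> differs from the content \<open>0\<close> of \<open>R\<^sub>3\<close>.\<close>

definition t_prog :: trm where
  "t_prog = foldr (\<lambda>i c. t_cons \<cdot> i \<cdot> c)
    [t_instr 2 1 0 0, t_instr 4 0 0 0, t_instr 1 1 0 0, t_instr 2 1 2 0, t_instr 4 2 0 0,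
     t_instr 1 1 0 0, t_instr 3 2 3 0] Zero"

definition t_double :: trm where
  "t_double = fn 0 N (\<lambda>n. Rec \<cdot> n \<cdot> Zero \<cdot> fn 1 N (\<lambda>r. fn 2 N (\<lambda>i. Succ \<cdot> (Succ \<cdot> r))))"

definition t_parity :: trm where
  "t_parity = fn 0 N (\<lambda>n. Rec \<cdot> n \<cdot> Zero \<cdot> fn 1 N (\<lambda>r. fn 2 N (\<lambda>i. t_ifz \<cdot> r \<cdot> (Succ \<cdot> Zero) \<cdot> Zero)))"

definition t_half :: trm where
  "t_half = fn 0 N (\<lambda>n. Rec \<cdot> n \<cdot> Zero \<cdot> fn 1 N (\<lambda>r. fn 2 N (\<lambda>i. t_ifz \<cdot> (t_parity \<cdot> i) \<cdot> r \<cdot> (Succ \<cdot> r))))"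

definition t_time :: trm where
  "t_time = fn 0 N (\<lambda>n. Rec \<cdot> n \<cdot> numeral_term 4 \<cdot> fn 1 N (\<lambda>r. fn 2 N (\<lambda>i.
     Succ \<cdot> (Succ \<cdot> (Succ \<cdot> (Succ \<cdot> (Succ \<cdot> (Succ \<cdot> (Succ \<cdot> r)))))))))"

text \<open>The oracle with entries \<open>v, 1\<close> at \<open>2 i, 2 i + 1\<close> if \<open>f i = 0\<close>, and \<open>0, 0\<close> otherwise.\<close>

definition t_mark :: trm where
  "t_mark = fn 0 ty1 (\<lambda>f. fn 0 N (\<lambda>v. fn 1 N (\<lambda>x.
     t_ifz \<cdot> (f \<cdot> (t_half \<cdot> x)) \<cdot> (t_ifz \<cdot> (t_parity \<cdot> x) \<cdot> v \<cdot> (Succ \<cdot> Zero)) \<cdot> Zero)))"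

definition t_zeros :: trm where
  "t_zeros = fn 0 N (\<lambda>x. Zero)"

text \<open>\<open>t_seg \<cdot> g \<cdot> n \<cdot> k\<close> is the sequence of the last \<open>k\<close> values of \<open>g\<close> below \<open>n\<close>.\<close>

definition t_seg :: trm where
  "t_seg = fn 0 ty1 (\<lambda>g. fn 1 N (\<lambda>n. fn 2 N (\<lambda>k. Rec \<cdot> k \<cdot> Zero \<cdot> fn 3 N (\<lambda>r. fn 4 N (\<lambda>i.
     t_cons \<cdot> (g \<cdot> (t_monus \<cdot> n \<cdot> (Succ \<cdot> i))) \<cdot> r)))))"

text \<open>The bound concerns places of the oracle, two of which belong to each argument of
  \<open>f\<close>; hence the halving. The outermost test is made at \<open>n - k\<close>, the
  smallest place examined, so smaller candidates win; 0 is the default when none is found.\<close>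

definition t_search :: trm where
  "t_search = fn 0 ty1 (\<lambda>f. fn 1 N (\<lambda>n. fn 2 N (\<lambda>k. Rec \<cdot> k \<cdot> Zero \<cdot> fn 3 N (\<lambda>r. fn 4 N (\<lambda>i.
     t_ifz \<cdot> (f \<cdot> (t_half \<cdot> (t_monus \<cdot> n \<cdot> (Succ \<cdot> i)))) \<cdot> (t_half \<cdot> (t_monus \<cdot> n \<cdot> (Succ \<cdot> i))) \<cdot> r)))))"

text \<open>As a function of the stage this is 0 exactly at halted configurations, so it is a
  suitable argument for the mu-operator.\<close>

definition t_halt :: trm where
  "t_halt = fn 0 ty1 (\<lambda>A. fn 0 N (\<lambda>e. fn 1 N (\<lambda>s. t_rest \<cdot> e \<cdot> (t_config \<cdot> A \<cdot> e \<cdot> e \<cdot> s))))"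

definition t_dnr :: trm where
  "t_dnr = fn 0 ty2 (\<lambda>\<mu>. fn 0 ty1 (\<lambda>A. fn 0 N (\<lambda>e.
     Succ \<cdot> (t_nth \<cdot> Zero \<cdot> (t_snd \<cdot> (t_config \<cdot> A \<cdot> e \<cdot> e \<cdot> (\<mu> \<cdot> (t_halt \<cdot> A \<cdot> e))))))))"

text \<open>The modulus is requested for length \<open>Succ \<cdot> t_prog\<close>, because an
  initial segment must have length \<open>e + 1\<close> to contain the entry at
  \<open>e\<close>.\<close>

definition t_mu :: trm where
  "t_mu = fn 0 (ty1 \<Rrightarrow> ty1) (\<lambda>\<Psi>. fn 0 Xi_ty (\<lambda>\<Xi>. fn 0 ty1 (\<lambda>f.
     let n = \<Xi> \<cdot> (t_mark \<cdot> f \<cdot> (\<Psi> \<cdot> t_zeros \<cdot> t_prog)) \<cdot> t_zeros \<cdot> (Succ \<cdot> t_prog)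
     in t_search \<cdot> f \<cdot> n \<cdot> n)))"

lemma numeral_term_closed [simp]: "closed (numeral_term k)"
  by (induction k) auto

lemma t_prog_type: "has_type t_prog (N)" and t_prog_closed: "closed t_prog"
  by (auto simp: t_prog_def t_instr_def)
lemmas t_prog_simps [simp] = has_type_iff[OF t_prog_type] t_prog_closed sub_closed[OF t_prog_closed]

lemma t_double_type: "has_type t_double (N \<Rrightarrow> N)" and t_double_closed: "closed t_double"
  by (auto simp: t_double_def)
lemmas t_double_simps [simp] = has_type_iff[OF t_double_type] t_double_closed sub_closed[OF t_double_closed]

lemma t_parity_type: "has_type t_parity (N \<Rrightarrow> N)" and t_parity_closed: "closed t_parity"
  by (auto simp: t_parity_def)
lemmas t_parity_simps [simp] = has_type_iff[OF t_parity_type] t_parity_closed sub_closed[OF t_parity_closed]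

lemma t_half_type: "has_type t_half (N \<Rrightarrow> N)" and t_half_closed: "closed t_half"
  by (auto simp: t_half_def)
lemmas t_half_simps [simp] = has_type_iff[OF t_half_type] t_half_closed sub_closed[OF t_half_closed]

lemma t_time_type: "has_type t_time (N \<Rrightarrow> N)" and t_time_closed: "closed t_time"
  by (auto simp: t_time_def)
lemmas t_time_simps [simp] = has_type_iff[OF t_time_type] t_time_closed sub_closed[OF t_time_closed]

lemma t_mark_type: "has_type t_mark (ty1 \<Rrightarrow> N \<Rrightarrow> N \<Rrightarrow> N)" and t_mark_closed: "closed t_mark"
  by (auto simp: t_mark_def)
lemmas t_mark_simps [simp] = has_type_iff[OF t_mark_type] t_mark_closed sub_closed[OF t_mark_closed]

lemma t_zeros_type: "has_type t_zeros (N \<Rrightarrow> N)" and t_zeros_closed: "closed t_zeros"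
  by (auto simp: t_zeros_def)
lemmas t_zeros_simps [simp] = has_type_iff[OF t_zeros_type] t_zeros_closed sub_closed[OF t_zeros_closed]

lemma t_seg_type: "has_type t_seg (ty1 \<Rrightarrow> N \<Rrightarrow> N \<Rrightarrow> N)" and t_seg_closed: "closed t_seg"
  by (auto simp: t_seg_def)
lemmas t_seg_simps [simp] = has_type_iff[OF t_seg_type] t_seg_closed sub_closed[OF t_seg_closed]

lemma t_search_type: "has_type t_search (ty1 \<Rrightarrow> N \<Rrightarrow> N \<Rrightarrow> N)" and t_search_closed: "closed t_search"
  by (auto simp: t_search_def)
lemmas t_search_simps [simp] = has_type_iff[OF t_search_type] t_search_closed sub_closed[OF t_search_closed]

lemma t_halt_type: "has_type t_halt (ty1 \<Rrightarrow> N \<Rrightarrow> N \<Rrightarrow> N)" and t_halt_closed: "closed t_halt"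
  by (auto simp: t_halt_def)
lemmas t_halt_simps [simp] = has_type_iff[OF t_halt_type] t_halt_closed sub_closed[OF t_halt_closed]

lemma t_dnr_type: "has_type t_dnr (ty2 \<Rrightarrow> ty1 \<Rrightarrow> N \<Rrightarrow> N)" and t_dnr_closed: "closed t_dnr"
  by (auto simp: t_dnr_def)
lemmas t_dnr_simps [simp] = has_type_iff[OF t_dnr_type] t_dnr_closed sub_closed[OF t_dnr_closed]

lemma t_mu_type: "has_type t_mu ((ty1 \<Rrightarrow> ty1) \<Rrightarrow> Xi_ty \<Rrightarrow> ty1 \<Rrightarrow> N)" and t_mu_closed: "closed t_mu"
  by (auto simp: t_mu_def Let_def)
lemmas t_mu_simps [simp] = has_type_iff[OF t_mu_type] t_mu_closed sub_closed[OF t_mu_closed]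

section \<open>Correctness of the search program\<close>

context henkin
begin

lemma val_unary_prog [simp]:
  "has_type s N \<Longrightarrow> val (t_double \<cdot> s) = op1 t_double (val s)"
  "has_type s N \<Longrightarrow> val (t_parity \<cdot> s) = op1 t_parity (val s)"
  "has_type s N \<Longrightarrow> val (t_half \<cdot> s) = op1 t_half (val s)"
  "has_type s N \<Longrightarrow> val (t_time \<cdot> s) = op1 t_time (val s)"
  by (rule val_op1; simp)+

lemma double_eqs [simp]: "op1 t_double ze = ze" "op1 t_double (su a) = su (su (op1 t_double a))"
proof -
  have "val (t_double \<cdot> Zero) = ze" by (simp add: t_double_def)
  then show "op1 t_double ze = ze" by simp
  have "val (t_double \<cdot> (Succ \<cdot> nm a)) = val (Succ \<cdot> (Succ \<cdot> (t_double \<cdot> nm a)))" by (simp add: t_double_def)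
  then show "op1 t_double (su a) = su (su (op1 t_double a))" by simp
qed

lemma parity_eqs [simp]: "op1 t_parity ze = ze"
  "op1 t_parity (su a) = (if op1 t_parity a = ze then su ze else ze)"
proof -
  have "val (t_parity \<cdot> Zero) = ze" by (simp add: t_parity_def)
  then show "op1 t_parity ze = ze" by simp
  have "val (t_parity \<cdot> (Succ \<cdot> nm a)) = val (t_ifz \<cdot> (t_parity \<cdot> nm a) \<cdot> (Succ \<cdot> Zero) \<cdot> Zero)"
    by (simp add: t_parity_def)
  then show "op1 t_parity (su a) = (if op1 t_parity a = ze then su ze else ze)" by simp
qed

lemma half_eqs [simp]: "op1 t_half ze = ze"
  "op1 t_half (su a) = (if op1 t_parity a = ze then op1 t_half a else su (op1 t_half a))"
proof -
  have "val (t_half \<cdot> Zero) = ze" by (simp add: t_half_def)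
  then show "op1 t_half ze = ze" by simp
  have "val (t_half \<cdot> (Succ \<cdot> nm a)) =
      val (t_ifz \<cdot> (t_parity \<cdot> nm a) \<cdot> (t_half \<cdot> nm a) \<cdot> (Succ \<cdot> (t_half \<cdot> nm a)))"
    by (simp add: t_half_def)
  then show "op1 t_half (su a) = (if op1 t_parity a = ze then op1 t_half a else su (op1 t_half a))"
    by simp
qed

lemma double_half [simp]: "op1 t_parity (op1 t_double a) = ze" "op1 t_half (op1 t_double a) = a"
proof -
  have "op1 t_parity (op1 t_double a) = ze \<and> op1 t_half (op1 t_double a) = a"
    by (induction a rule: induct) (intro definable_intros, simp_all)
  then show "op1 t_parity (op1 t_double a) = ze" "op1 t_half (op1 t_double a) = a" by auto
qed

lemma time_eqs [simp]: "op1 t_time ze = su (su (su (su ze)))"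
  "op1 t_time (su a) = su (su (su (su (su (su (su (op1 t_time a)))))))"
proof -
  have "val (t_time \<cdot> Zero) = su (su (su (su ze)))" by (simp add: t_time_def numeral_eq_Suc)
  then show "op1 t_time ze = su (su (su (su ze)))" by simp
  have "val (t_time \<cdot> (Succ \<cdot> nm a)) =
      val (Succ \<cdot> (Succ \<cdot> (Succ \<cdot> (Succ \<cdot> (Succ \<cdot> (Succ \<cdot> (Succ \<cdot> (t_time \<cdot> nm a))))))))"
    by (simp add: t_time_def)
  then show "op1 t_time (su a) = su (su (su (su (su (su (su (op1 t_time a)))))))" by simp
qed

lemma monus_ze_left [simp]: "ze \<ominus> a = ze"
  by (induction a rule: induct) (intro definable_intros, simp_all add: monus_su)

lemma val_prog: "val t_prog =
  (let n0 = ze; n1 = su n0; n2 = su n1; n3 = su n2; n4 = su n3; ins = (\<lambda>k m n q. pr k (pr m (pr n q)))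
   in cn (ins n2 n1 n0 n0) (cn (ins n4 n0 n0 n0) (cn (ins n1 n1 n0 n0) (cn (ins n2 n1 n2 n0)
      (cn (ins n4 n2 n0 n0) (cn (ins n1 n1 n0 n0) (cn (ins n3 n2 n3 n0) ze)))))))"
  by (simp add: t_prog_def t_instr_def numeral_eq_Suc Let_def)

lemma prog_step:
  assumes A: "has_type A ty1"
  defines "step pc c \<equiv> op2 (t_step \<cdot> A) (val t_prog) (pr pc c)"
  shows "step ze c = pr (su ze) (cn (op1 t_hd (op1 t_tl c)) (op1 t_tl c))"
    "step (su ze) c = pr (su (su ze)) (cn (op1 A (op1 t_hd c)) (op1 t_tl c))"
    "step (su (su ze)) c = pr (su (su (su ze)))
      (cn (op1 t_hd c) (cn (su (op1 t_hd (op1 t_tl c))) (op1 t_tl (op1 t_tl c))))"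
    "step (su (su (su ze))) (cn a (cn x b)) = pr (su (su (su (su ze)))) (cn a (cn x (cn x (op1 t_tl b))))"
    "step (su (su (su (su ze)))) (cn a (cn x (cn y b))) =
      pr (su (su (su (su (su ze))))) (cn a (cn x (cn (op1 A y) b)))"
    "step (su (su (su (su (su ze))))) (cn a (cn x b)) =
      pr (su (su (su (su (su (su ze)))))) (cn a (cn (su x) b))"
    "step (su (su (su (su (su (su ze)))))) (cn a (cn x (cn y ze))) =
      pr (if y = ze then ze else su (su (su (su (su (su (su ze))))))) (cn a (cn x (cn y ze)))"
    "step (su (su (su (su (su (su (su ze))))))) c = pr (su (su (su (su (su (su (su ze))))))) c"
  unfolding step_def by (simp_all add: step_eq[OF A] exec_eq[OF A] val_prog Let_def)

text \<open>Since every marked place carries the same value \<open>v\<close>, it does not matter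
  which of them the program meets, and no least marked place has to be produced.\<close>

theorem search_halts:
  assumes A: "has_type A ty1"
    and val: "\<And>i. op1 A (su (op1 t_double i)) \<noteq> ze \<Longrightarrow> op1 A (op1 t_double i) = v"
    and i: "op1 A (su (op1 t_double i)) \<noteq> ze"
  obtains s where "op2 t_rest (val t_prog) (op3 (t_config \<cdot> A) (val t_prog) (val t_prog) s) = ze"
    "op1 t_hd (op1 t_snd (op3 (t_config \<cdot> A) (val t_prog) (val t_prog) s)) = v"
proof -
  let ?E = "val t_prog"
  let ?C = "\<lambda>i. op3 (t_config \<cdot> A) ?E ?E (op1 t_time i)"
  let ?H = "\<lambda>c. op2 t_rest ?E c = ze \<and> op1 t_hd (op1 t_snd c) = v"
  let ?L = "\<lambda>x. pr (su (su (su (su ze)))) (cn (op1 A x) (cn (su x) (cn (su x) ze)))"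
  have halted: "op2 (t_step \<cdot> A) ?E c = c" if "?H c" for c
    using that by (simp add: step_eq[OF A])
  have loop: "?C (su i) = (if op1 A (su (op1 t_double i)) = ze then ?L (op1 t_double (su i))
      else pr (su (su (su (su (su (su (su ze)))))))
        (cn (op1 A (op1 t_double i)) (cn (op1 t_double (su i)) (cn (op1 A (su (op1 t_double i))) ze))))"
    if "?C i = ?L (op1 t_double i)" for i
    using that by (simp add: config_eqs[OF A] prog_step[OF A])
  have exit: "?H (?C (su i))" if "?C i = ?L (op1 t_double i)" "op1 A (su (op1 t_double i)) \<noteq> ze" for i
    unfolding loop[OF that(1)] using that(2) val by (simp add: val_prog Let_def)
  \<comment> \<open>The invariant keeps an early halt as a second alternative. Both alternatives are
    equations between terms, as quantifier-free induction demands.\<close>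
  have "?C i = ?L (op1 t_double i) \<or> ?H (?C i)"
  proof (induction i rule: induct)
    case dpred
    show ?case using A by (intro definable_intros) simp_all
  next
    case ze
    show ?case by (simp add: config_eqs[OF A] prog_step[OF A])
  next
    case (su i)
    show ?case
    proof (cases "?C i = ?L (op1 t_double i)")
      case True
      then show ?thesis using loop exit by (cases "op1 A (su (op1 t_double i)) = ze") simp_all
    next
      case False
      with su have "?H (?C i)" by simp
      moreover have "?C (su i) = ?C i"
        using halted[OF \<open>?H (?C i)\<close>] by (simp add: config_eqs[OF A])
      ultimately show ?thesis by simp
    qed
  qed
  \<comment> \<open>At the given marked place the machine either leaves the loop in this round or
    had halted before, in both cases with output \<open>v\<close>.\<close>
  then show ?thesis using exit i that by blast
qed

section \<open>Marked oracles and their initial segments\<close>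

lemma mark_eq:
  assumes f: "has_type f ty1" and v: "has_type v N"
  shows "op1 (t_mark \<cdot> f \<cdot> v) x =
    (if op1 f (op1 t_half x) = ze then if op1 t_parity x = ze then val v else su ze else ze)"
proof -
  note [simp] = has_type_iff[OF f] has_type_iff[OF v] val_op1[OF f]
  have "val (t_mark \<cdot> f \<cdot> v \<cdot> nm x) =
    (if op1 f (op1 t_half x) = ze then if op1 t_parity x = ze then val v else su ze else ze)"
    by (simp add: t_mark_def)
  then show ?thesis unfolding op1_def[of "t_mark \<cdot> f \<cdot> v"] .
qed

lemma zeros_eq [simp]: "op1 t_zeros x = ze"
proof -
  have "val (t_zeros \<cdot> nm x) = ze" by (simp add: t_zeros_def)
  then show ?thesis unfolding op1_def[of t_zeros] .
qed

lemma seg_eqs: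
  assumes g: "has_type g ty1"
  shows "op2 (t_seg \<cdot> g) n ze = ze"
    and "op2 (t_seg \<cdot> g) n (su k) = cn (op1 g (n \<ominus> su k)) (op2 (t_seg \<cdot> g) n k)"
proof -
  note [simp] = has_type_iff[OF g] val_op1[OF g] val_op2[of "t_seg \<cdot> g"]
  have "val (t_seg \<cdot> g \<cdot> nm n \<cdot> Zero) = ze" by (simp add: t_seg_def)
  then show "op2 (t_seg \<cdot> g) n ze = ze" by simp
  have "val (t_seg \<cdot> g \<cdot> nm n \<cdot> (Succ \<cdot> nm k)) =
      val (t_cons \<cdot> (g \<cdot> (t_monus \<cdot> nm n \<cdot> (Succ \<cdot> nm k))) \<cdot> (t_seg \<cdot> g \<cdot> nm n \<cdot> nm k))"
    by (simp add: t_seg_def)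
  then show "op2 (t_seg \<cdot> g) n (su k) = cn (op1 g (n \<ominus> su k)) (op2 (t_seg \<cdot> g) n k)" by simp
qed

lemma search_eqs:
  assumes f: "has_type f ty1"
  shows "op2 (t_search \<cdot> f) n ze = ze"
    and "op2 (t_search \<cdot> f) n (su k) =
      (if op1 f (op1 t_half (n \<ominus> su k)) = ze then op1 t_half (n \<ominus> su k) else op2 (t_search \<cdot> f) n k)"
proof -
  note [simp] = has_type_iff[OF f] val_op1[OF f] val_op2[of "t_search \<cdot> f"]
  have "val (t_search \<cdot> f \<cdot> nm n \<cdot> Zero) = ze" by (simp add: t_search_def)
  then show "op2 (t_search \<cdot> f) n ze = ze" by simp
  have "val (t_search \<cdot> f \<cdot> nm n \<cdot> (Succ \<cdot> nm k)) =
      val (t_ifz \<cdot> (f \<cdot> (t_half \<cdot> (t_monus \<cdot> nm n \<cdot> (Succ \<cdot> nm k)))) \<cdot>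
        (t_half \<cdot> (t_monus \<cdot> nm n \<cdot> (Succ \<cdot> nm k))) \<cdot> (t_search \<cdot> f \<cdot> nm n \<cdot> nm k))"
    by (simp add: t_search_def)
  then show "op2 (t_search \<cdot> f) n (su k) =
      (if op1 f (op1 t_half (n \<ominus> su k)) = ze then op1 t_half (n \<ominus> su k) else op2 (t_search \<cdot> f) n k)"
    by simp
qed

text \<open>In \<open>t_bar\<close> the length is both the recursion argument and a parameter of the
  step. \<open>t_seg\<close> separates these roles, so that one can be varied by induction while the
  other is fixed.\<close>

lemma val_bar:
  assumes g: "has_type g ty1" and n: "has_type n N"
  shows "val (t_bar \<cdot> g \<cdot> n) = op2 (t_seg \<cdot> g) (val n) (val n)"
proof -
  note [simp] = has_type_iff[OF g] has_type_iff[OF n]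
  have "val (t_bar \<cdot> g \<cdot> n) = val (t_prepend \<cdot> g \<cdot> n \<cdot> Zero)" by (simp add: t_bar_def)
  also have "\<dots> = val (t_seg \<cdot> g \<cdot> n \<cdot> n)" by (simp add: t_prepend_def t_seg_def)
  finally show ?thesis by (simp add: val_op2[of "t_seg \<cdot> g"])
qed

lemma drop_seg:
  assumes g: "has_type g ty1"
  shows "op2 t_drop j (op2 (t_seg \<cdot> g) n n) = op2 (t_seg \<cdot> g) n (n \<ominus> j)"
proof -
  have tl: "op1 t_tl (op2 (t_seg \<cdot> g) n m) = op2 (t_seg \<cdot> g) n (op1 t_pred m)" for m
    by (cases m rule: nat_cases) (simp_all add: seg_eqs[OF g])
  show ?thesis
    by (induction j rule: induct) (intro definable_intros, use g in \<open>simp_all add: tl monus_su\<close>)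
qed

text \<open>Dropping \<open>e\<close> entries from a segment of length \<open>e + 1\<close> leaves
  the single entry at \<open>e\<close>.\<close>

lemma bar_eqD:
  assumes g: "has_type g ty1" "has_type h ty1" and e: "has_type e N"
    and eq: "val (t_bar \<cdot> g \<cdot> (Succ \<cdot> e)) = val (t_bar \<cdot> h \<cdot> (Succ \<cdot> e))"
  shows "val (g \<cdot> e) = val (h \<cdot> e)"
proof -
  have *: "op1 t_hd (op2 t_drop (val e) (val (t_bar \<cdot> g \<cdot> (Succ \<cdot> e)))) = val (g \<cdot> e)"
    if g: "has_type g ty1" for g
    using e g by (simp add: val_bar drop_seg) (simp add: seg_eqs val_op1[OF g])
  show ?thesis using *[OF g(1)] *[OF g(2)] eq by simp
qed

text \<open>The recursions of \<open>t_search\<close> and \<open>t_seg\<close> run through the same arguments in the same order,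
  so no order relation is needed to see that the search is exhaustive.\<close>

lemma search_exhaustive:
  assumes f: "has_type f ty1" and v: "has_type v N"
  shows "op1 f (op2 (t_search \<cdot> f) n k) \<noteq> ze \<longrightarrow>
    op2 (t_seg \<cdot> (t_mark \<cdot> f \<cdot> v)) n k = op2 (t_seg \<cdot> t_zeros) n k"
proof (induction k rule: induct)
  case dpred
  show ?case using f v by (intro definable_intros) (simp_all add: has_type_iff[OF f] has_type_iff[OF v])
next
  case ze
  show ?case using f v by (simp add: seg_eqs)
next
  case (su k)
  then show ?case using f v by (simp add: seg_eqs search_eqs mark_eq)
qed

theorem search_finds:
  assumes f: "has_type f ty1" and v: "has_type v N" and n: "has_type n N"
    and neq: "val (t_bar \<cdot> (t_mark \<cdot> f \<cdot> v) \<cdot> n) \<noteq> val (t_bar \<cdot> t_zeros \<cdot> n)"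
  shows "val (f \<cdot> (t_search \<cdot> f \<cdot> n \<cdot> n)) = ze"
  using search_exhaustive[OF f v, of "val n" "val n"] neq f v n
  by (auto simp: val_bar val_op1[OF f] val_op2[of "t_search \<cdot> f"])

text \<open>An existential statement about \<open>f\<close> becomes an inequality of type
  \<open>N\<close>. This is what makes the matrix of the later choice instance
  quantifier-free.\<close>

theorem mark_diverges:
  assumes f: "has_type f ty1" and \<Psi>: "has_type \<Psi> (ty1 \<Rrightarrow> ty1)" and v: "v = \<Psi> \<cdot> t_zeros \<cdot> t_prog"
    and dnr: "\<And>s. has_type s N \<Longrightarrow>
      val (t_rest \<cdot> t_prog \<cdot> (t_config \<cdot> (t_mark \<cdot> f \<cdot> v) \<cdot> t_prog \<cdot> t_prog \<cdot> s)) = ze \<Longrightarrow>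
      val (t_nth \<cdot> Zero \<cdot> (t_snd \<cdot> (t_config \<cdot> (t_mark \<cdot> f \<cdot> v) \<cdot> t_prog \<cdot> t_prog \<cdot> s))) = val v \<Longrightarrow>
      val (\<Psi> \<cdot> (t_mark \<cdot> f \<cdot> v) \<cdot> t_prog) \<noteq> val v"
  shows "(\<exists>n. op1 f n = ze) \<longleftrightarrow> val (\<Psi> \<cdot> (t_mark \<cdot> f \<cdot> v) \<cdot> t_prog) \<noteq> val v"
proof
  have vN: "has_type v N" using \<Psi> v by auto
  note [simp] = has_type_iff[OF f] has_type_iff[OF vN] val_op3[of "t_config \<cdot> (t_mark \<cdot> f \<cdot> v)"]
  assume "\<exists>n. op1 f n = ze"
  then obtain n where n: "op1 f n = ze" by blast
  obtain s where "op2 t_rest (val t_prog) (op3 (t_config \<cdot> (t_mark \<cdot> f \<cdot> v)) (val t_prog) (val t_prog) s) = ze"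
    "op1 t_hd (op1 t_snd (op3 (t_config \<cdot> (t_mark \<cdot> f \<cdot> v)) (val t_prog) (val t_prog) s)) = val v"
    by (rule search_halts[of "t_mark \<cdot> f \<cdot> v" "val v" n])
      (use n in \<open>auto simp: mark_eq[OF f vN] split: if_splits\<close>)
  then show "val (\<Psi> \<cdot> (t_mark \<cdot> f \<cdot> v) \<cdot> t_prog) \<noteq> val v"
    by (intro dnr[of "nm s"]) simp_all
next
  have vN: "has_type v N" using \<Psi> v by auto
  assume neq: "val (\<Psi> \<cdot> (t_mark \<cdot> f \<cdot> v) \<cdot> t_prog) \<noteq> val v"
  show "\<exists>n. op1 f n = ze"
  proof (rule ccontr)
    assume "\<nexists>n. op1 f n = ze"
    then have "val (apps (\<Psi> \<cdot> (t_mark \<cdot> f \<cdot> v)) [t_prog]) = val (apps (\<Psi> \<cdot> t_zeros) [t_prog])"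
      using f vN \<Psi> by (intro val_ext1[where \<tau> = ty1]) (auto simp: mark_eq[OF f vN])
    with neq v show False by simp
  qed
qed

lemma config_halted:
  assumes A: "has_type A ty1" and halt: "op2 t_rest e (op3 (t_config \<cdot> A) e n s) = ze"
  shows "op3 (t_config \<cdot> A) e n (s \<oplus> k) = op3 (t_config \<cdot> A) e n s"
  by (induction k rule: induct)
    (intro definable_intros, use A halt in \<open>simp_all add: config_eqs[OF A] step_eq[OF A]\<close>)

text \<open>Both configurations equal the one at stage \<open>s \<oplus> s'\<close>; commutativity
  of addition replaces a comparison of the two stages.\<close>

lemma config_unique:
  assumes A: "has_type A ty1" and "op2 t_rest e (op3 (t_config \<cdot> A) e n s) = ze"
    and "op2 t_rest e (op3 (t_config \<cdot> A) e n s') = ze"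
  shows "op3 (t_config \<cdot> A) e n s = op3 (t_config \<cdot> A) e n s'"
  using config_halted[OF assms(1,2), of s'] config_halted[OF assms(1,3), of s]
  by (simp add: add_commute)

lemma val_halt:
  assumes A: "has_type A ty1" and e: "has_type e N" and s: "has_type s N"
  shows "val (t_halt \<cdot> A \<cdot> e \<cdot> s) = op2 t_rest (val e) (op3 (t_config \<cdot> A) (val e) (val e) (val s))"
  using A e s by (simp add: t_halt_def has_type_iff[OF A] val_op3[of "t_config \<cdot> A"])

text \<open>The stage found by \<open>\<mu>\<close> need not be \<open>s\<close>, but halted
  configurations of one computation coincide, hence so do the outputs.\<close>

theorem dnr_correct:
  assumes A: "has_type A ty1" and e: "has_type e N" and \<mu>: "has_type \<mu> ty2" and s: "has_type s N"
    and mu: "val (t_halt \<cdot> A \<cdot> e \<cdot> s) = ze \<Longrightarrow> val (t_halt \<cdot> A \<cdot> e \<cdot> (\<mu> \<cdot> (t_halt \<cdot> A \<cdot> e))) = ze"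
    and halt: "val (t_rest \<cdot> e \<cdot> (t_config \<cdot> A \<cdot> e \<cdot> e \<cdot> s)) = ze"
  shows "val (t_dnr \<cdot> \<mu> \<cdot> A \<cdot> e) = su (val (t_nth \<cdot> Zero \<cdot> (t_snd \<cdot> (t_config \<cdot> A \<cdot> e \<cdot> e \<cdot> s))))"
proof -
  note [simp] = has_type_iff[OF A] has_type_iff[OF e] has_type_iff[OF \<mu>] has_type_iff[OF s]
    val_op3[of "t_config \<cdot> A"] val_halt[OF A e]
  let ?m = "\<mu> \<cdot> (t_halt \<cdot> A \<cdot> e)"
  have h: "op2 t_rest (val e) (op3 (t_config \<cdot> A) (val e) (val e) (val s)) = ze" using halt by simp
  with mu have "op2 t_rest (val e) (op3 (t_config \<cdot> A) (val e) (val e) (val ?m)) = ze" by simp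
  from config_unique[OF A this h] show ?thesis by (simp add: t_dnr_def)
qed

end

section \<open>The principles\<close>

lemma der_semantic:
  assumes "\<And>\<psi>. \<psi> \<in> set \<Gamma> \<Longrightarrow> wff \<psi>" "wff \<phi>" "\<And>X. henkin X \<Longrightarrow> set \<Gamma> \<subseteq> X \<Longrightarrow> \<phi> \<in> X"
  shows "\<Gamma> \<turnstile> \<phi>"
  by (rule entailsD[OF completeness[of "set \<Gamma>"]]) (use assms in auto)

lemma der_cut: "\<Gamma> \<turnstile> \<phi> \<Longrightarrow> wff \<phi> \<Longrightarrow> \<phi> # \<Gamma> \<turnstile> \<psi> \<Longrightarrow> \<Gamma> \<turnstile> \<psi>"
  using derivable.impE derivable.impI by blast

lemma der_notI: "wff \<phi> \<Longrightarrow> \<phi> # \<Gamma> \<turnstile> \<^bold>\<bottom> \<Longrightarrow> \<Gamma> \<turnstile> \<^bold>\<not> \<phi>"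
  by (rule derivable.impI)

lemma der_exE:
  assumes "Exists x \<phi> \<in> set \<Gamma>" "wff \<phi>" "\<forall>\<psi>\<in>set \<Gamma>. x \<notin> fv \<psi>" "\<phi> # \<Gamma> \<turnstile> \<^bold>\<bottom>"
  shows "\<Gamma> \<turnstile> \<^bold>\<bottom>"
  using assms by (intro derivable.impE[OF derivable.assm[OF assms(1)]] derivable.allI der_notI)

text \<open>The instance has to be derived with the refuted universal formula already among the
  assumptions, because it could not be added by weakening.\<close>

lemma der_exI:
  assumes "wff \<phi>" "has_type t (snd x)" "free_for t x \<phi>" "Forall x (\<^bold>\<not> \<phi>) # \<Gamma> \<turnstile> subst \<phi> x t"
  shows "\<Gamma> \<turnstile> Exists x \<phi>"
proof (rule der_notI)
  have "Forall x (\<^bold>\<not> \<phi>) # \<Gamma> \<turnstile> subst (\<^bold>\<not> \<phi>) x t"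
    using assms by (intro derivable.allE derivable.assm) auto
  then show "Forall x (\<^bold>\<not> \<phi>) # \<Gamma> \<turnstile> \<^bold>\<bottom>" using assms(4) by (auto intro: derivable.impE)
qed (use assms in simp)

section \<open>The principles with the functional as a parameter\<close>

definition halt_fm :: "trm \<Rightarrow> trm \<Rightarrow> trm \<Rightarrow> trm \<Rightarrow> fm" where
  "halt_fm A e y s = (t_rest \<cdot> e \<cdot> (t_config \<cdot> A \<cdot> e \<cdot> e \<cdot> s) \<^bold>= Zero \<^bold>\<and>
     t_nth \<cdot> Zero \<cdot> (t_snd \<cdot> (t_config \<cdot> A \<cdot> e \<cdot> e \<cdot> s)) \<^bold>= y)"

text \<open>The bound variable has index 2 because this is what \<open>fresh\<close> yields in
  \<open>Phi_halts\<close> for the variables of \<open>is_UDNR\<close>, the largest index among them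
  being 1.\<close>

definition dnr_kernel :: "trm \<Rightarrow> trm \<Rightarrow> trm \<Rightarrow> trm \<Rightarrow> fm" where
  "dnr_kernel P A e y = (exists 2 N (\<lambda>s. halt_fm A e y s) \<^bold>\<longrightarrow> \<^bold>\<not> (P \<cdot> A \<cdot> e \<^bold>= y))"

definition dnr_fm :: "trm \<Rightarrow> fm" where
  "dnr_fm P = forall 0 ty1 (\<lambda>A. forall 0 N (\<lambda>e. forall 1 N (\<lambda>y. dnr_kernel P A e y)))"

definition mu_fm :: "trm \<Rightarrow> fm" where
  "mu_fm M = forall 0 ty1 (\<lambda>f. exists 0 N (\<lambda>n. f \<cdot> n \<^bold>= Zero) \<^bold>\<longrightarrow> f \<cdot> (M \<cdot> f) \<^bold>= Zero)"

abbreviation udnr_vars :: "var set" where "udnr_vars \<equiv> {(0, ty1), (0, N), (1, N), (2, N)}"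

lemma halt_fm_simps [simp]:
  "subst (halt_fm A e y s) x t = halt_fm (tsubst A x t) (tsubst e x t) (tsubst y x t) (tsubst s x t)"
  "fv (halt_fm A e y s) = tvars A \<union> tvars e \<union> tvars y \<union> tvars s"
  "qf (halt_fm A e y s)"
  "wff (halt_fm A e y s) \<longleftrightarrow> has_type A ty1 \<and> has_type e N \<and> has_type y N \<and> has_type s N"
  by (auto simp: halt_fm_def)

lemma dnr_kernel_simps [simp]:
  "x \<noteq> (2, N) \<Longrightarrow> subst (dnr_kernel P A e y) x t =
    dnr_kernel (tsubst P x t) (tsubst A x t) (tsubst e x t) (tsubst y x t)"
  "(2, N) \<notin> tvars t \<Longrightarrow> free_for t x (dnr_kernel P A e y)"
  "has_type A ty1 \<Longrightarrow> has_type e N \<Longrightarrow> has_type y N \<Longrightarrow> has_type P (ty1 \<Rrightarrow> ty1) \<Longrightarrow> wff (dnr_kernel P A e y)"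
  by (auto simp: dnr_kernel_def free_for_qf)

lemma fv_dnr_fm: "fv (dnr_fm P) = tvars P - udnr_vars"
  if "(2, N) \<notin> tvars P"
  using that by (auto simp: dnr_fm_def dnr_kernel_def)

lemma fv_mu_fm: "fv (mu_fm M) = tvars M - {(0, ty1)}"
  by (auto simp: mu_fm_def)

lemma wff_dnr_fm [simp]: "has_type P (ty1 \<Rrightarrow> ty1) \<Longrightarrow> wff (dnr_fm P)"
  by (simp add: dnr_fm_def)

lemma wff_mu_fm [simp]: "has_type M ty2 \<Longrightarrow> wff (mu_fm M)"
  by (simp add: mu_fm_def)

lemma is_UDNR_eq: "is_UDNR = dnr_fm (Var Psi_var)"
proof -
  have "fresh [Var (0, ty1), Var (0, N), Var (0, N), Var (1, N)] = 2" by (simp add: fresh_def)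
  then show ?thesis
    by (simp add: is_UDNR_def dnr_fm_def dnr_kernel_def Phi_halts_def halt_fm_def)
qed

lemma is_mu_eq: "is_mu = mu_fm (Var mu_var)"
  by (simp add: is_mu_def mu_fm_def)

lemma subst_is_UDNR: "subst is_UDNR Psi_var P = dnr_fm P"
  by (simp add: is_UDNR_eq dnr_fm_def)

lemma subst_is_mu: "subst is_mu mu_var M = mu_fm M"
  by (simp add: is_mu_eq mu_fm_def)

lemma free_for_is_UDNR: "tvars P \<inter> udnr_vars = {} \<Longrightarrow> free_for P Psi_var is_UDNR"
  by (simp add: is_UDNR_eq dnr_fm_def)

lemma free_for_is_mu: "tvars M \<inter> {(0, ty1), (0, N)} = {} \<Longrightarrow> free_for M mu_var is_mu"
  by (simp add: is_mu_eq mu_fm_def)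

lemma fv_is_UDNR [simp]: "fv is_UDNR = {Psi_var}"
  by (auto simp: is_UDNR_eq fv_dnr_fm)

lemma fv_is_mu [simp]: "fv is_mu = {mu_var}"
  by (auto simp: is_mu_eq fv_mu_fm)

lemma wff_is_UDNR [simp]: "wff is_UDNR" and wff_is_mu [simp]: "wff is_mu"
  by (simp_all add: is_UDNR_eq is_mu_eq)

text \<open>Henkin sets need not witness their existential members, so quantifiers are stripped in
  the calculus, with the bound variables as eigenvariables. Only a quantifier-free implication is
  left to the model; its variables are passed through equations to keep them opaque.\<close>

lemma der_dnr_fm:
  assumes P: "has_type P (ty1 \<Rrightarrow> ty1)" "tvars P \<inter> udnr_vars = {}"
    and \<Gamma>: "\<And>\<psi>. \<psi> \<in> set \<Gamma> \<Longrightarrow> wff \<psi> \<and> fv \<psi> \<inter> udnr_vars = {}"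
    and sem: "\<And>X A e y s. henkin X \<Longrightarrow> set \<Gamma> \<subseteq> X \<Longrightarrow> A = Var (0, ty1) \<Longrightarrow> e = Var (0, N) \<Longrightarrow> y = Var (1, N) \<Longrightarrow>
      s = Var (2, N) \<Longrightarrow> halt_fm A e y s \<in> X \<Longrightarrow> (P \<cdot> A \<cdot> e \<^bold>= y) \<notin> X"
  shows "\<Gamma> \<turnstile> dnr_fm P"
  unfolding dnr_fm_def
proof (intro derivable.allI)
  let ?A = "Var (0, ty1)" let ?e = "Var (0, N)" let ?y = "Var (1, N)" let ?s = "Var (2, N)"
  have types: "wff (halt_fm ?A ?e ?y ?s)" "wff (P \<cdot> ?A \<cdot> ?e \<^bold>= ?y)" using P by auto
  show "\<Gamma> \<turnstile> dnr_kernel P ?A ?e ?y"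
    unfolding dnr_kernel_def
  proof (intro derivable.impI)
    let ?\<Delta> = "(P \<cdot> ?A \<cdot> ?e \<^bold>= ?y) # Exists (2, N) (halt_fm ?A ?e ?y ?s) # \<Gamma>"
    show "?\<Delta> \<turnstile> \<^bold>\<bottom>"
    proof (rule der_exE)
      show "halt_fm ?A ?e ?y ?s # ?\<Delta> \<turnstile> \<^bold>\<bottom>"
      proof (rule der_semantic)
        fix X assume X: "henkin X" "set (halt_fm ?A ?e ?y ?s # ?\<Delta>) \<subseteq> X"
        then show "\<^bold>\<bottom> \<in> X" using sem[OF X(1)] by auto
      qed (use types \<Gamma> in auto)
    qed (use types \<Gamma> P in auto)
  qed (use types in auto)
qed (use \<Gamma> in auto)

lemma der_mu_fm:
  assumes M: "has_type M ty2" "tvars M \<inter> {(0, ty1), (0, N)} = {}"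
    and \<Gamma>: "\<And>\<psi>. \<psi> \<in> set \<Gamma> \<Longrightarrow> wff \<psi> \<and> fv \<psi> \<inter> {(0, ty1), (0, N)} = {}"
    and sem: "\<And>X f n. henkin X \<Longrightarrow> set \<Gamma> \<subseteq> X \<Longrightarrow> f = Var (0, ty1) \<Longrightarrow> n = Var (0, N) \<Longrightarrow>
      (f \<cdot> n \<^bold>= Zero) \<in> X \<Longrightarrow> (f \<cdot> (M \<cdot> f) \<^bold>= Zero) \<in> X"
  shows "\<Gamma> \<turnstile> mu_fm M"
  unfolding mu_fm_def
proof (intro derivable.allI derivable.impI)
  let ?f = "Var (0, ty1)" let ?n = "Var (0, N)"
  have types: "wff (?f \<cdot> ?n \<^bold>= Zero)" "wff (?f \<cdot> (M \<cdot> ?f) \<^bold>= Zero)" using M by auto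
  let ?\<Delta> = "Exists (0, N) (?f \<cdot> ?n \<^bold>= Zero) # \<Gamma>"
  show "?\<Delta> \<turnstile> ?f \<cdot> (M \<cdot> ?f) \<^bold>= Zero"
  proof (rule derivable.raa)
    show "(\<^bold>\<not> ?f \<cdot> (M \<cdot> ?f) \<^bold>= Zero) # ?\<Delta> \<turnstile> \<^bold>\<bottom>"
    proof (rule der_exE)
      show "(?f \<cdot> ?n \<^bold>= Zero) # (\<^bold>\<not> ?f \<cdot> (M \<cdot> ?f) \<^bold>= Zero) # ?\<Delta> \<turnstile> \<^bold>\<bottom>" (is "?\<Theta> \<turnstile> _")
      proof (rule der_semantic)
        fix X assume X: "henkin X" "set ?\<Theta> \<subseteq> X"
        then show "\<^bold>\<bottom> \<in> X" using sem[OF X(1)] types henkin.imp_iff[OF X(1)] by auto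
      qed (use types \<Gamma> in auto)
    qed (use types \<Gamma> M in auto)
  qed (use types in auto)
qed (use \<Gamma> M in auto)

context henkin
begin

lemma halt_fm_X:
  assumes "has_type A ty1" "has_type e N" "has_type y N" "has_type s N"
  shows "halt_fm A e y s \<in> X \<longleftrightarrow> val (t_rest \<cdot> e \<cdot> (t_config \<cdot> A \<cdot> e \<cdot> e \<cdot> s)) = ze \<and>
    val (t_nth \<cdot> Zero \<cdot> (t_snd \<cdot> (t_config \<cdot> A \<cdot> e \<cdot> e \<cdot> s))) = val y"
  using assms by (simp add: halt_fm_def val_eq_iff del: val_unary val_binary nth_eq)

text \<open>The three quantifiers are instantiated from the outside in, and each term must avoid the
  variables bound further inside. The concrete stage \<open>s\<close> refutes the universal formula
  that the existential premise abbreviates.\<close>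

lemma dnr_fm_inst:
  assumes "dnr_fm P \<in> X" "has_type P (ty1 \<Rrightarrow> ty1)" "tvars P \<inter> udnr_vars = {}"
    and A: "has_type A ty1" "tvars A \<inter> {(0, N), (1, N), (2, N)} = {}"
    and e: "has_type e N" "tvars e \<inter> {(1, N), (2, N)} = {}"
    and y: "has_type y N" "(2, N) \<notin> tvars y"
    and s: "has_type s N" "halt_fm A e y s \<in> X"
  shows "val (P \<cdot> A \<cdot> e) \<noteq> val y"
proof -
  have "forall 0 N (\<lambda>e. forall 1 N (\<lambda>y. dnr_kernel P A e y)) \<in> X"
    using all_inst[OF assms(1)[unfolded dnr_fm_def], of A] A assms(2,3) by simp
  from all_inst[OF this, of e] have "forall 1 N (\<lambda>y. dnr_kernel P A e y) \<in> X"
    using A e assms(2,3) by simp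
  from all_inst[OF this, of y] have "dnr_kernel P A e y \<in> X"
    using A e y assms(2,3) by simp
  moreover have "Forall (2, N) (\<^bold>\<not> halt_fm A e y (Var (2, N))) \<notin> X"
  proof
    assume "Forall (2, N) (\<^bold>\<not> halt_fm A e y (Var (2, N))) \<in> X"
    from all_inst[OF this, of s] show False
      using A e y s by (simp add: free_for_qf)
  qed
  ultimately show ?thesis
    using A e y by (simp add: dnr_kernel_def val_eq_iff has_type_iff[OF assms(2)])
qed

end

text \<open>In \<open>mu_fm\<close> the variable \<open>(0, N)\<close> is bound, so that functions depending on it cannot be
  substituted; the following prenex variant has other bound variables.\<close>

definition mu_fm' :: "trm \<Rightarrow> fm" where
  "mu_fm' M = forall 7 ty1 (\<lambda>f. forall 7 N (\<lambda>n. f \<cdot> n \<^bold>= Zero \<^bold>\<longrightarrow> f \<cdot> (M \<cdot> f) \<^bold>= Zero))"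

lemma der_mu_fm':
  assumes M: "has_type M ty2" "tvars M \<inter> {(0, ty1), (0, N), (7, ty1), (7, N)} = {}"
    and \<Gamma>: "mu_fm M \<in> set \<Gamma>" "\<And>\<psi>. \<psi> \<in> set \<Gamma> \<Longrightarrow> fv \<psi> \<inter> {(7, ty1), (7, N)} = {}"
  shows "\<Gamma> \<turnstile> mu_fm' M"
  unfolding mu_fm'_def
proof (intro derivable.allI derivable.impI)
  let ?f = "Var (7, ty1)" let ?n = "Var (7, N)"
  let ?\<Delta> = "(?f \<cdot> ?n \<^bold>= Zero) # \<Gamma>"
  have "?\<Delta> \<turnstile> mu_fm M" using \<Gamma> by (auto intro: derivable.assm)
  from derivable.allE[OF this[unfolded mu_fm_def], of ?f]
  have "?\<Delta> \<turnstile> exists 0 N (\<lambda>n. ?f \<cdot> n \<^bold>= Zero) \<^bold>\<longrightarrow> ?f \<cdot> (M \<cdot> ?f) \<^bold>= Zero"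
    using M by simp
  moreover have "?\<Delta> \<turnstile> exists 0 N (\<lambda>n. ?f \<cdot> n \<^bold>= Zero)"
    by (rule der_exI[of _ ?n]) (auto intro: derivable.assm)
  ultimately show "?\<Delta> \<turnstile> ?f \<cdot> (M \<cdot> ?f) \<^bold>= Zero" by (rule derivable.impE)
qed (use \<Gamma> M in auto)

lemma mu_to_dnr:
  assumes "is_mu \<in> set \<Gamma>" "\<And>\<psi>. \<psi> \<in> set \<Gamma> \<Longrightarrow> wff \<psi> \<and> fv \<psi> \<subseteq> {mu_var}"
  shows "\<Gamma> \<turnstile> dnr_fm (t_dnr \<cdot> Var mu_var)"
proof (rule der_cut)
  let ?\<mu> = "Var mu_var"
  show "\<Gamma> \<turnstile> mu_fm' ?\<mu>" using assms by (intro der_mu_fm') (auto simp: is_mu_eq dest!: assms(2))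
  show wff: "wff (mu_fm' ?\<mu>)" by (simp add: mu_fm'_def)
  have fv: "fv (mu_fm' ?\<mu>) = {mu_var}" by (auto simp: mu_fm'_def)
  show "mu_fm' ?\<mu> # \<Gamma> \<turnstile> dnr_fm (t_dnr \<cdot> ?\<mu>)"
  proof (rule der_dnr_fm)
    fix \<psi> assume "\<psi> \<in> set (mu_fm' ?\<mu> # \<Gamma>)"
    then have "wff \<psi>" "fv \<psi> \<subseteq> {mu_var}" using assms(2) wff fv by auto
    then show "wff \<psi> \<and> fv \<psi> \<inter> udnr_vars = {}" by auto
  next
    fix X A e y s
    assume X: "henkin X" "set (mu_fm' ?\<mu> # \<Gamma>) \<subseteq> X" and vars: "A = Var (0, ty1)" "e = Var (0, N)"
      "y = Var (1, N)" "s = Var (2, N)" and halt: "halt_fm A e y s \<in> X"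
    interpret henkin X by fact
    have types: "has_type A ty1" "has_type e N" "has_type s N" "has_type y N" using vars by auto
    let ?h = "t_halt \<cdot> A \<cdot> e"
    have h: "has_type ?h ty1" "has_type (?h \<cdot> s) N" "has_type (?h \<cdot> (?\<mu> \<cdot> ?h)) N"
      using types by (simp_all add: vars)
    have "mu_fm' ?\<mu> \<in> X" using X by simp
    from all_inst[OF this[unfolded mu_fm'_def], of ?h]
    have "forall 7 N (\<lambda>n. ?h \<cdot> n \<^bold>= Zero \<^bold>\<longrightarrow> ?h \<cdot> (?\<mu> \<cdot> ?h) \<^bold>= Zero) \<in> X"
      by (simp add: vars)
    from all_inst[OF this, of s] have "(?h \<cdot> s \<^bold>= Zero \<^bold>\<longrightarrow> ?h \<cdot> (?\<mu> \<cdot> ?h) \<^bold>= Zero) \<in> X"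
      by (simp add: vars)
    then have mu: "val (?h \<cdot> s) = ze \<Longrightarrow> val (?h \<cdot> (?\<mu> \<cdot> ?h)) = ze"
      using h by (simp add: val_eq_iff)
    have "val (t_dnr \<cdot> ?\<mu> \<cdot> A \<cdot> e) = su (val y)"
      using dnr_correct[OF types(1,2) _ types(3) mu] halt types by (simp add: halt_fm_X)
    moreover have "su (val y) \<noteq> val y"
      using induct[of "\<lambda>a. su a \<noteq> a" "val y"] by (simp add: definable_intros)
    ultimately show "(t_dnr \<cdot> ?\<mu> \<cdot> A \<cdot> e \<^bold>= y) \<notin> X"
      using types by (simp add: val_eq_iff vars)
  qed auto
qed

section \<open>From diagonal functionals to the mu-operator\<close>

abbreviation "f_var \<equiv> (0, ty1) :: var"
abbreviation "Xi_var \<equiv> (0, Xi_ty) :: var"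

text \<open>With \<Psi> and \<open>f\<close> as free variables, \<open>psi0\<close> is the planted
  value \<open>v\<close>, and \<open>marked\<close> below is the oracle attached to
  \<open>f\<close>.\<close>

definition psi0 :: trm where "psi0 = Var Psi_var \<cdot> t_zeros \<cdot> t_prog"

definition marked :: trm where "marked = t_mark \<cdot> Var f_var \<cdot> psi0"

lemma psi0_simps [simp]: "has_type psi0 \<tau> \<longleftrightarrow> \<tau> = N" "tvars psi0 = {Psi_var}"
  by (auto simp: psi0_def)

lemma marked_simps [simp]: "has_type marked \<tau> \<longleftrightarrow> \<tau> = ty1" "tvars marked = {f_var, Psi_var}"
  by (auto simp: marked_def)

lemma (in henkin) marked_iff:
  assumes "is_UDNR \<in> X"
  shows "(\<exists>n. op1 (Var f_var) n = ze) \<longleftrightarrow> val (Var Psi_var \<cdot> marked \<cdot> t_prog) \<noteq> val psi0"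
  unfolding marked_def
proof (rule mark_diverges)
  fix s assume "has_type s N"
    "val (t_rest \<cdot> t_prog \<cdot> (t_config \<cdot> (t_mark \<cdot> Var f_var \<cdot> psi0) \<cdot> t_prog \<cdot> t_prog \<cdot> s)) = ze"
    "val (t_nth \<cdot> Zero \<cdot> (t_snd \<cdot> (t_config \<cdot> (t_mark \<cdot> Var f_var \<cdot> psi0) \<cdot> t_prog \<cdot> t_prog \<cdot> s))) = val psi0"
  then have "halt_fm marked t_prog psi0 s \<in> X" unfolding marked_def[symmetric]
    by (subst halt_fm_X) auto
  then show "val (Var Psi_var \<cdot> (t_mark \<cdot> Var f_var \<cdot> psi0) \<cdot> t_prog) \<noteq> val psi0"
    unfolding marked_def[symmetric] using assms \<open>has_type s N\<close>
    by (intro dnr_fm_inst) (auto simp: is_UDNR_eq)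
qed (auto simp: psi0_def)

lemma ext_functional_simps [simp]:
  "wff (ext_functional Xi_var Psi_var)" "fv (ext_functional Xi_var Psi_var) = {Xi_var, Psi_var}"
  by (auto simp: ext_functional_def)

lemma dnr_to_mu_explicit:
  "[is_UDNR \<^bold>\<and> ext_functional Xi_var Psi_var] \<turnstile> mu_fm (t_mu \<cdot> Var Psi_var \<cdot> Var Xi_var)"
proof (rule der_mu_fm)
  let ?\<Psi> = "Var Psi_var" and ?\<Xi> = "Var Xi_var"
  fix X f n
  assume X: "henkin X" "set [is_UDNR \<^bold>\<and> ext_functional Xi_var Psi_var] \<subseteq> X"
    and vars: "f = Var (0, ty1)" "n = Var (0, N)" and fn: "(f \<cdot> n \<^bold>= Zero) \<in> X"
  interpret henkin X by fact
  have U: "is_UDNR \<in> X" and E: "ext_functional Xi_var Psi_var \<in> X" using X(2) by auto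
  define m where "m = ?\<Xi> \<cdot> marked \<cdot> t_zeros \<cdot> (Succ \<cdot> t_prog)"
  have m: "has_type m N" by (simp add: m_def)
  have "val (f \<cdot> n) = ze" using fn by (simp add: val_eq_iff vars)
  then have "\<exists>n. op1 (Var f_var) n = ze" using vars val_op1[of f n] by auto
  then have neq: "val (?\<Psi> \<cdot> marked \<cdot> t_prog) \<noteq> val (?\<Psi> \<cdot> t_zeros \<cdot> t_prog)"
    using marked_iff[OF U] by (simp add: psi0_def)
  let ?ext = "\<lambda>k f g. t_bar \<cdot> f \<cdot> (?\<Xi> \<cdot> f \<cdot> g \<cdot> k) \<^bold>= t_bar \<cdot> g \<cdot> (?\<Xi> \<cdot> f \<cdot> g \<cdot> k) \<^bold>\<longrightarrow>
     t_bar \<cdot> (?\<Psi> \<cdot> f) \<cdot> k \<^bold>= t_bar \<cdot> (?\<Psi> \<cdot> g) \<cdot> k"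
  have "forall 0 ty1 (\<lambda>f. forall 1 ty1 (\<lambda>g. ?ext (Succ \<cdot> t_prog) f g)) \<in> X"
    using all_inst[OF E[unfolded ext_functional_def], of "Succ \<cdot> t_prog"] by simp
  from all_inst[OF this, of marked] have "forall 1 ty1 (\<lambda>g. ?ext (Succ \<cdot> t_prog) marked g) \<in> X"
    by simp
  from all_inst[OF this, of t_zeros] have "?ext (Succ \<cdot> t_prog) marked t_zeros \<in> X"
    by simp
  then have "val (t_bar \<cdot> marked \<cdot> m) = val (t_bar \<cdot> t_zeros \<cdot> m) \<Longrightarrow>
      val (t_bar \<cdot> (?\<Psi> \<cdot> marked) \<cdot> (Succ \<cdot> t_prog)) = val (t_bar \<cdot> (?\<Psi> \<cdot> t_zeros) \<cdot> (Succ \<cdot> t_prog))"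
    by (simp add: val_eq_iff m_def)
  \<comment> \<open>Different entries at \<open>e\<close> make the segments of length
    \<open>e + 1\<close> differ. Read contrapositively, the extensionality functional then makes the
    oracles differ below \<open>m\<close>, which bounds the search.\<close>
  with neq have "val (t_bar \<cdot> marked \<cdot> m) \<noteq> val (t_bar \<cdot> t_zeros \<cdot> m)"
    using bar_eqD[of "?\<Psi> \<cdot> marked" "?\<Psi> \<cdot> t_zeros" t_prog] by auto
  then have "val (f \<cdot> (t_search \<cdot> f \<cdot> m \<cdot> m)) = ze"
    using m by (intro search_finds[of f psi0]) (auto simp: marked_def vars)
  moreover have "val (t_mu \<cdot> ?\<Psi> \<cdot> ?\<Xi> \<cdot> f) = val (t_search \<cdot> f \<cdot> m \<cdot> m)"
    by (simp add: t_mu_def Let_def m_def marked_def psi0_def vars)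
  ultimately show "(f \<cdot> (t_mu \<cdot> ?\<Psi> \<cdot> ?\<Xi> \<cdot> f) \<^bold>= Zero) \<in> X"
    using m by (simp add: val_eq_iff vars val_op1[of "Var (0, ty1)"])
qed auto

lemma dnr_to_mu:
  assumes "is_UDNR \<in> set \<Gamma>" "\<And>\<psi>. \<psi> \<in> set \<Gamma> \<Longrightarrow> wff \<psi> \<and> fv \<psi> \<subseteq> {Psi_var}"
  shows "\<Gamma> \<turnstile> mu2"
proof -
  define ac where "ac n = (\<^bold>\<not> (Var Psi_var \<cdot> marked \<cdot> t_prog \<^bold>= psi0) \<^bold>\<longrightarrow> Var f_var \<cdot> n \<^bold>= Zero)" for n
  let ?n = "Var (0, N)" and ?F = "Var mu_var"
  have ac: "qf (ac n)" "wff (ac n) \<longleftrightarrow> has_type n N" "fv (ac n) = {f_var, Psi_var} \<union> tvars n"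
    "subst (ac ?n) (0, N) n = ac n" for n
    by (auto simp: ac_def)
  have "\<Gamma> \<turnstile> Forall f_var (Exists (0, N) (ac ?n))"
  proof (intro derivable.allI der_notI)
    let ?\<Delta> = "Forall (0, N) (\<^bold>\<not> ac ?n) # \<Gamma>"
    show "?\<Delta> \<turnstile> \<^bold>\<bottom>"
    proof (rule der_semantic)
      fix X assume X: "henkin X" "set ?\<Delta> \<subseteq> X"
      interpret henkin X by fact
      have U: "is_UDNR \<in> X" using assms X by auto
      have nac: "ac n \<notin> X" if "has_type n N" for n
      proof -
        have "subst (\<^bold>\<not> ac ?n) (0, N) n \<in> X"
          using X(2) that ac by (intro all_inst) (auto simp: free_for_qf)
        then show ?thesis using ac that by simp
      qed
      \<comment> \<open>If the choice premise fails for every \<open>n\<close>, then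
        \<open>f\<close> has no zero; yet a single failure, taken at 0, already gives the inequality
        that by \<open>marked_iff\<close> provides one.\<close>
      have "op1 (Var f_var) a \<noteq> ze" for a
        using nac[of "nm a"] by (auto simp: ac_def val_eq_iff val_op1)
      moreover have "val (Var Psi_var \<cdot> marked \<cdot> t_prog) \<noteq> val psi0"
        using nac[of Zero] by (auto simp: ac_def val_eq_iff)
      ultimately show "\<^bold>\<bottom> \<in> X" using marked_iff[OF U] by blast
    qed (use assms ac in auto)
  qed (use assms ac in auto)
  moreover have "\<Gamma> \<turnstile> Forall f_var (Exists (0, N) (ac ?n)) \<^bold>\<longrightarrow>
      Exists mu_var (Forall f_var (subst (ac ?n) (0, N) (?F \<cdot> Var f_var)))"
    using ac by (intro derivable.axiom UnI2 QF_AC10.intros) auto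
  ultimately have choice: "\<Gamma> \<turnstile> Exists mu_var (Forall f_var (ac (?F \<cdot> Var f_var)))"
    unfolding ac by (rule derivable.impE[rotated])
  show ?thesis unfolding mu2_def
  proof (rule der_cut[OF choice], simp add: ac, rule der_notI)
    let ?A = "Forall f_var (ac (?F \<cdot> Var f_var))"
    let ?\<Delta> = "Forall mu_var (\<^bold>\<not> is_mu) # Exists mu_var ?A # \<Gamma>"
    have fv: "mu_var \<notin> fv \<psi>" "f_var \<notin> fv \<psi>" "(0, N) \<notin> fv \<psi>" if "\<psi> \<in> set \<Gamma>" for \<psi>
      using assms(2)[OF that] by auto
    show "?\<Delta> \<turnstile> \<^bold>\<bottom>"
    proof (rule der_exE)
      have "?A # ?\<Delta> \<turnstile> subst (\<^bold>\<not> is_mu) mu_var ?F"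
        by (intro derivable.allE derivable.assm) (auto intro: free_for_is_mu)
      moreover have "?A # ?\<Delta> \<turnstile> mu_fm ?F"
      proof (rule der_mu_fm)
        fix X f n
        assume X: "henkin X" "set (?A # ?\<Delta>) \<subseteq> X"
          and vars: "f = Var (0, ty1)" "n = Var (0, N)" and fn: "(f \<cdot> n \<^bold>= Zero) \<in> X"
        interpret henkin X by fact
        have U: "is_UDNR \<in> X" using assms X by auto
        have "val (f \<cdot> n) = ze" using fn by (simp add: val_eq_iff vars)
        then have "\<exists>n. op1 (Var f_var) n = ze" using vars val_op1[of f n] by auto
        then have neq: "val (Var Psi_var \<cdot> marked \<cdot> t_prog) \<noteq> val psi0"
          using marked_iff[OF U] by simp
        have "subst (ac (?F \<cdot> Var f_var)) f_var (Var f_var) \<in> X"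
          using X(2) ac by (intro all_inst) (auto simp: free_for_qf)
        with neq show "(f \<cdot> (?F \<cdot> f) \<^bold>= Zero) \<in> X"
          by (simp add: ac_def vars val_eq_iff)
      qed (use assms fv ac in auto)
      ultimately show "?A # ?\<Delta> \<turnstile> \<^bold>\<bottom>" by (simp add: is_mu_eq derivable.impE)
    qed (use assms ac fv in auto)
  qed simp
qed

text \<open>Both implications are stated over arbitrary closed contexts so that they can be used
  below further assumptions without weakening.\<close>

lemma mu2_imp_UDNR:
  assumes "\<And>\<psi>. \<psi> \<in> set \<Gamma> \<Longrightarrow> wff \<psi> \<and> fv \<psi> = {}"
  shows "\<Gamma> \<turnstile> mu2 \<^bold>\<longrightarrow> UDNR"
  unfolding mu2_def UDNR_def
proof (intro derivable.impI)
  let ?\<Delta> = "Forall Psi_var (\<^bold>\<not> is_UDNR) # Exists mu_var is_mu # \<Gamma>"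
  show "?\<Delta> \<turnstile> \<^bold>\<bottom>"
  proof (rule der_exE)
    have "is_mu # ?\<Delta> \<turnstile> subst (\<^bold>\<not> is_UDNR) Psi_var (t_dnr \<cdot> Var mu_var)"
      by (intro derivable.allE derivable.assm) (auto intro!: free_for_is_UDNR)
    moreover have "is_mu # ?\<Delta> \<turnstile> dnr_fm (t_dnr \<cdot> Var mu_var)"
      using assms by (intro mu_to_dnr) auto
    ultimately show "is_mu # ?\<Delta> \<turnstile> \<^bold>\<bottom>" by (simp add: subst_is_UDNR derivable.impE)
  qed (use assms in auto)
qed auto

lemma UDNR_imp_mu2:
  assumes "\<And>\<psi>. \<psi> \<in> set \<Gamma> \<Longrightarrow> wff \<psi> \<and> fv \<psi> = {}"
  shows "\<Gamma> \<turnstile> UDNR \<^bold>\<longrightarrow> mu2"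
proof (rule derivable.impI)
  let ?\<Delta> = "(\<^bold>\<not> mu2) # UDNR # \<Gamma>"
  have mu2: "wff mu2" "fv mu2 = {}" by (auto simp: mu2_def)
  have UDNR: "wff UDNR" "fv UDNR = {}" by (auto simp: UDNR_def)
  show "UDNR # \<Gamma> \<turnstile> mu2"
  \<comment> \<open>\<open>der_exE\<close> opens an existential formula only on the way to falsity;
    as \<open>mu2\<close> is closed, its negation does not obstruct the eigenvariable.\<close>
  proof (rule derivable.raa)
    show "?\<Delta> \<turnstile> \<^bold>\<bottom>"
    proof (rule der_exE)
      have "is_UDNR # ?\<Delta> \<turnstile> mu2" using assms mu2 UDNR by (intro dnr_to_mu) auto
      then show "is_UDNR # ?\<Delta> \<turnstile> \<^bold>\<bottom>" by (rule derivable.impE[OF derivable.assm, rotated]) simp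
    qed (use assms mu2 UDNR in \<open>auto simp: UDNR_def\<close>)
  qed fact
qed (auto simp: UDNR_def)

theorem corollary3p4:
  shows "RCA\<^sub>0\<^sup>\<omega> \<turnstile> (UDNR \<^bold>\<longleftrightarrow> mu2) \<and>
    explicit_imp Psi_var is_UDNR mu_var is_mu \<and>
    explicit_imp mu_var is_mu Psi_var is_UDNR"
proof (intro conjI)
  \<comment> \<open>A conjunction abbreviates the negation of an implication to a negation, so both
    halves are derived under that single assumption.\<close>
  have "[(UDNR \<^bold>\<longrightarrow> mu2) \<^bold>\<longrightarrow> \<^bold>\<not> (mu2 \<^bold>\<longrightarrow> UDNR)] \<turnstile> \<^bold>\<bottom>"
    by (rule derivable.impE[OF derivable.impE[OF derivable.assm UDNR_imp_mu2] mu2_imp_UDNR])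
      (auto simp: UDNR_def mu2_def)
  then show "RCA\<^sub>0\<^sup>\<omega> \<turnstile> (UDNR \<^bold>\<longleftrightarrow> mu2)"
    unfolding RCA0w_def by (rule der_notI[rotated]) (simp add: UDNR_def mu2_def)
next
  let ?U = "is_UDNR \<^bold>\<and> ext_functional Xi_var Psi_var"
  \<comment> \<open>This direction uses the alternative of \<open>explicit_imp\<close> with an
    extensionality functional; the converse has a witnessing term in the mu-operator alone.\<close>
  have "RCA\<^sub>0\<^sup>\<omega> \<turnstile> Forall Psi_var (Forall Xi_var (?U \<^bold>\<longrightarrow> mu_fm (t_mu \<cdot> Var Psi_var \<cdot> Var Xi_var)))"
    unfolding RCA0w_def
    by (intro derivable.allI derivable.impI dnr_to_mu_explicit) simp_all
  then show "explicit_imp Psi_var is_UDNR mu_var is_mu"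
    unfolding explicit_imp_def
    using UDNR_imp_mu2[of "[]"]
    by (auto simp: RCA0w_def subst_is_mu UDNR_def mu2_def intro!: exI[of _ t_mu] exI[of _ Xi_var] free_for_is_mu)
next
  have "RCA\<^sub>0\<^sup>\<omega> \<turnstile> Forall mu_var (is_mu \<^bold>\<longrightarrow> dnr_fm (t_dnr \<cdot> Var mu_var))"
    unfolding RCA0w_def by (intro derivable.allI derivable.impI mu_to_dnr) auto
  then show "explicit_imp mu_var is_mu Psi_var is_UDNR"
    unfolding explicit_imp_def
    using mu2_imp_UDNR[of "[]"]
    by (auto simp: RCA0w_def subst_is_UDNR UDNR_def mu2_def intro!: exI[of _ t_dnr] free_for_is_UDNR)
qed

end
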